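(* Let $\tau>0$ and let $E,A,B\in\mathbb{C}^{n,n}$ be pairwise commuting. Assume the IVP for the DDAE $E\dot x(t)=Ax(t)+Bx(t-\tau)+f(t)$, $t\ge0$, $x|_{[-\tau,0]}=\varphi$, is uniquely solvable, and that initial functions are sufficiently smooth. Let $U\in\mathbb{C}^{n,n}$ be nonsingular with $UEU^{-1}=\mathrm{diag}(J^E,N^E_2,N^E_3,N^E_4)$, $UAU^{-1}=\mathrm{diag}(A_1,J^A,N^A_3,N^A_4)$, $UBU^{-1}=\mathrm{diag}(B_1,B_2,J^B,N^B_4)$, where $J^E,J^A,J^B$ are nonsingular and the $N$-blocks are nilpotent. Consider the homogeneous DDAE $E\dot x(t)=Ax(t)+Bx(t-\tau)$ and let $\sigma(E,A,B)=\{\lambda\in\mathbb{C}:\det(\lambda E-A-e^{-\lambda\tau}B)=0\}$. Then: (i) if $\sigma(E,A,B)\subseteq\mathbb{C}_-$ and $N^E_2=0$, the null solution of the homogeneous DDAE is exponentially stable; (ii) if $\sigma(E,A,B)\subseteq\mathbb{C}_-$, the null solution is $C^\zeta$-weakly exponentially stable, where $\zeta$ is the nilpotency index of $N^E_2$.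
   Context: $\mathbb{C}_-=\{\lambda:\mathrm{Re}\,\lambda<0\}$. Solutions are piecewise differentiable: continuous $x$ with $Ex$ piecewise continuously differentiable satisfying the equation for all $t\in[0,\infty)\setminus\bigcup_{j\in\mathbb{N}_0}\{j\tau\}$; an initial function is consistent if the IVP has a solution. For $0\le p\le\infty$, $\|\varphi\|_{C^p}=\sum_{i=0}^p\sup_{t\in[-\tau,0]}\|\varphi^{(i)}(t)\|$. The null solution is exponentially stable if there are $\delta,\gamma>0$ with $\|x(t)\|\le\delta e^{-\gamma t}\sup_{[-\tau,0]}\|\varphi\|$ for all $t\ge0$ and all consistent continuous $\varphi$; it is $C^p$-weakly exponentially stable if there are $\delta,\gamma>0$ with $\|x(t)\|\le\delta e^{-\gamma t}\|\varphi\|_{C^p}$ for all $t\ge0$ and all consistent $\varphi\in C^p([-\tau,0],\mathbb{C}^n)$. *)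

theory Defs
  imports "HOL-Analysis.Analysis" "Jordan_Normal_Form.Jordan_Normal_Form"
begin

definition vnorm :: "complex vec \<Rightarrow> real" where
  "vnorm v = sqrt (\<Sum>i<dim_vec v. (cmod (v $ i))^2)"

definition has_vec_deriv ::
  "nat \<Rightarrow> (real \<Rightarrow> complex vec) \<Rightarrow> complex vec \<Rightarrow> real \<Rightarrow> real set \<Rightarrow> bool" where
  "has_vec_deriv n u d t S \<longleftrightarrow> d \<in> carrier_vec n \<and>
     (\<forall>i<n. ((\<lambda>s. u s $ i) has_vector_derivative (d $ i)) (at t within S))"

definition vcont_on :: "nat \<Rightarrow> real set \<Rightarrow> (real \<Rightarrow> complex vec) \<Rightarrow> bool" where
  "vcont_on n S u \<longleftrightarrow> (\<forall>i<n. continuous_on S (\<lambda>s. u s $ i))"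

definition ddae_solution ::
  "nat \<Rightarrow> complex mat \<Rightarrow> complex mat \<Rightarrow> complex mat \<Rightarrow> real \<Rightarrow> (real \<Rightarrow> complex vec)
   \<Rightarrow> (real \<Rightarrow> complex vec) \<Rightarrow> (real \<Rightarrow> complex vec) \<Rightarrow> bool" where
  "ddae_solution n E A B \<tau> f \<phi> x \<longleftrightarrow>
     (\<forall>t\<ge>-\<tau>. x t \<in> carrier_vec n) \<and>
     (\<forall>t\<in>{-\<tau>..0}. x t = \<phi> t) \<and>
     vcont_on n {-\<tau>..} x \<and>
     (\<forall>j::nat. \<exists>g. vcont_on n {real j * \<tau> .. real (Suc j) * \<tau>} g \<and>
        (\<forall>t\<in>{real j * \<tau> .. real (Suc j) * \<tau>}.
           has_vec_deriv n (\<lambda>s. E *\<^sub>v x s) (g t) t {real j * \<tau> .. real (Suc j) * \<tau>})) \<and>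
     (\<forall>t\<ge>0. (\<forall>j::nat. t \<noteq> real j * \<tau>) \<longrightarrow>
        has_vec_deriv n (\<lambda>s. E *\<^sub>v x s) (A *\<^sub>v x t + B *\<^sub>v x (t - \<tau>) + f t) t UNIV)"

definition consistent_init ::
  "nat \<Rightarrow> complex mat \<Rightarrow> complex mat \<Rightarrow> complex mat \<Rightarrow> real \<Rightarrow> (real \<Rightarrow> complex vec)
   \<Rightarrow> (real \<Rightarrow> complex vec) \<Rightarrow> bool" where
  "consistent_init n E A B \<tau> f \<phi> \<longleftrightarrow> (\<exists>x. ddae_solution n E A B \<tau> f \<phi> x)"

definition exp_stable ::
  "nat \<Rightarrow> complex mat \<Rightarrow> complex mat \<Rightarrow> complex mat \<Rightarrow> real \<Rightarrow> bool" where
  "exp_stable n E A B \<tau> \<longleftrightarrow> (\<exists>\<delta>>0. \<exists>\<gamma>>0. \<forall>\<phi> x.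
     vcont_on n {-\<tau>..0} \<phi> \<longrightarrow> ddae_solution n E A B \<tau> (\<lambda>_. 0\<^sub>v n) \<phi> x \<longrightarrow>
     (\<forall>t\<ge>0. vnorm (x t) \<le> \<delta> * exp (-\<gamma> * t) * (SUP s\<in>{-\<tau>..0}. vnorm (\<phi> s))))"

text \<open>D 0 is a C^p function on [-tau,0] with derivatives D 1, ..., D p
  (one-sided at the end points).\<close>
definition Cp_family :: "nat \<Rightarrow> real \<Rightarrow> nat \<Rightarrow> (nat \<Rightarrow> real \<Rightarrow> complex vec) \<Rightarrow> bool" where
  "Cp_family n \<tau> p D \<longleftrightarrow> (\<forall>i\<le>p. vcont_on n {-\<tau>..0} (D i)) \<and>
     (\<forall>i<p. \<forall>t\<in>{-\<tau>..0}. has_vec_deriv n (D i) (D (Suc i) t) t {-\<tau>..0})"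

definition Cp_norm :: "real \<Rightarrow> nat \<Rightarrow> (nat \<Rightarrow> real \<Rightarrow> complex vec) \<Rightarrow> real" where
  "Cp_norm \<tau> p D = (\<Sum>i\<le>p. SUP t\<in>{-\<tau>..0}. vnorm (D i t))"

definition weak_exp_stable ::
  "nat \<Rightarrow> complex mat \<Rightarrow> complex mat \<Rightarrow> complex mat \<Rightarrow> real \<Rightarrow> nat \<Rightarrow> bool" where
  "weak_exp_stable n E A B \<tau> p \<longleftrightarrow> (\<exists>\<delta>>0. \<exists>\<gamma>>0. \<forall>D x.
     Cp_family n \<tau> p D \<longrightarrow> ddae_solution n E A B \<tau> (\<lambda>_. 0\<^sub>v n) (D 0) x \<longrightarrow>
     (\<forall>t\<ge>0. vnorm (x t) \<le> \<delta> * exp (-\<gamma> * t) * Cp_norm \<tau> p D))"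

definition ddae_spectrum :: "complex mat \<Rightarrow> complex mat \<Rightarrow> complex mat \<Rightarrow> real \<Rightarrow> complex set" where
  "ddae_spectrum E A B \<tau> =
     {z. det (z \<cdot>\<^sub>m E - A - exp (- z * complex_of_real \<tau>) \<cdot>\<^sub>m B) = 0}"

definition nilpotent_mat :: "complex mat \<Rightarrow> bool" where
  "nilpotent_mat N \<longleftrightarrow> (\<exists>k. N ^\<^sub>m k = 0\<^sub>m (dim_row N) (dim_col N))"

definition nilpotency_index :: "complex mat \<Rightarrow> nat" where
  "nilpotency_index N = (LEAST k. N ^\<^sub>m k = 0\<^sub>m (dim_row N) (dim_col N))"

end

theory Submission
  imports Defs "HOL-Complex_Analysis.Complex_Analysis" "Jordan_Normal_Form.Schur_Decomposition"
begin

text \<open>Restricted to the rows of \<open>U\<close> belonging to one diagonal block, the equation splits into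
  four independent ones. The fourth block is empty, since commuting nilpotent matrices have a
  common kernel vector, which would put every \<open>\<lambda>\<close> into the spectrum. The third block reads
  \<open>y(t - \<tau>) = (P y)' - Q y\<close> with commuting nilpotent \<open>P\<close> and \<open>Q\<close>, so \<open>y = 0\<close>.
  The second one reads \<open>y(t) = - D y(t - \<tau>) + (R y)'\<close> with \<open>R\<close> nilpotent of index \<open>\<zeta>\<close>; the spectral
  condition says that all eigenvalues of \<open>D\<close> have modulus less than 1, and each multiplication by \<open>R\<close> costs one
  derivative. The first one reads \<open>y' = A y + B y(t - \<tau>)\<close> with \<open>A B = B A\<close> and reduces to
  scalar equations \<open>y' = a y + b y(t - \<tau>) + g\<close> without triangularising: if some root \<open>\<lambda>\<close> of
  \<open>\<lambda> = a + b exp(- \<lambda> \<tau>)\<close> has \<open>Re \<lambda> \<ge> 0\<close>, then \<open>\<lambda> - A - exp(- \<lambda> \<tau>) B\<close> is invertible, and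
  \<open>y\<close> is controlled by \<open>(A - a) y\<close> and \<open>(B - b) y\<close>.

  For the scalar equation, variation of constants on \<open>[n \<tau>, (n + 1) \<tau>]\<close> gives a discrete Volterra
  equation for \<open>y(n \<tau>)\<close> with generating function \<open>1 - z exp((a + b z) \<tau>)\<close>. This entire function has no
  zeros in a disc of radius greater than 1, so the Taylor coefficients of its reciprocal decay
  geometrically.\<close>

section \<open>The characteristic function of a scalar delay equation\<close>

text \<open>The eigenvalues of \<open>A\<close> and \<open>B\<close> come as two lists without a
  pairing. A pair \<open>(a, b)\<close> may belong to no common eigenvector, and its scalar
  characteristic equation may have roots in the closed right half-plane although the spectrum has
  none. For such a root \<open>\<lambda>\<close> the invertible matrix named above equals
  \<open>- (A - a) - exp (- \<lambda> \<tau>) (B - b)\<close>, so it maps \<open>y\<close> to a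
  combination of functions already under control.

  Two requirements shape the rest. The constants must not depend on the initial function, so decay
  is made a property of a whole family of solutions; it is stable under linear operations, and the
  inductions over matrices carry no constants. And the equation holds only off the multiples of
  \<open>\<tau>\<close>, so the estimates live on an open set of times and reach the grid by
  continuity at the end.

  In the algebraic block an eigenvector of \<open>D\<close> can be moved into the kernel of
  \<open>E\<close>, where \<open>\<lambda> E\<close> vanishes and the spectral condition only
  concerns \<open>exp (- \<lambda> \<tau>)\<close>. Both claims are instances of one: if the power
  \<open>p + 1\<close> of the nilpotent block is zero, \<open>C^p\<close>-weak stability
  holds.\<close>

definition delay_char_fps :: "complex \<Rightarrow> complex \<Rightarrow> real \<Rightarrow> complex fps" where
  "delay_char_fps a b \<tau> = 1 - fps_X * (fps_const (exp (a * \<tau>)) * fps_exp (b * \<tau>))"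

lemma fps_conv_radius_delay_char: "fps_conv_radius (delay_char_fps a b \<tau>) = \<infinity>"
proof -
  have 1: "fps_conv_radius (fps_const (exp (a * \<tau>)) * fps_exp (b * \<tau>)) = \<infinity>"
    using fps_conv_radius_mult[of "fps_const (exp (a * \<tau>))" "fps_exp (b * \<tau>)"] by simp
  have 2: "fps_conv_radius (fps_X * (fps_const (exp (a * \<tau>)) * fps_exp (b * \<tau>))) = \<infinity>"
    using fps_conv_radius_mult[of fps_X "fps_const (exp (a * \<tau>)) * fps_exp (b * \<tau>)"] 1 by simp
  show ?thesis
    unfolding delay_char_fps_def
    using fps_conv_radius_diff[of 1 "fps_X * (fps_const (exp (a * \<tau>)) * fps_exp (b * \<tau>))"] 2
    by simp
qed

lemma eval_fps_delay_char:
  "eval_fps (delay_char_fps a b \<tau>) z = 1 - z * exp ((a + b * z) * \<tau>)"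
proof -
  have 1: "fps_conv_radius (fps_const (exp (a * \<tau>)) * fps_exp (b * \<tau>)) = \<infinity>"
    using fps_conv_radius_mult[of "fps_const (exp (a * \<tau>))" "fps_exp (b * \<tau>)"] by simp
  have 2: "fps_conv_radius (fps_X * (fps_const (exp (a * \<tau>)) * fps_exp (b * \<tau>))) = \<infinity>"
    using fps_conv_radius_mult[of fps_X "fps_const (exp (a * \<tau>)) * fps_exp (b * \<tau>)"] 1 by simp
  show ?thesis
    unfolding delay_char_fps_def using 1 2
    by (simp add: eval_fps_diff eval_fps_mult exp_add algebra_simps)
qed

lemma delay_char_fps_nth_0: "fps_nth (delay_char_fps a b \<tau>) 0 = 1"
  by (simp add: delay_char_fps_def)

text \<open>With the opposite sign this is the weight of \<open>u (n - k)\<close> in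
  \<open>u (n + 1)\<close> for the equation without forcing and history, where \<open>u n\<close> is
  the value of the solution at \<open>n \<tau>\<close>. Convolving the series with \<open>u\<close>
  therefore measures the effect of forcing and history.\<close>

lemma delay_char_fps_nth_Suc:
  "fps_nth (delay_char_fps a b \<tau>) (Suc k) = - exp (a * \<tau>) * ((b * \<tau>) ^ k / fact k)"
  by (simp add: delay_char_fps_def)

text \<open>With \<open>z = exp (- \<lambda> \<tau>)\<close> the zeros of \<open>1 - z exp ((a + b z) \<tau>)\<close> are the
  characteristic roots, and \<open>Re \<lambda> < 0\<close> becomes \<open>norm z > 1\<close>.\<close>

lemma inverse_delay_char_coeffs:
  fixes a b :: complex
  assumes tau: "\<tau> > 0"
    and roots: "\<And>l. l = a + b * exp (- l * \<tau>) \<Longrightarrow> Re l < 0"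
  obtains C r where "C \<ge> 0" "0 < r" "r < 1"
    "\<And>n. cmod (fps_nth (inverse (delay_char_fps a b \<tau>)) n) \<le> C * r ^ n"
proof -
  define F where "F = delay_char_fps a b \<tau>"
  define d where "d = (\<lambda>z::complex. 1 - z * exp ((a + b * z) * \<tau>))"
  have big: "norm z > 1" if "d z = 0" for z
  proof -
    define l where "l = a + b * z"
    have "z * exp (l * \<tau>) = 1" using that by (simp add: d_def l_def)
    hence z: "z = exp (- l * \<tau>)"
      by (simp add: exp_minus field_simps)
    hence "l = a + b * exp (- l * \<tau>)" by (simp add: l_def)
    hence "Re l < 0" by (rule roots)
    hence "- Re l * \<tau> > 0" using tau by (simp add: mult_neg_pos)
    thus ?thesis by (subst z) (simp)
  qed
  \<comment> \<open>Each zero lies outside the closed unit disc, but a uniform gap is needed. The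
    zeros in the closed disc of radius 2 form a compact set, so one of them is nearest to the origin
    and its modulus serves as \<open>R\<close>; without such zeros \<open>R = 2\<close>
    does.\<close>
  have "\<exists>R>1. \<forall>z. norm z < R \<longrightarrow> d z \<noteq> 0"
  proof (cases "{z. d z = 0} \<inter> cball 0 2 = {}")
    case True
    thus ?thesis by (intro exI[of _ 2]) (auto simp: disjoint_iff)
  next
    case False
    have "closed {z. d z = 0}"
      unfolding d_def by (intro closed_Collect_eq continuous_intros)
    hence "compact ({z. d z = 0} \<inter> cball 0 2)"
      by (simp add: closed_Int_compact)
    then obtain m where m: "m \<in> {z. d z = 0} \<inter> cball 0 2"
      "\<And>z. z \<in> {z. d z = 0} \<inter> cball 0 2 \<Longrightarrow> norm m \<le> norm z"
      using continuous_attains_inf[of _ norm] False continuous_on_norm_id by metis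
    have "norm m > 1" using m(1) big by auto
    moreover have "d z \<noteq> 0" if "norm z < norm m" for z
      using m(2)[of z] m(1) that by fastforce
    ultimately show ?thesis by blast
  qed
  then obtain R where R: "R > 1" "\<And>z. norm z < R \<Longrightarrow> d z \<noteq> 0" by blast
  \<comment> \<open>A radius strictly between 1 and \<open>R\<close>: there the series of the
    reciprocal converges, so its terms are bounded, which is decay of the coefficients with ratio
    \<open>1 / r\<close>.\<close>
  define r where "r = (1 + R) / 2"
  have r: "1 < r" "r < R" using R(1) by (auto simp: r_def)
  have "fps_conv_radius (inverse F) \<ge> min (ereal R) (fps_conv_radius F)"
    by (rule fps_conv_radius_inverse) (use R(2) in \<open>auto simp: F_def eval_fps_delay_char d_def\<close>)
  hence rad: "fps_conv_radius (inverse F) \<ge> ereal R"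
    by (simp add: F_def fps_conv_radius_delay_char)
  have "ereal (norm (of_real r :: complex)) < fps_conv_radius (inverse F)"
    using r rad by (intro less_le_trans[OF _ rad]) auto
  hence "summable (\<lambda>n. fps_nth (inverse F) n * of_real r ^ n)"
    by (intro summable_in_conv_radius) (simp add: fps_conv_radius_def)
  hence "Bseq (\<lambda>n. fps_nth (inverse F) n * of_real r ^ n)"
    using summable_LIMSEQ_zero convergent_imp_Bseq convergent_def by blast
  then obtain C where C: "C > 0" "\<And>n. norm (fps_nth (inverse F) n * of_real r ^ n) \<le> C"
    by (auto simp: Bseq_def)
  show thesis
  proof (rule that[of C "1 / r"])
    show "cmod (fps_nth (inverse (delay_char_fps a b \<tau>)) n) \<le> C * (1 / r) ^ n" for n
      using C(2)[of n] r by (simp add: norm_mult norm_power F_def power_one_over field_simps)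
  qed (use C r in auto)
qed

section \<open>Geometric decay through inversion of formal power series\<close>

lemma linear_times_power_le_sqrt_power:
  fixes x :: real
  assumes "0 < x" "x < 1"
  obtains D where "D \<ge> 0" "\<And>n. (real n + 1) * x ^ n \<le> D * sqrt x ^ n"
proof -
  have s: "0 < sqrt x" "sqrt x < 1" using assms by auto
  have "(\<lambda>n. of_nat n * sqrt x ^ n + sqrt x ^ n) \<longlonglongrightarrow> 0 + 0"
    using s by (intro tendsto_add powser_times_n_limit_0 LIMSEQ_power_zero) auto
  hence "Bseq (\<lambda>n. of_nat n * sqrt x ^ n + sqrt x ^ n)"
    using convergent_imp_Bseq convergent_def by blast
  then obtain D where D: "D > 0" "\<And>n. norm (of_nat n * sqrt x ^ n + sqrt x ^ n) \<le> D"
    by (auto simp: Bseq_def)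
  show thesis
  proof (rule that)
    fix n
    have x: "sqrt x ^ n * sqrt x ^ n = x ^ n"
      using assms by (simp flip: power_mult_distrib)
    \<comment> \<open>One half of the exponent absorbs the linear factor, the other half remains as
      the rate.\<close>
    have "(real n + 1) * x ^ n = (real n * sqrt x ^ n + sqrt x ^ n) * sqrt x ^ n"
      using x by (simp add: algebra_simps)
    also have "\<dots> \<le> D * sqrt x ^ n"
      using D(2)[of n] s by (intro mult_right_mono) auto
    finally show "(real n + 1) * x ^ n \<le> D * sqrt x ^ n" .
  qed (use D in auto)
qed

text \<open>\<open>u\<close> is recovered as \<open>inverse F * (F * u)\<close> among formal power
  series, so its growth need not be known beforehand. Convolving two sequences of ratio at most
  \<open>max r \<theta>\<close> costs a factor \<open>n + 1\<close>, and passing to the square root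
  of the ratio pays for it. \<open>D\<close> is fixed before \<open>u\<close> and \<open>K\<close>,
  as uniform stability demands.\<close>

lemma convolution_inverse_decay:
  fixes F :: "complex fps" and C r \<theta> :: real
  assumes "fps_nth F 0 \<noteq> 0" and "C \<ge> 0" "0 < r" "r < 1" "0 < \<theta>" "\<theta> < 1"
    and inv: "\<And>n. cmod (fps_nth (inverse F) n) \<le> C * r ^ n"
  obtains D where "D \<ge> 0"
    "\<And>u K n. K \<ge> 0 \<Longrightarrow> (\<And>n. cmod (\<Sum>k\<le>n. fps_nth F k * u (n - k)) \<le> K * \<theta> ^ n) \<Longrightarrow>
       cmod (u n) \<le> D * K * sqrt (max r \<theta>) ^ n"
proof -
  define x where "x = max r \<theta>"
  have x: "0 < x" "x < 1" "r \<le> x" "\<theta> \<le> x" using assms by (auto simp: x_def)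
  obtain D where D: "D \<ge> 0" "\<And>n. (real n + 1) * x ^ n \<le> D * sqrt x ^ n"
    using linear_times_power_le_sqrt_power[OF x(1,2)] by blast
  show thesis
  proof (rule that[of "C * D"])
    fix u :: "nat \<Rightarrow> complex" and K :: real and n :: nat
    assume K: "K \<ge> 0" and le: "\<And>n. cmod (\<Sum>k\<le>n. fps_nth F k * u (n - k)) \<le> K * \<theta> ^ n"
    define G where "G = F * Abs_fps u"
    have G: "cmod (fps_nth G n) \<le> K * \<theta> ^ n" for n
      using le[of n] by (simp add: G_def fps_mult_nth atLeast0AtMost)
    have "inverse F * G = Abs_fps u"
      using assms(1) by (simp add: G_def inverse_mult_eq_1 flip: mult.assoc)
    hence "u n = (\<Sum>k\<le>n. fps_nth (inverse F) k * fps_nth G (n - k))"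
      by (metis fps_mult_nth fps_nth_Abs_fps atLeast0AtMost)
    also have "cmod \<dots> \<le> (\<Sum>k\<le>n. C * K * x ^ n)"
    proof (rule sum_norm_le)
      fix k assume k: "k \<in> {..n}"
      have "cmod (fps_nth (inverse F) k * fps_nth G (n - k)) \<le> (C * r ^ k) * (K * \<theta> ^ (n - k))"
        unfolding norm_mult using inv G assms by (intro mult_mono) auto
      also have "\<dots> \<le> (C * x ^ k) * (K * x ^ (n - k))"
        using x assms K by (intro mult_mono power_mono) auto
      also have "\<dots> = C * K * x ^ n"
        using k by (simp add: flip: power_add)
      finally show "cmod (fps_nth (inverse F) k * fps_nth G (n - k)) \<le> C * K * x ^ n" .
    qed
    also have "\<dots> = C * K * ((real n + 1) * x ^ n)" by (simp add: algebra_simps)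
    also have "\<dots> \<le> C * K * (D * sqrt x ^ n)"
      using D(2) assms K by (intro mult_left_mono) auto
    finally show "cmod (u n) \<le> C * D * K * sqrt (max r \<theta>) ^ n"
      by (simp add: x_def mult_ac)
  qed (use D assms in auto)
qed

section \<open>Exponential decay for scalar delay equations\<close>

definition off_grid :: "real \<Rightarrow> real set" where
  "off_grid \<tau> = {t. t > 0 \<and> (\<forall>j::nat. t \<noteq> real j * \<tau>)}"

lemma between_multiples_off_grid:
  assumes "\<tau> > 0" "0 < s" "s < \<tau>"
  shows "real n * \<tau> + s \<in> off_grid \<tau>"
proof -
  have "real n * \<tau> + s \<noteq> real j * \<tau>" for j :: nat
  proof
    assume eq: "real n * \<tau> + s = real j * \<tau>"
    hence "real n * \<tau> < real j * \<tau>" "real j * \<tau> < (real n + 1) * \<tau>"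
      using assms(2,3) by (simp_all only: distrib_right mult_1_left)
    hence "real n < real j" "real j < real (Suc n)"
      using assms by (simp_all only: mult_less_cancel_right_pos of_nat_Suc add.commute)
    thus False by simp
  qed
  moreover have "real n * \<tau> + s > 0" using assms by (simp add: add_nonneg_pos)
  ultimately show ?thesis by (auto simp: off_grid_def)
qed

section \<open>The unforced solution on successive delay intervals\<close>

definition exp_segment :: "complex \<Rightarrow> (nat \<Rightarrow> complex) \<Rightarrow> nat \<Rightarrow> real \<Rightarrow> complex" where
  "exp_segment b u n s = (\<Sum>k\<le>n. (b * s) ^ k / fact k * u (n - k))"

lemma exp_segment_0: "exp_segment b u n 0 = u n"
proof -
  have "exp_segment b u n 0 = (\<Sum>k\<le>n. if k = 0 then u n else 0)"
    unfolding exp_segment_def by (intro sum.cong) (auto simp: power_0_left)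
  thus ?thesis by simp
qed

lemma exp_segment_Suc:
  "exp_segment b u (Suc n) s = u (Suc n) + (\<Sum>k\<le>n. (b * s) ^ Suc k / fact (Suc k) * u (n - k))"
  unfolding exp_segment_def by (subst sum.atMost_Suc_shift) simp

lemma exp_segment_zero_index: "exp_segment b u 0 s = u 0"
  by (simp add: exp_segment_def)

lemma continuous_on_exp_segment: "continuous_on A (exp_segment b u n)"
  unfolding exp_segment_def by (intro continuous_intros) auto

text \<open>\<open>exp_segment b u n s\<close> is the coefficient of \<open>z ^ n\<close> in
  \<open>exp (b * s * z)\<close> times the generating function of \<open>u\<close>. Differentiating
  in \<open>s\<close> multiplies by \<open>b * z\<close>, which lowers the index by one: that is the
  delay.\<close>

lemma exp_segment_deriv:
  "(exp_segment b u (Suc n) has_vector_derivative b * exp_segment b u n s) (at s)"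
proof -
  have mono: "((\<lambda>s::real. (b * of_real s) ^ Suc k / fact (Suc k) * c) has_vector_derivative
      b * ((b * of_real s) ^ k / fact k * c)) (at s)" for k c
  proof -
    have "((\<lambda>z::complex. (b * z) ^ Suc k / fact (Suc k) * c) has_field_derivative
        (of_nat (Suc k) * (b * s) ^ k * b) / fact (Suc k) * c) (at (of_real s))"
      by (rule derivative_eq_intros refl | simp del: power_Suc of_nat_Suc fact_Suc)+
    hence "((\<lambda>s::real. (b * of_real s) ^ Suc k / fact (Suc k) * c) has_vector_derivative
        (of_nat (Suc k) * (b * s) ^ k * b) / fact (Suc k) * c) (at s)"
      using has_vector_derivative_real_field by blast
    moreover have "(of_nat (Suc k) * (b * s) ^ k * b) / fact (Suc k) * c
        = b * ((b * of_real s) ^ k / fact k * c)"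
      by (simp add: fact_Suc field_simps del: of_nat_Suc)
    ultimately show ?thesis by simp
  qed
  have "((\<lambda>s. u (Suc n) + (\<Sum>k\<le>n. (b * of_real s) ^ Suc k / fact (Suc k) * u (n - k)))
      has_vector_derivative 0 + (\<Sum>k\<le>n. b * ((b * of_real s) ^ k / fact k * u (n - k)))) (at s)"
    by (intro has_vector_derivative_add has_vector_derivative_const has_vector_derivative_sum mono)
  moreover have "exp_segment b u (Suc n) =
      (\<lambda>s. u (Suc n) + (\<Sum>k\<le>n. (b * of_real s) ^ Suc k / fact (Suc k) * u (n - k)))"
    by (rule ext) (rule exp_segment_Suc)
  ultimately show ?thesis
    by (simp add: exp_segment_def sum_distrib_left)
qed

text \<open>Writing \<open>\<eta> ^ (n - k)\<close> as \<open>\<eta> ^ n / \<eta> ^ k\<close> leaves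
  a partial sum of the exponential series at \<open>cmod b * \<tau> / \<eta>\<close>, so the
  geometric rate of the grid values survives between the grid points.\<close>

lemma norm_exp_segment_le:
  assumes "0 < \<eta>" "0 \<le> s" "s \<le> \<tau>" "K \<ge> 0"
    and le: "\<And>n. cmod (u n) \<le> K * \<eta> ^ n"
  shows "cmod (exp_segment b u n s) \<le> exp (cmod b * \<tau> / \<eta>) * K * \<eta> ^ n"
proof -
  define x where "x = cmod b * \<tau> / \<eta>"
  have x: "x \<ge> 0" using assms by (simp add: x_def)
  have "cmod (exp_segment b u n s) \<le> (\<Sum>k\<le>n. x ^ k / fact k * (K * \<eta> ^ n))"
    unfolding exp_segment_def
  proof (rule sum_norm_le)
    fix k assume k: "k \<in> {..n}"
    have "cmod ((b * s) ^ k / fact k * u (n - k)) = (cmod b * s) ^ k / fact k * cmod (u (n - k))"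
      using assms by (simp add: norm_mult norm_divide norm_power)
    also have "\<dots> \<le> (cmod b * \<tau>) ^ k / fact k * (K * \<eta> ^ (n - k))"
      using assms by (intro mult_mono divide_right_mono power_mono mult_left_mono) auto
    also have "\<dots> = x ^ k / fact k * (K * (\<eta> ^ k * \<eta> ^ (n - k)))"
      using assms by (simp add: x_def power_divide)
    also have "\<eta> ^ k * \<eta> ^ (n - k) = \<eta> ^ n" using k by (simp flip: power_add)
    finally show "cmod ((b * s) ^ k / fact k * u (n - k)) \<le> x ^ k / fact k * (K * \<eta> ^ n)" .
  qed
  also have "\<dots> = (\<Sum>k\<le>n. x ^ k / fact k) * (K * \<eta> ^ n)"
    by (simp add: sum_distrib_right)
  also have "(\<Sum>k\<le>n. x ^ k / fact k) \<le> exp x"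
  proof -
    have "(\<Sum>k\<in>{..n}. x ^ k /\<^sub>R fact k) \<le> (\<Sum>k. x ^ k /\<^sub>R fact k)"
      by (rule sum_le_suminf) (use x summable_exp_generic[of x] in auto)
    thus ?thesis by (simp add: exp_def divide_inverse mult_ac)
  qed
  finally show ?thesis
    using assms by (simp add: x_def mult_right_mono mult.assoc)
qed

text \<open>Dividing out \<open>exp (a s)\<close> on each delay interval turns the equation into
  \<open>v n' = b v (n - 1) + q n\<close>, whose solution with \<open>q = 0\<close> and no history is
  \<^term>\<open>exp_segment\<close>; the difference is controlled by a Gronwall-type induction over \<open>n\<close>.\<close>

lemma exp_segment_approx:
  fixes v :: "nat \<Rightarrow> real \<Rightarrow> complex" and q :: "nat \<Rightarrow> real \<Rightarrow> complex"
  assumes \<theta>: "0 < \<theta>" and M: "M \<ge> 0"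
    and cont: "\<And>n. continuous_on {0..\<tau>} (v n)"
    and d0: "\<And>s. 0 < s \<Longrightarrow> s < \<tau> \<Longrightarrow> (v 0 has_vector_derivative q 0 s) (at s)"
    and dS: "\<And>n s. 0 < s \<Longrightarrow> s < \<tau> \<Longrightarrow>
      (v (Suc n) has_vector_derivative b * v n s + q (Suc n) s) (at s)"
    and q: "\<And>n s. 0 < s \<Longrightarrow> s < \<tau> \<Longrightarrow> cmod (q n s) \<le> M * \<theta> ^ n"
    and s: "0 \<le> s" "s \<le> \<tau>"
  shows "cmod (v n s - exp_segment b (\<lambda>n. v n 0) n s) \<le> M * \<theta> ^ n * exp ((cmod b / \<theta> + 1) * s)"
  using s
proof (induction n arbitrary: s)
  case 0
  define \<beta> where "\<beta> = cmod b / \<theta> + 1"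
  have \<beta>: "\<beta> \<ge> 1" using \<theta> by (simp add: \<beta>_def)
  have "cmod (v 0 s - v 0 0) \<le> M * exp (\<beta> * s)"
  proof (cases "s = 0")
    case True thus ?thesis using M by simp
  next
    case False
    hence s: "0 < s" "s \<le> \<tau>" using 0 by auto
    have "norm (v 0 s - v 0 0) \<le> M * exp (\<beta> * s) - M * exp (\<beta> * 0)"
    proof (rule differentiable_bound_general[where f' = "q 0" and \<phi>' = "\<lambda>x. M * (\<beta> * exp (\<beta> * x))"])
      show "continuous_on {0..s} (v 0)" using s by (intro continuous_on_subset[OF cont]) auto
      show "continuous_on {0..s} (\<lambda>s. M * exp (\<beta> * s))" by (intro continuous_intros)
      fix x assume x: "0 < x" "x < s"
      show "(v 0 has_vector_derivative q 0 x) (at x)" using d0 x s by auto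
      show "((\<lambda>s. M * exp (\<beta> * s)) has_vector_derivative M * (\<beta> * exp (\<beta> * x))) (at x)"
        unfolding has_real_derivative_iff_has_vector_derivative[symmetric]
        by (auto intro!: derivative_eq_intros)
      have "1 \<le> \<beta> * exp (\<beta> * x)" using \<beta> x mult_mono[of 1 \<beta> 1 "exp (\<beta> * x)"] by auto
      hence "M * 1 \<le> M * (\<beta> * exp (\<beta> * x))" using M by (intro mult_left_mono)
      thus "norm (q 0 x) \<le> M * (\<beta> * exp (\<beta> * x))" using q[of x 0] x s by auto
    qed (use s in auto)
    thus ?thesis using M by simp
  qed
  thus ?case by (simp add: exp_segment_zero_index \<beta>_def)
next
  case (Suc n)
  \<comment> \<open>The choice makes \<open>L * exp (\<beta> * s)\<close> an exact majorant: the
    delayed error contributes \<open>cmod b / \<theta>\<close> times it, since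
    \<open>M * \<theta> ^ n = L / \<theta>\<close>, the forcing contributes at most once it, and the
    sum is its derivative.\<close>
  define \<beta> where "\<beta> = cmod b / \<theta> + 1"
  have \<beta>: "\<beta> \<ge> 1" using \<theta> by (simp add: \<beta>_def)
  define u where "u = (\<lambda>n. v n 0)"
  define w where "w = (\<lambda>n s. v n s - exp_segment b u n s)"
  define L where "L = M * \<theta> ^ Suc n"
  have L: "L \<ge> 0" using M \<theta> by (simp add: L_def)
  have w0: "w (Suc n) 0 = 0" by (simp add: w_def exp_segment_0 u_def)
  have IH: "cmod (w n s) \<le> M * \<theta> ^ n * exp (\<beta> * s)" if "0 \<le> s" "s \<le> \<tau>" for s
    using Suc.IH[OF that] by (simp add: w_def u_def \<beta>_def)
  have "cmod (w (Suc n) s) \<le> L * exp (\<beta> * s)"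
  proof (cases "s = 0")
    case True thus ?thesis using L w0 by simp
  next
    case False
    hence s: "0 < s" "s \<le> \<tau>" using Suc by auto
    have "norm (w (Suc n) s - w (Suc n) 0) \<le> L * exp (\<beta> * s) - L * exp (\<beta> * 0)"
    proof (rule differentiable_bound_general[where f' = "\<lambda>x. b * w n x + q (Suc n) x"
          and \<phi>' = "\<lambda>x. L * (\<beta> * exp (\<beta> * x))"])
      show "continuous_on {0..s} (w (Suc n))" unfolding w_def
        using s by (intro continuous_on_diff continuous_on_exp_segment continuous_on_subset[OF cont]) auto
      show "continuous_on {0..s} (\<lambda>s. L * exp (\<beta> * s))" by (intro continuous_intros)
      fix x assume x: "0 < x" "x < s"
      have "((\<lambda>s. v (Suc n) s - exp_segment b u (Suc n) s) has_vector_derivative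
          (b * v n x + q (Suc n) x) - b * exp_segment b u n x) (at x)"
        by (intro has_vector_derivative_diff dS exp_segment_deriv) (use x s in auto)
      thus "(w (Suc n) has_vector_derivative b * w n x + q (Suc n) x) (at x)"
        by (simp add: w_def algebra_simps)
      show "((\<lambda>s. L * exp (\<beta> * s)) has_vector_derivative L * (\<beta> * exp (\<beta> * x))) (at x)"
        unfolding has_real_derivative_iff_has_vector_derivative[symmetric]
        by (auto intro!: derivative_eq_intros)
      have "norm (b * w n x + q (Suc n) x) \<le> cmod b * cmod (w n x) + cmod (q (Suc n) x)"
        by (metis norm_mult norm_triangle_ineq)
      also have "\<dots> \<le> cmod b * (M * \<theta> ^ n * exp (\<beta> * x)) + L * exp (\<beta> * x)"
      proof (intro add_mono mult_left_mono IH)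
        have "cmod (q (Suc n) x) \<le> L * 1" using q[of x "Suc n"] x s by (simp add: L_def)
        also have "\<dots> \<le> L * exp (\<beta> * x)" using L \<beta> x by (intro mult_left_mono) auto
        finally show "cmod (q (Suc n) x) \<le> L * exp (\<beta> * x)" .
      qed (use x s in auto)
      also have "\<dots> = L * (\<beta> * exp (\<beta> * x))"
        using \<theta> by (simp add: \<beta>_def L_def field_simps)
      finally show "norm (b * w n x + q (Suc n) x) \<le> L * (\<beta> * exp (\<beta> * x))" .
    qed (use s in auto)
    thus ?thesis using L w0 by simp
  qed
  thus ?case by (simp add: w_def u_def L_def \<beta>_def)
qed

text \<open>The values at the grid points satisfy a perturbed convolution equation and decay by
  inversion of its series; \<open>exp_segment\<close> carries the decay into the intervals. One
  \<open>K\<close> bounds history and forcing alike, and the constants are obtained before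
  \<open>y\<close>, \<open>g\<close> and \<open>K\<close>.\<close>

theorem scalar_delay_decay:
  fixes a b :: complex and \<tau> \<gamma> :: real
  assumes tau: "\<tau> > 0" and \<gamma>: "\<gamma> > 0"
    and roots: "\<And>l::complex. l = a + b * exp (- l * \<tau>) \<Longrightarrow> Re l < 0"
  obtains C \<gamma>' where "C \<ge> 0" "\<gamma>' > 0"
    "\<And>y g K t. K \<ge> 0 \<Longrightarrow> continuous_on {-\<tau>..} y \<Longrightarrow> (\<And>t. -\<tau> < t \<Longrightarrow> t < 0 \<Longrightarrow> cmod (y t) \<le> K) \<Longrightarrow>
      (\<And>t. t \<in> off_grid \<tau> \<Longrightarrow> (y has_vector_derivative a * y t + b * y (t - \<tau>) + g t) (at t)) \<Longrightarrow>
      (\<And>t. t \<in> off_grid \<tau> \<Longrightarrow> cmod (g t) \<le> K * exp (- \<gamma> * t)) \<Longrightarrow> t \<ge> 0 \<Longrightarrow>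
      cmod (y t) \<le> C * K * exp (- \<gamma>' * t)"
proof -
  define F where "F = delay_char_fps a b \<tau>"
  define \<theta> where "\<theta> = exp (- \<gamma> * \<tau>)"
  have \<theta>: "0 < \<theta>" "\<theta> < 1" using tau \<gamma> by (auto simp: \<theta>_def)
  obtain Ci r where inv: "Ci \<ge> 0" "0 < r" "r < 1" "\<And>n. cmod (fps_nth (inverse F) n) \<le> Ci * r ^ n"
    using inverse_delay_char_coeffs[OF tau roots] unfolding F_def by metis
  have F0: "fps_nth F 0 \<noteq> 0" by (simp add: F_def delay_char_fps_nth_0)
  define \<eta> where "\<eta> = sqrt (max r \<theta>)"
  have mx: "0 < max r \<theta>" "max r \<theta> < 1" using inv \<theta> by auto
  have \<eta>: "0 < \<eta>" "\<eta> < 1" using mx unfolding \<eta>_def by (auto simp: real_sqrt_gt_0_iff real_sqrt_lt_1_iff simp del: max_less_iff_conj)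
  have \<theta>\<eta>: "\<theta> \<le> \<eta>"
  proof -
    have "\<theta> \<le> max r \<theta>" by simp
    also have "\<dots> = \<eta> * \<eta>" using mx by (simp add: \<eta>_def)
    also have "\<dots> \<le> \<eta> * 1" using \<eta> by (intro mult_left_mono) auto
    finally show ?thesis by simp
  qed
  obtain D where D: "D \<ge> 0" "\<And>u K n. K \<ge> 0 \<Longrightarrow>
      (\<And>n. cmod (\<Sum>k\<le>n. fps_nth F k * u (n - k)) \<le> K * \<theta> ^ n) \<Longrightarrow> cmod (u n) \<le> D * K * \<eta> ^ n"
    by (rule convolution_inverse_decay[OF F0 inv(1-3) \<theta> inv(4), folded \<eta>_def])
      (rule that, assumption, blast)
  define Ea where "Ea = exp (cmod a * \<tau>)"
  have Ea: "Ea \<ge> 1" using tau by (simp add: Ea_def)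
  define \<beta> where "\<beta> = cmod b / \<theta> + 1"
  have \<beta>: "\<beta> \<ge> 0" using \<theta> by (simp add: \<beta>_def)
  \<comment> \<open>Bound for the forcing \<open>q\<close> below: \<open>Ea\<close> for the
    exponential factor, 1 for \<open>g\<close>, and \<open>cmod b\<close> for the history, which
    enters on the first interval only.\<close>
  define c1 where "c1 = Ea * (cmod b + 1)"
  have c1: "c1 \<ge> 1" using Ea mult_mono[of 1 Ea 1 "cmod b + 1"] by (auto simp: c1_def)
  \<comment> \<open>The summand 1 serves \<open>n = 0\<close>. The other one is the error of
    \<open>exp_segment\<close> at \<open>s = \<tau>\<close>, transported by
    \<open>exp (a * \<tau>)\<close>; the division by \<open>\<theta>\<close> accounts for the step
    from interval \<open>m\<close> to grid point \<open>m + 1\<close>.\<close>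
  define c2 where "c2 = 1 + Ea * c1 * exp (\<beta> * \<tau>) / \<theta>"
  have c2: "c2 \<ge> 1" using Ea c1 \<theta> by (simp add: c2_def)
  define c3 where "c3 = Ea * (c1 * exp (\<beta> * \<tau>) + exp (cmod b * \<tau> / \<eta>) * (D * c2))"
  have c3: "c3 \<ge> 0" using Ea c1 c2 D by (simp add: c3_def)
  \<comment> \<open>Thus \<open>\<eta> = exp (- \<gamma>' * \<tau>)\<close>, one factor per delay
    interval. The constant handed over is \<open>c3 / \<eta>\<close> because
    \<open>t / \<tau>\<close> will be rounded down to an integer.\<close>
  define \<gamma>' where "\<gamma>' = - ln \<eta> / \<tau>"
  have \<gamma>': "\<gamma>' > 0" using \<eta> tau by (simp add: \<gamma>'_def divide_neg_pos)
  show thesis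
  proof (rule that[of "c3 / \<eta>" \<gamma>'])
    fix y g :: "real \<Rightarrow> complex" and K t :: real
    assume K: "K \<ge> 0" and cont: "continuous_on {-\<tau>..} y"
      and init: "\<And>t. -\<tau> < t \<Longrightarrow> t < 0 \<Longrightarrow> cmod (y t) \<le> K"
      and deriv: "\<And>t. t \<in> off_grid \<tau> \<Longrightarrow> (y has_vector_derivative a * y t + b * y (t - \<tau>) + g t) (at t)"
      and g: "\<And>t. t \<in> off_grid \<tau> \<Longrightarrow> cmod (g t) \<le> K * exp (- \<gamma> * t)" and t: "t \<ge> 0"
    define v where "v = (\<lambda>n s. exp (- a * of_real s) * y (real n * \<tau> + s))"
    \<comment> \<open>On the first interval \<open>y (s - \<tau>)\<close> is prescribed data and
      goes into the forcing. On later ones the delayed term, multiplied by the exponential factor,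
      is \<open>v (n - 1) s\<close>.\<close>
    define q where "q = (\<lambda>n s. exp (- a * of_real s) *
        (g (real n * \<tau> + s) + (if n = 0 then b * y (s - \<tau>) else 0)))"
    define u where "u = (\<lambda>n. v n 0)"
    have expa: "cmod (exp (- a * of_real s)) \<le> Ea" "cmod (exp (a * of_real s)) \<le> Ea"
      if "0 \<le> s" "s \<le> \<tau>" for s
    proof -
      have "\<bar>Re a\<bar> * s \<le> cmod a * \<tau>"
        using that by (intro mult_mono abs_Re_le_cmod) auto
      moreover have "\<bar>Re a * s\<bar> = \<bar>Re a\<bar> * s" using that by (simp add: abs_mult)
      ultimately show "cmod (exp (- a * of_real s)) \<le> Ea" "cmod (exp (a * of_real s)) \<le> Ea"
        by (auto simp: Ea_def)
    qed
    have contv: "continuous_on {0..\<tau>} (v n)" for n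
    proof -
      have "0 \<le> real n * \<tau>" using tau by simp
      hence "real n * \<tau> + s \<in> {-\<tau>..}" if "s \<in> {0..\<tau>}" for s
        using tau that by (simp only: atLeast_iff atLeastAtMost_iff) linarith
      hence "(\<lambda>s. real n * \<tau> + s) ` {0..\<tau>} \<subseteq> {-\<tau>..}" by blast
      thus ?thesis unfolding v_def
        by (intro continuous_intros continuous_on_compose2[OF cont])
    qed
    have dv: "(v n has_vector_derivative
        exp (- a * of_real s) * (b * y (real n * \<tau> + s - \<tau>) + g (real n * \<tau> + s))) (at s)"
      if s: "0 < s" "s < \<tau>" for n s
    proof -
      let ?t = "real n * \<tau> + s"
      have offgrid: "?t \<in> off_grid \<tau>" using between_multiples_off_grid tau s by blast
      have e: "((\<lambda>s::real. exp (- a * of_real s)) has_vector_derivative - a * exp (- a * of_real s)) (at s)"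
      proof -
        have "((\<lambda>z::complex. exp (- a * z)) has_field_derivative - a * exp (- a * of_real s)) (at (of_real s))"
          by (auto intro!: derivative_eq_intros)
        thus ?thesis using has_vector_derivative_real_field by blast
      qed
      have y: "((\<lambda>s. y (real n * \<tau> + s)) has_vector_derivative
          1 *\<^sub>R (a * y ?t + b * y (?t - \<tau>) + g ?t)) (at s)"
      proof -
        have "((\<lambda>s. real n * \<tau> + s) has_vector_derivative 1) (at s)"
          by (auto intro!: derivative_eq_intros)
        from vector_diff_chain_at[OF this deriv[OF offgrid]] show ?thesis
          by (simp add: o_def)
      qed
      from has_vector_derivative_mult[OF e y] show ?thesis
        unfolding v_def by (simp add: algebra_simps)
    qed
    have approx: "cmod (v n s - exp_segment b u n s) \<le> (c1 * K) * \<theta> ^ n * exp (\<beta> * s)"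
      if "0 \<le> s" "s \<le> \<tau>" for n s
      unfolding u_def \<beta>_def
    proof (rule exp_segment_approx[where \<tau> = \<tau> and q = q])
      fix n s assume s: "0 < s" "s < \<tau>"
      show "(v 0 has_vector_derivative q 0 s) (at s)"
        using dv[OF s, of 0] by (simp add: q_def add_ac)
      have "real (Suc n) * \<tau> + s - \<tau> = real n * \<tau> + s" by (simp add: algebra_simps)
      thus "(v (Suc n) has_vector_derivative b * v n s + q (Suc n) s) (at s)"
        using dv[OF s, of "Suc n"] by (simp add: q_def v_def algebra_simps)
      have offgrid: "real n * \<tau> + s \<in> off_grid \<tau>" using between_multiples_off_grid tau s by blast
      have "exp (- \<gamma> * (real n * \<tau> + s)) \<le> exp (- \<gamma> * (real n * \<tau>))"
        using \<gamma> s by simp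
      also have "\<dots> = \<theta> ^ n"
        by (simp add: \<theta>_def algebra_simps flip: exp_of_nat_mult)
      finally have le: "cmod (g (real n * \<tau> + s)) \<le> K * \<theta> ^ n"
        using g[OF offgrid] K by (meson mult_left_mono order_trans)
      have "cmod (g (real n * \<tau> + s) + (if n = 0 then b * y (s - \<tau>) else 0))
          \<le> K * \<theta> ^ n + cmod b * K * \<theta> ^ n"
      proof (rule norm_triangle_le[OF add_mono[OF le]])
        show "cmod (if n = 0 then b * y (s - \<tau>) else 0) \<le> cmod b * K * \<theta> ^ n"
          using init[of "s - \<tau>"] s K \<theta> by (auto simp: norm_mult mult_left_mono)
      qed
      hence "cmod (q n s) \<le> Ea * (K * \<theta> ^ n + cmod b * K * \<theta> ^ n)"
        unfolding q_def norm_mult using s expa(1)[of s] Ea by (intro mult_mono) auto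
      thus "cmod (q n s) \<le> c1 * K * \<theta> ^ n" by (simp add: c1_def algebra_simps)
    qed (use that contv \<theta> K c1 in auto)
    \<comment> \<open>The bound on the history is assumed on the open interval only; it reaches 0 by
      continuity from the left.\<close>
    have u0: "cmod (u 0) \<le> K"
    proof -
      have "y \<midarrow>0\<rightarrow> y 0"
        using continuous_on_interior[OF cont, of 0] tau by (simp add: isCont_def)
      hence "((\<lambda>t. cmod (y t)) \<longlongrightarrow> cmod (y 0)) (at_left 0)"
        by (intro tendsto_norm) (rule filterlim_mono[OF _ order_refl at_le], auto)
      moreover have "eventually (\<lambda>t. cmod (y t) \<le> K) (at_left 0)"
        using eventually_at_left_real[of "-\<tau>" 0] tau by (auto elim!: eventually_mono intro: init)
      ultimately have "cmod (y 0) \<le> K"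
        by (intro tendsto_upperbound) auto
      thus ?thesis by (simp add: u_def v_def)
    qed
    have u: "cmod (u n) \<le> D * (c2 * K) * \<eta> ^ n" for n
    proof (rule D(2))
      fix n
      show "cmod (\<Sum>k\<le>n. fps_nth F k * u (n - k)) \<le> c2 * K * \<theta> ^ n"
      proof (cases n)
        case 0
        have "1 * K \<le> c2 * K" using c2 K by (intro mult_right_mono) auto
        thus ?thesis using 0 u0 by (simp add: F_def delay_char_fps_nth_0)
      next
        case (Suc m)
        have step: "u (Suc m) = exp (a * \<tau>) * v m \<tau>"
          by (simp add: u_def v_def algebra_simps flip: exp_add)
        \<comment> \<open>The series is made for this: up to the factor
          \<open>exp (a * \<tau>)\<close>, the convolution at \<open>m + 1\<close> is the error of
          \<open>exp_segment\<close> at the end of interval \<open>m\<close>.\<close>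
        have "(\<Sum>k\<le>n. fps_nth F k * u (n - k)) =
            u (Suc m) + (\<Sum>k\<le>m. fps_nth F (Suc k) * u (m - k))"
          unfolding Suc by (subst sum.atMost_Suc_shift) (simp add: F_def delay_char_fps_nth_0)
        also have "\<dots> = exp (a * \<tau>) * (v m \<tau> - exp_segment b u m \<tau>)"
          unfolding step exp_segment_def F_def delay_char_fps_nth_Suc
          by (simp add: algebra_simps sum_distrib_left sum_negf)
        also have "cmod \<dots> \<le> Ea * ((c1 * K) * \<theta> ^ m * exp (\<beta> * \<tau>))"
          unfolding norm_mult using expa(2)[of \<tau>] approx[of \<tau> m] tau Ea by (intro mult_mono) auto
        also have "\<dots> = (c2 - 1) * K * \<theta> ^ n"
          using \<theta> by (simp add: c2_def Suc)
        also have "\<dots> \<le> c2 * K * \<theta> ^ n"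
          using K \<theta> by (intro mult_right_mono) auto
        finally show ?thesis .
      qed
    qed (use c2 K in auto)
    have main: "cmod (y (real n * \<tau> + s)) \<le> c3 * K * \<eta> ^ n" if s: "0 \<le> s" "s \<le> \<tau>" for n s
    proof -
      have "y (real n * \<tau> + s) = exp (a * of_real s) * v n s"
        by (simp add: v_def flip: mult.assoc exp_add)
      also have "v n s = (v n s - exp_segment b u n s) + exp_segment b u n s" by simp
      also have "cmod (exp (a * of_real s) * \<dots>) \<le> Ea * ((c1 * K) * \<theta> ^ n * exp (\<beta> * s)
          + exp (cmod b * \<tau> / \<eta>) * (D * (c2 * K)) * \<eta> ^ n)"
        unfolding norm_mult
        by (intro mult_mono expa(2) norm_triangle_le[OF add_mono] approx norm_exp_segment_le)
          (use s \<eta> u D c2 K Ea in auto)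
      also have "\<dots> \<le> Ea * ((c1 * K) * \<eta> ^ n * exp (\<beta> * \<tau>)
          + exp (cmod b * \<tau> / \<eta>) * (D * (c2 * K)) * \<eta> ^ n)"
        using Ea c1 K \<theta> \<theta>\<eta> s \<beta> \<eta>
        by (intro mult_left_mono add_right_mono mult_mono power_mono) (auto intro!: mult_left_mono)
      also have "\<dots> = c3 * K * \<eta> ^ n" by (simp add: c3_def algebra_simps)
      finally show ?thesis .
    qed
    define n where "n = nat \<lfloor>t / \<tau>\<rfloor>"
    have n: "real n \<le> t / \<tau>" "t / \<tau> < real n + 1"
      using t tau by (auto simp: n_def)
    have "cmod (y t) = cmod (y (real n * \<tau> + (t - real n * \<tau>)))" by simp
    also have "\<dots> \<le> c3 * K * \<eta> ^ n"
      by (rule main) (use n tau in \<open>auto simp: field_simps\<close>)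
    also have "\<dots> \<le> c3 * K * (exp (- \<gamma>' * t) / \<eta>)"
    proof (intro mult_left_mono)
      have "\<eta> ^ n * \<eta> = exp ((real n + 1) * ln \<eta>)"
        using \<eta> by (simp add: algebra_simps exp_add exp_of_nat_mult)
      also have "\<dots> \<le> exp (t / \<tau> * ln \<eta>)"
        unfolding exp_le_cancel_iff by (intro mult_right_mono_neg) (use n \<eta> in auto)
      also have "\<dots> = exp (- \<gamma>' * t)" by (simp add: \<gamma>'_def)
      finally show "\<eta> ^ n \<le> exp (- \<gamma>' * t) / \<eta>" using \<eta> by (simp add: field_simps)
    qed (use c3 K in auto)
    finally show "cmod (y t) \<le> c3 / \<eta> * K * exp (- \<gamma>' * t)" by simp
  qed (use c3 \<eta> \<gamma>' in auto)
qed

section \<open>Annihilating products and nilpotent matrices\<close>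

text \<open>The linear factor \<open>C - c\<close> as an operation on vectors: a product of such
  factors is a \<open>fold\<close> over a list of scalars, and induction on the list peels off the
  factor applied first.\<close>

definition shift_mult :: "complex mat \<Rightarrow> complex \<Rightarrow> complex vec \<Rightarrow> complex vec" where
  "shift_mult C c v = C *\<^sub>v v - c \<cdot>\<^sub>v v"

lemma shift_mult_carrier [simp]:
  "C \<in> carrier_mat m m \<Longrightarrow> v \<in> carrier_vec m \<Longrightarrow> shift_mult C c v \<in> carrier_vec m"
  by (simp add: shift_mult_def)

lemma mult_mat_vec_shift_mult:
  assumes "A \<in> carrier_mat m m" "C \<in> carrier_mat m m" "v \<in> carrier_vec m" "A * C = C * A"
  shows "A *\<^sub>v shift_mult C c v = shift_mult C c (A *\<^sub>v v)"
proof -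
  have "A *\<^sub>v (C *\<^sub>v v) = C *\<^sub>v (A *\<^sub>v v)"
    using assms by (metis assoc_mult_mat_vec)
  thus ?thesis using assms
    by (simp add: shift_mult_def mult_minus_distrib_mat_vec[of A m m] mult_mat_vec[of A m m])
qed

lemma mult_mat_vec_zero_vec [simp]:
  "A \<in> carrier_mat m k \<Longrightarrow> A *\<^sub>v 0\<^sub>v k = (0\<^sub>v m :: 'a :: semiring_0 vec)"
  by (intro eq_vecI) auto

lemma smult_minus_distrib_vec:
  fixes v w :: "complex vec"
  assumes "v \<in> carrier_vec m" "w \<in> carrier_vec m"
  shows "k \<cdot>\<^sub>v (v - w) = k \<cdot>\<^sub>v v - k \<cdot>\<^sub>v w"
  using assms by (intro eq_vecI) (auto simp: algebra_simps)

lemma fold_shift_mult_carrier: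
  assumes "C \<in> carrier_mat m m" "v \<in> carrier_vec m"
  shows "fold (shift_mult C) cs v \<in> carrier_vec m"
  using assms(2) by (induction cs arbitrary: v) (use assms(1) in auto)

lemma mult_mat_vec_fold_shift_mult:
  assumes "A \<in> carrier_mat m m" "C \<in> carrier_mat m m" "v \<in> carrier_vec m" "A * C = C * A"
  shows "A *\<^sub>v fold (shift_mult C) cs v = fold (shift_mult C) cs (A *\<^sub>v v)"
  using assms(3)
  by (induction cs arbitrary: v) (use assms mult_mat_vec_shift_mult in auto)

lemma shift_mult_fold_shift_mult:
  assumes "A \<in> carrier_mat m m" "C \<in> carrier_mat m m" "v \<in> carrier_vec m" "A * C = C * A"
  shows "shift_mult A a (fold (shift_mult C) cs v) = fold (shift_mult C) cs (shift_mult A a v)"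
  using assms(3)
proof (induction cs arbitrary: v)
  case (Cons c cs)
  have "shift_mult C c (shift_mult A a v) = shift_mult A a (shift_mult C c v)"
  proof -
    have w: "C *\<^sub>v v \<in> carrier_vec m" "A *\<^sub>v v \<in> carrier_vec m" using assms Cons by auto
    have "shift_mult C c (shift_mult A a v) =
        C *\<^sub>v shift_mult A a v - c \<cdot>\<^sub>v shift_mult A a v"
      by (simp add: shift_mult_def)
    also have "C *\<^sub>v shift_mult A a v = shift_mult A a (C *\<^sub>v v)"
      using assms Cons by (intro mult_mat_vec_shift_mult) auto
    also have "\<dots> - c \<cdot>\<^sub>v shift_mult A a v = A *\<^sub>v (C *\<^sub>v v) - c \<cdot>\<^sub>v (A *\<^sub>v v) -
        (a \<cdot>\<^sub>v (C *\<^sub>v v) - a \<cdot>\<^sub>v (c \<cdot>\<^sub>v v))"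
      using assms Cons.prems by (intro eq_vecI) (auto simp: shift_mult_def algebra_simps)
    also have "a \<cdot>\<^sub>v (C *\<^sub>v v) - a \<cdot>\<^sub>v (c \<cdot>\<^sub>v v) = a \<cdot>\<^sub>v shift_mult C c v"
      unfolding shift_mult_def
      by (rule smult_minus_distrib_vec[symmetric, where m = m]) (use assms Cons.prems in auto)
    also have "A *\<^sub>v (C *\<^sub>v v) - c \<cdot>\<^sub>v (A *\<^sub>v v) = A *\<^sub>v shift_mult C c v"
      using assms Cons.prems
      by (simp add: shift_mult_def mult_minus_distrib_mat_vec[of A m m] mult_mat_vec[of A m m])
    finally show ?thesis by (simp add: shift_mult_def)
  qed
  thus ?case using Cons assms by simp
qed simp

lemma fold_shift_mult_zero:
  assumes "C \<in> carrier_mat m m"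
  shows "fold (shift_mult C) cs (0\<^sub>v m) = 0\<^sub>v m"
proof -
  have "shift_mult C c (0\<^sub>v m) = 0\<^sub>v m" for c
    using assms by (simp add: shift_mult_def) (intro eq_vecI, auto)
  thus ?thesis by (induction cs) auto
qed

text \<open>The factor with index \<open>k\<close> kills entry \<open>k\<close> through its diagonal
  entry and creates nothing at larger indices by triangularity, so the support shrinks from the
  first \<open>k + 1\<close> entries to the first \<open>k\<close>. \<open>fold\<close> applies the
  head of the list first, hence the reversed order.\<close>

lemma upper_triangular_annihilated:
  fixes B :: "complex mat"
  assumes B: "B \<in> carrier_mat m m" "upper_triangular B"
  shows "k \<le> m \<Longrightarrow> v \<in> carrier_vec m \<Longrightarrow> (\<And>i. k \<le> i \<Longrightarrow> i < m \<Longrightarrow> v $ i = 0) \<Longrightarrow>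
    fold (shift_mult B) (map (\<lambda>i. B $$ (i, i)) (rev [0..<k])) v = 0\<^sub>v m"
proof (induction k arbitrary: v)
  case 0
  thus ?case by (intro eq_vecI) auto
next
  case (Suc k)
  let ?w = "shift_mult B (B $$ (k, k)) v"
  have "?w $ i = 0" if i: "k \<le> i" "i < m" for i
  proof -
    have "?w $ i = (\<Sum>j<m. B $$ (i, j) * v $ j) - B $$ (k, k) * v $ i"
      using i B Suc.prems(2)
      by (simp add: shift_mult_def scalar_prod_def atLeast0LessThan)
    also have "(\<Sum>j<m. B $$ (i, j) * v $ j) = (\<Sum>j<m. if j = k then B $$ (i, k) * v $ k else 0)"
    proof (intro sum.cong refl)
      fix j assume j: "j \<in> {..<m}"
      show "B $$ (i, j) * v $ j = (if j = k then B $$ (i, k) * v $ k else 0)"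
      proof (cases j k rule: linorder_cases)
        case less
        thus ?thesis using B i by (auto dest: upper_triangularD)
      next
        case greater
        thus ?thesis using Suc.prems(3)[of j] j by auto
      qed auto
    qed
    also have "\<dots> = B $$ (i, k) * v $ k" using i by simp
    finally show ?thesis
      using i B Suc.prems(3)[of i] by (cases "i = k") (auto dest: upper_triangularD)
  qed
  moreover have "?w \<in> carrier_vec m" using B Suc.prems by simp
  ultimately have "fold (shift_mult B) (map (\<lambda>i. B $$ (i, i)) (rev [0..<k])) ?w = 0\<^sub>v m"
    using Suc by simp
  thus ?case by simp
qed

text \<open>Cayley-Hamilton in factored form: the diagonal of a Schur form supplies the roots, and
  the similarity carries the factors over. That the roots are eigenvalues gives access to the
  spectral condition in the algebraic block.\<close>

lemma ex_annihilating_eigenvalues: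
  fixes A :: "complex mat"
  assumes A: "A \<in> carrier_mat m m"
  obtains cs where "\<And>c. c \<in> set cs \<Longrightarrow> eigenvalue A c"
    "\<And>v. v \<in> carrier_vec m \<Longrightarrow> fold (shift_mult A) cs v = 0\<^sub>v m"
proof -
  obtain es where "char_poly A = (\<Prod>a\<leftarrow>es. [:- a, 1:])"
    using char_poly_factorized[OF A] by blast
  then obtain B where B: "B \<in> carrier_mat m m" "upper_triangular B" "similar_mat A B"
    using schur_decomposition_exists[OF A] by blast
  obtain P Q where "similar_mat_wit A B P Q" using B(3) by (auto simp: similar_mat_def)
  hence PQ: "P \<in> carrier_mat m m" "Q \<in> carrier_mat m m" "P * Q = 1\<^sub>m m" "Q * P = 1\<^sub>m m" "A = P * B * Q"
    using A by (auto simp: similar_mat_wit_def Let_def)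
  define cs where "cs = map (\<lambda>i. B $$ (i, i)) (rev [0..<m])"
  show thesis
  proof
    fix c assume "c \<in> set cs"
    hence "c \<in> set (diag_mat B)" using B(1) by (auto simp: cs_def diag_mat_def)
    hence "poly (char_poly B) c = 0"
      by (auto simp: char_poly_upper_triangular[OF B(1,2)] poly_prod_list prod_list_zero_iff)
    thus "eigenvalue A c"
      using eigenvalue_root_char_poly[OF A] char_poly_similar[OF B(3)] by simp
  next
    fix v :: "complex vec" assume v: "v \<in> carrier_vec m"
    have conj: "Q *\<^sub>v fold (shift_mult A) ds w = fold (shift_mult B) ds (Q *\<^sub>v w)"
      if "w \<in> carrier_vec m" for ds w
      using that
    proof (induction ds arbitrary: w)
      case (Cons d ds)
      have "A *\<^sub>v w = P *\<^sub>v (B *\<^sub>v (Q *\<^sub>v w))"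
        using PQ B Cons.prems by (simp add: assoc_mult_mat_vec[of _ m m _ m])
      hence "Q *\<^sub>v (A *\<^sub>v w) = (Q * P) *\<^sub>v (B *\<^sub>v (Q *\<^sub>v w))"
        using assoc_mult_mat_vec[of Q m m P m "B *\<^sub>v (Q *\<^sub>v w)"] PQ(1,2) B(1) Cons.prems by simp
      also have "\<dots> = B *\<^sub>v (Q *\<^sub>v w)"
        using PQ B Cons.prems mult_mat_vec_carrier[of B m m "Q *\<^sub>v w"] by simp
      finally have "Q *\<^sub>v shift_mult A d w = shift_mult B d (Q *\<^sub>v w)"
        using PQ(2) A Cons.prems
        by (simp add: shift_mult_def mult_minus_distrib_mat_vec[of Q m m] mult_mat_vec[of Q m m])
      moreover have "shift_mult A d w \<in> carrier_vec m" using A Cons.prems by simp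
      ultimately show ?case using Cons.IH by simp
    qed simp
    have "Q *\<^sub>v fold (shift_mult A) cs v = fold (shift_mult B) cs (Q *\<^sub>v v)"
      using conj v by blast
    also have "\<dots> = 0\<^sub>v m"
      unfolding cs_def by (rule upper_triangular_annihilated) (use B PQ v in auto)
    finally have "P *\<^sub>v (Q *\<^sub>v fold (shift_mult A) cs v) = P *\<^sub>v 0\<^sub>v m" by simp
    moreover have "P *\<^sub>v (Q *\<^sub>v fold (shift_mult A) cs v) = (P * Q) *\<^sub>v fold (shift_mult A) cs v"
      using PQ fold_shift_mult_carrier[OF A v] by (intro assoc_mult_mat_vec[symmetric])
    ultimately show "fold (shift_mult A) cs v = 0\<^sub>v m"
      using PQ fold_shift_mult_carrier[OF A v] by simp
  qed
qed

lemma ex_left_inverse_if_trivial_kernel: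
  fixes M :: "complex mat"
  assumes M: "M \<in> carrier_mat m m"
    and ker: "\<And>v. v \<in> carrier_vec m \<Longrightarrow> M *\<^sub>v v = 0\<^sub>v m \<Longrightarrow> v = 0\<^sub>v m"
  obtains Mi where "Mi \<in> carrier_mat m m" "Mi * M = 1\<^sub>m m"
proof -
  have "det M \<noteq> 0" using ker det_0_iff_vec_prod_zero[OF M] by blast
  from det_non_zero_imp_unit[OF M this, of "()"] show thesis
    using that by (auto simp: Units_def ring_mat_def)
qed

lemma invertible_mat_obtain:
  assumes "invertible_mat J" "J \<in> carrier_mat m m"
  obtains Ji where "Ji \<in> carrier_mat m m" "Ji * J = 1\<^sub>m m" "J * Ji = 1\<^sub>m m"
proof -
  obtain Ji where "inverts_mat J Ji" "inverts_mat Ji J"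
    using assms(1) by (auto simp: invertible_mat_def)
  hence J: "J * Ji = 1\<^sub>m m" "Ji * J = 1\<^sub>m (dim_row Ji)"
    using assms(2) by (auto simp: inverts_mat_def)
  have "dim_col Ji = m" using arg_cong[OF J(1), of dim_col] by simp
  moreover have "dim_row Ji = m"
    using arg_cong[OF J(2), of dim_col] assms(2) by simp
  ultimately have "Ji \<in> carrier_mat m m" by auto
  thus thesis using that J by auto
qed

lemma inverse_mat_commute:
  fixes J :: "complex mat"
  assumes "J \<in> carrier_mat m m" "Ji \<in> carrier_mat m m" "M \<in> carrier_mat m m"
    and "Ji * J = 1\<^sub>m m" "J * Ji = 1\<^sub>m m" "J * M = M * J"
  shows "Ji * M = M * Ji"
proof -
  have "Ji * M = Ji * M * (J * Ji)" using assms by simp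
  also have "\<dots> = Ji * (M * J) * Ji"
    using assms by (simp add: assoc_mult_mat[of _ m m _ m _ m])
  also have "\<dots> = (Ji * J) * M * Ji"
    unfolding assms(6)[symmetric] using assms(1-3) by (simp add: assoc_mult_mat[of _ m m _ m _ m])
  finally show ?thesis using assms by simp
qed

section \<open>Powers of a matrix as iterated maps on vectors\<close>

lemma funpow_mult_mat_vec_carrier:
  assumes "N \<in> carrier_mat m m" "v \<in> carrier_vec m"
  shows "(((*\<^sub>v) N) ^^ k) v \<in> carrier_vec m"
  using assms by (induction k) auto

lemma pow_mat_mult_vec:
  fixes N :: "complex mat"
  assumes "N \<in> carrier_mat m m" "v \<in> carrier_vec m"
  shows "(N ^\<^sub>m k) *\<^sub>v v = (((*\<^sub>v) N) ^^ k) v"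
  using assms(2)
proof (induction k arbitrary: v)
  case (Suc k)
  have "N ^\<^sub>m Suc k *\<^sub>v v = N ^\<^sub>m k *\<^sub>v (N *\<^sub>v v)"
    using assms(1) Suc.prems by (simp add: assoc_mult_mat_vec[of _ m m _ m])
  also have "\<dots> = (((*\<^sub>v) N) ^^ k) (N *\<^sub>v v)" using Suc assms(1) by simp
  finally show ?case by (simp add: funpow_swap1)
qed (use assms in simp)

lemma funpow_mult_mat_vec_commute:
  fixes A N :: "complex mat"
  assumes "A \<in> carrier_mat m m" "N \<in> carrier_mat m m" "v \<in> carrier_vec m" "A * N = N * A"
  shows "(((*\<^sub>v) N) ^^ k) (A *\<^sub>v v) = A *\<^sub>v (((*\<^sub>v) N) ^^ k) v"
proof (induction k)
  case (Suc k)
  let ?w = "(((*\<^sub>v) N) ^^ k) v"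
  have w: "?w \<in> carrier_vec m" using assms funpow_mult_mat_vec_carrier by blast
  have "N *\<^sub>v (A *\<^sub>v ?w) = (N * A) *\<^sub>v ?w" "A *\<^sub>v (N *\<^sub>v ?w) = (A * N) *\<^sub>v ?w"
    using assms(1,2) w by (auto simp: assoc_mult_mat_vec[of _ m m _ m])
  thus ?case using Suc assms(4) by simp
qed simp

lemma funpow_mult_mat_prod:
  fixes A N :: "complex mat"
  assumes "A \<in> carrier_mat m m" "N \<in> carrier_mat m m" "v \<in> carrier_vec m" "A * N = N * A"
  shows "(((*\<^sub>v) (A * N)) ^^ k) v = (((*\<^sub>v) A) ^^ k) ((((*\<^sub>v) N) ^^ k) v)"
  using assms(3)
proof (induction k arbitrary: v)
  case (Suc k)
  have c: "A *\<^sub>v v \<in> carrier_vec m" "N *\<^sub>v v \<in> carrier_vec m" "A *\<^sub>v (N *\<^sub>v v) \<in> carrier_vec m"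
    using assms Suc.prems by auto
  have "(((*\<^sub>v) (A * N)) ^^ Suc k) v = (((*\<^sub>v) (A * N)) ^^ k) (A *\<^sub>v (N *\<^sub>v v))"
    using assms(1,2) Suc.prems by (simp only: funpow_Suc_right o_def) (simp add: assoc_mult_mat_vec[of _ m m _ m])
  also have "\<dots> = (((*\<^sub>v) A) ^^ k) ((((*\<^sub>v) N) ^^ k) (A *\<^sub>v (N *\<^sub>v v)))"
    using Suc.IH c by blast
  also have "(((*\<^sub>v) N) ^^ k) (A *\<^sub>v (N *\<^sub>v v)) = A *\<^sub>v (((*\<^sub>v) N) ^^ k) (N *\<^sub>v v)"
    using funpow_mult_mat_vec_commute[OF assms(1,2) c(2) assms(4)] by blast
  finally show ?case by (simp add: funpow_Suc_right del: funpow.simps)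
qed simp

lemma funpow_mult_mat_zero_vec:
  fixes A :: "complex mat"
  assumes "A \<in> carrier_mat m m"
  shows "(((*\<^sub>v) A) ^^ k) (0\<^sub>v m) = 0\<^sub>v m"
  using assms by (induction k) auto

lemma nilpotent_mult_mat_vec:
  fixes A N :: "complex mat"
  assumes "A \<in> carrier_mat m m" "N \<in> carrier_mat m m" "A * N = N * A"
    and "\<And>v. v \<in> carrier_vec m \<Longrightarrow> (((*\<^sub>v) N) ^^ k) v = 0\<^sub>v m" and "v \<in> carrier_vec m"
  shows "(((*\<^sub>v) (A * N)) ^^ k) v = 0\<^sub>v m"
  unfolding funpow_mult_mat_prod[OF assms(1,2,5,3)]
  by (simp only: assms(4)[OF assms(5)] funpow_mult_mat_zero_vec[OF assms(1)])

lemma nilpotent_mat_obtain: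
  assumes "nilpotent_mat N" "N \<in> carrier_mat m m"
  obtains k where "\<And>v. v \<in> carrier_vec m \<Longrightarrow> (((*\<^sub>v) N) ^^ k) v = 0\<^sub>v m"
proof -
  obtain k where k: "N ^\<^sub>m k = 0\<^sub>m m m" using assms by (auto simp: nilpotent_mat_def)
  show thesis
  proof (rule that)
    fix v :: "complex vec" assume v: "v \<in> carrier_vec m"
    have "(((*\<^sub>v) N) ^^ k) v = (0\<^sub>m m m) *\<^sub>v v"
      using pow_mat_mult_vec[OF assms(2) v, of k] k by simp
    also have "\<dots> = 0\<^sub>v m" using v by (intro eq_vecI) auto
    finally show "(((*\<^sub>v) N) ^^ k) v = 0\<^sub>v m" .
  qed
qed

text \<open>This is the last nonzero vector of the orbit. Kernels and eigenspaces of matrices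
  commuting with \<open>N\<close> are invariant under \<open>N\<close>, so a vector found in the
  orbit inherits such properties from \<open>v\<close>.\<close>

lemma nilpotent_kernel_in_orbit:
  assumes "N \<in> carrier_mat m m" "v \<in> carrier_vec m" "v \<noteq> 0\<^sub>v m" "(((*\<^sub>v) N) ^^ k) v = 0\<^sub>v m"
  obtains j where "(((*\<^sub>v) N) ^^ j) v \<noteq> 0\<^sub>v m" "N *\<^sub>v (((*\<^sub>v) N) ^^ j) v = 0\<^sub>v m"
proof -
  define l where "l = (LEAST k. (((*\<^sub>v) N) ^^ k) v = 0\<^sub>v m)"
  have l: "(((*\<^sub>v) N) ^^ l) v = 0\<^sub>v m" unfolding l_def by (rule LeastI) (rule assms(4))
  with assms(3) obtain j where j: "l = Suc j" by (cases l) auto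
  have "(((*\<^sub>v) N) ^^ j) v \<noteq> 0\<^sub>v m"
    using not_less_Least[of j "\<lambda>k. (((*\<^sub>v) N) ^^ k) v = 0\<^sub>v m"] j unfolding l_def by auto
  thus thesis using that[of j] l j by simp
qed

section \<open>Block decompositions\<close>

text \<open>Rows and columns through the block are both restricted to it. The rows give the block
  coordinates of a solution an equation of their own; the columns lift vectors of the block to the
  whole space. With offset and size as parameters one argument serves all four blocks.\<close>

definition block_at :: "nat \<Rightarrow> nat \<Rightarrow> nat \<Rightarrow> complex mat \<Rightarrow> complex mat \<Rightarrow> bool" where
  "block_at n k m D M \<longleftrightarrow> D \<in> carrier_mat n n \<and> M \<in> carrier_mat m m \<and> k + m \<le> n \<and>
     (\<forall>i<m. \<forall>j<n.
        D $$ (k + i, j) = (if k \<le> j \<and> j < k + m then M $$ (i, j - k) else 0) \<and>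
        D $$ (j, k + i) = (if k \<le> j \<and> j < k + m then M $$ (j - k, i) else 0))"

lemma block_at_diag_block_mat:
  assumes "M1 \<in> carrier_mat n1 n1" "M2 \<in> carrier_mat n2 n2"
    "M3 \<in> carrier_mat n3 n3" "M4 \<in> carrier_mat n4 n4" "n1 + n2 + n3 + n4 = n"
  defines "D \<equiv> diag_block_mat [M1, M2, M3, M4]"
  shows "block_at n 0 n1 D M1" "block_at n n1 n2 D M2"
    "block_at n (n1 + n2) n3 D M3" "block_at n (n1 + n2 + n3) n4 D M4"
  using assms(1-5) unfolding block_at_def D_def
  by (auto simp: Let_def)

definition block_rows :: "complex mat \<Rightarrow> nat \<Rightarrow> nat \<Rightarrow> complex mat" where
  "block_rows U k m = mat m (dim_col U) (\<lambda>(i, j). U $$ (k + i, j))"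

definition block_cols :: "complex mat \<Rightarrow> nat \<Rightarrow> nat \<Rightarrow> complex mat" where
  "block_cols V k m = mat (dim_row V) m (\<lambda>(i, j). V $$ (i, k + j))"

lemma block_rows_carrier [simp]: "U \<in> carrier_mat n n \<Longrightarrow> block_rows U k m \<in> carrier_mat m n"
  by (auto simp: block_rows_def)

lemma block_cols_carrier [simp]: "V \<in> carrier_mat n n \<Longrightarrow> block_cols V k m \<in> carrier_mat n m"
  by (auto simp: block_cols_def)

lemma sum_if_interval:
  fixes f :: "nat \<Rightarrow> complex"
  assumes "k + m \<le> n"
  shows "(\<Sum>j<n. (if k \<le> j \<and> j < k + m then f j else 0)) = (\<Sum>j<m. f (k + j))"
proof -
  have "(\<Sum>j<n. (if k \<le> j \<and> j < k + m then f j else 0)) = (\<Sum>j\<in>{k..<k+m}. f j)"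
    using assms by (intro sum.mono_neutral_cong_right) auto
  also have "\<dots> = (\<Sum>j<m. f (k + j))"
    by (rule sum.reindex_bij_witness[of _ "\<lambda>j. k + j" "\<lambda>j. j - k"]) auto
  finally show ?thesis .
qed

lemma mult_mat_entry:
  assumes "A \<in> carrier_mat p q" "B \<in> carrier_mat q r" "i < p" "j < r"
  shows "(A * B) $$ (i, j) = (\<Sum>l<q. A $$ (i, l) * B $$ (l, j))"
  using assms by (auto simp: scalar_prod_def atLeast0LessThan)

lemma mult_mat_vec_entry:
  assumes "A \<in> carrier_mat p q" "v \<in> carrier_vec q" "i < p"
  shows "(A *\<^sub>v v) $ i = (\<Sum>l<q. A $$ (i, l) * v $ l)"
  using assms by (auto simp: scalar_prod_def atLeast0LessThan)

lemma block_rows_mult_vec: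
  assumes "U \<in> carrier_mat n n" "x \<in> carrier_vec n" "i < m" "k + m \<le> n"
  shows "(block_rows U k m *\<^sub>v x) $ i = (U *\<^sub>v x) $ (k + i)"
  using assms
  by (subst mult_mat_vec_entry[of _ m n], simp_all del: index_mult_mat_vec,
      subst mult_mat_vec_entry[of U n n]) (simp_all add: block_rows_def)

lemma block_rows_block_cols:
  assumes "U \<in> carrier_mat n n" "V \<in> carrier_mat n n" "U * V = 1\<^sub>m n" "k + m \<le> n"
  shows "block_rows U k m * block_cols V k m = 1\<^sub>m m"
proof (rule eq_matI)
  fix i j assume "i < dim_row (1\<^sub>m m :: complex mat)" "j < dim_col (1\<^sub>m m :: complex mat)"
  hence ij: "i < m" "j < m" by auto
  have "(block_rows U k m * block_cols V k m) $$ (i, j) = (\<Sum>l<n. U $$ (k + i, l) * V $$ (l, k + j))"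
    using ij assms by (subst mult_mat_entry[of _ m n _ m]) (auto simp: block_rows_def block_cols_def)
  also have "\<dots> = (U * V) $$ (k + i, k + j)"
    using ij assms(1,2,4) by (subst mult_mat_entry[of _ n n _ n]) auto
  finally show "(block_rows U k m * block_cols V k m) $$ (i, j) = 1\<^sub>m m $$ (i, j)"
    using ij assms by simp
qed (use assms in \<open>auto simp: block_rows_def block_cols_def\<close>)

text \<open>From \<open>D = U * M * V\<close> follow \<open>D * U = U * M\<close> and
  \<open>V * D = M * V\<close>; the first is read in the rows of the block, the second in its
  columns.\<close>

lemma block_intertwine:
  assumes U: "U \<in> carrier_mat n n" and V: "V \<in> carrier_mat n n"
    and UV: "U * V = 1\<^sub>m n" "V * U = 1\<^sub>m n" and M: "M \<in> carrier_mat n n"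
    and blk: "block_at n k m (U * M * V) Mp"
  shows "block_rows U k m * M = Mp * block_rows U k m"
    and "M * block_cols V k m = block_cols V k m * Mp"
proof -
  define D where "D = U * M * V"
  have D: "D \<in> carrier_mat n n" using U V M by (simp add: D_def)
  have Mp: "Mp \<in> carrier_mat m m" "k + m \<le> n" using blk by (auto simp: block_at_def)
  have "D * U = U * M * (V * U)" unfolding D_def
    using U V M by (simp add: assoc_mult_mat[of _ n n _ n _ n])
  hence DU: "D * U = U * M" using UV U M by simp
  have "V * D = (V * U) * M * V" unfolding D_def
    using U V M by (simp add: assoc_mult_mat[of _ n n _ n _ n])
  hence VD: "V * D = M * V" using UV V M by simp
  show "block_rows U k m * M = Mp * block_rows U k m"
  proof (rule eq_matI)
    fix i j assume "i < dim_row (Mp * block_rows U k m)" "j < dim_col (Mp * block_rows U k m)"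
    hence ij: "i < m" "j < n" using Mp U by (auto simp: block_rows_def)
    have "(block_rows U k m * M) $$ (i, j) = (\<Sum>l<n. U $$ (k + i, l) * M $$ (l, j))"
      using ij U M by (subst mult_mat_entry[of _ m n _ n]) (auto simp: block_rows_def)
    also have "\<dots> = (U * M) $$ (k + i, j)"
      using ij U M Mp by (subst mult_mat_entry[of _ n n _ n]) auto
    also have "\<dots> = (\<Sum>l<n. D $$ (k + i, l) * U $$ (l, j))"
      unfolding DU[symmetric] using ij U D Mp by (subst mult_mat_entry[of _ n n _ n]) auto
    also have "\<dots> = (\<Sum>l<n. (if k \<le> l \<and> l < k + m then Mp $$ (i, l - k) * U $$ (l, j) else 0))"
      using blk ij by (intro sum.cong) (auto simp: block_at_def D_def[symmetric])
    also have "\<dots> = (\<Sum>l<m. Mp $$ (i, l) * U $$ (k + l, j))"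
      by (subst sum_if_interval[OF Mp(2)]) simp
    also have "\<dots> = (Mp * block_rows U k m) $$ (i, j)"
      using ij U Mp by (subst mult_mat_entry[of _ m m _ n]) (auto simp: block_rows_def)
    finally show "(block_rows U k m * M) $$ (i, j) = (Mp * block_rows U k m) $$ (i, j)" .
  qed (use U M Mp in \<open>auto simp: block_rows_def\<close>)
  show "M * block_cols V k m = block_cols V k m * Mp"
  proof (rule eq_matI)
    fix i j assume "i < dim_row (block_cols V k m * Mp)" "j < dim_col (block_cols V k m * Mp)"
    hence ij: "i < n" "j < m" using Mp V by (auto simp: block_cols_def)
    have "(M * block_cols V k m) $$ (i, j) = (\<Sum>l<n. M $$ (i, l) * V $$ (l, k + j))"
      using ij V M by (subst mult_mat_entry[of _ n n _ m]) (auto simp: block_cols_def)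
    also have "\<dots> = (M * V) $$ (i, k + j)"
      using ij V M Mp by (subst mult_mat_entry[of _ n n _ n]) auto
    also have "\<dots> = (\<Sum>l<n. V $$ (i, l) * D $$ (l, k + j))"
      unfolding VD[symmetric] using ij V D Mp by (subst mult_mat_entry[of _ n n _ n]) auto
    also have "\<dots> = (\<Sum>l<n. (if k \<le> l \<and> l < k + m then V $$ (i, l) * Mp $$ (l - k, j) else 0))"
      using blk ij by (intro sum.cong) (auto simp: block_at_def D_def[symmetric])
    also have "\<dots> = (\<Sum>l<m. V $$ (i, k + l) * Mp $$ (l, j))"
      by (subst sum_if_interval[OF Mp(2)]) simp
    also have "\<dots> = (block_cols V k m * Mp) $$ (i, j)"
      using ij V Mp by (subst mult_mat_entry[of _ n m _ m]) (auto simp: block_cols_def)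
    finally show "(M * block_cols V k m) $$ (i, j) = (block_cols V k m * Mp) $$ (i, j)" .
  qed (use V M Mp in \<open>auto simp: block_cols_def\<close>)
qed

text \<open>Both products agree after multiplication by \<open>W\<close> from the right, and
  \<open>Z\<close> cancels \<open>W\<close>.\<close>

lemma intertwined_commute:
  fixes M N :: "complex mat"
  assumes W: "W \<in> carrier_mat m n" and Z: "Z \<in> carrier_mat n m" and WZ: "W * Z = 1\<^sub>m m"
    and M: "M \<in> carrier_mat n n" "Mp \<in> carrier_mat m m" "W * M = Mp * W"
    and N: "N \<in> carrier_mat n n" "Np \<in> carrier_mat m m" "W * N = Np * W"
    and MN: "M * N = N * M"
  shows "Mp * Np = Np * Mp"
proof -
  have *: "Mp * Np * W = W * (M * N)"
    if "M \<in> carrier_mat n n" "Mp \<in> carrier_mat m m" "W * M = Mp * W"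
      "N \<in> carrier_mat n n" "Np \<in> carrier_mat m m" "W * N = Np * W" for M Mp N Np
  proof -
    have "Mp * Np * W = Mp * (W * N)" using that W by (simp add: assoc_mult_mat[of _ m m _ m _ n])
    also have "\<dots> = (Mp * W) * N" using that(1,2,4,5) W by (simp add: assoc_mult_mat[of _ m m _ n _ n])
    also have "\<dots> = (W * M) * N" using that(3) by simp
    finally show ?thesis using that(1,2,4,5) W by (simp add: assoc_mult_mat[of _ m n _ n _ n])
  qed
  have "Mp * Np * W = Np * Mp * W" using *[OF M N] *[OF N M] MN by simp
  hence "Mp * Np * W * Z = Np * Mp * W * Z" by simp
  moreover have "Mp * Np * W * Z = Mp * Np * (W * Z)" "Np * Mp * W * Z = Np * Mp * (W * Z)"
    by (intro assoc_mult_mat[of _ m m _ n _ m] mult_carrier_mat[of _ m m] W Z M(2) N(2))+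
  ultimately show ?thesis using WZ M(2) N(2) by simp
qed

text \<open>A nonzero \<open>v\<close> with this equation would lift through \<open>Z\<close> to a
  vector that the full matrix annihilates. The lift is nonzero because \<open>W\<close> recovers
  \<open>v\<close> from it, so \<open>l\<close> would lie in the spectrum.\<close>

lemma block_spectrum_regular:
  assumes spec: "ddae_spectrum E A B \<tau> \<subseteq> {z. Re z < 0}"
    and carr: "E \<in> carrier_mat n n" "A \<in> carrier_mat n n" "B \<in> carrier_mat n n"
    and W: "W \<in> carrier_mat m n" and Z: "Z \<in> carrier_mat n m" and WZ: "W * Z = 1\<^sub>m m"
    and E: "Ep \<in> carrier_mat m m" "E * Z = Z * Ep"
    and A: "Ap \<in> carrier_mat m m" "A * Z = Z * Ap"
    and B: "Bp \<in> carrier_mat m m" "B * Z = Z * Bp"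
    and l: "Re l \<ge> 0" and v: "v \<in> carrier_vec m"
    and eq: "l \<cdot>\<^sub>v (Ep *\<^sub>v v) = Ap *\<^sub>v v + exp (- l * \<tau>) \<cdot>\<^sub>v (Bp *\<^sub>v v)"
  shows "v = 0\<^sub>v m"
proof (rule ccontr)
  assume v0: "v \<noteq> 0\<^sub>v m"
  define e where "e = exp (- l * \<tau>)"
  define w where "w = Z *\<^sub>v v"
  have w: "w \<in> carrier_vec n" using Z v by (simp add: w_def)
  have "W *\<^sub>v w = (W * Z) *\<^sub>v v" unfolding w_def by (rule assoc_mult_mat_vec[symmetric]) (use W Z v in auto)
  hence Ww: "W *\<^sub>v w = v" using WZ v by simp
  have w0: "w \<noteq> 0\<^sub>v n" using Ww v0 W by auto
  have lift: "M *\<^sub>v w = Z *\<^sub>v (Mp *\<^sub>v v)"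
    if "M \<in> carrier_mat n n" "Mp \<in> carrier_mat m m" "M * Z = Z * Mp" for M Mp
  proof -
    have "M *\<^sub>v w = (M * Z) *\<^sub>v v" unfolding w_def using that(1) Z v
      by (intro assoc_mult_mat_vec[symmetric])
    also have "\<dots> = Z *\<^sub>v (Mp *\<^sub>v v)" unfolding that(3) using that(2) Z v
      by (intro assoc_mult_mat_vec)
    finally show ?thesis .
  qed
  let ?M = "l \<cdot>\<^sub>m E - A - e \<cdot>\<^sub>m B"
  have M: "?M \<in> carrier_mat n n" using carr by auto
  have "Z *\<^sub>v (l \<cdot>\<^sub>v (Ep *\<^sub>v v)) = Z *\<^sub>v (Ap *\<^sub>v v + e \<cdot>\<^sub>v (Bp *\<^sub>v v))"
    using eq by (simp add: e_def)
  hence "l \<cdot>\<^sub>v (E *\<^sub>v w) = A *\<^sub>v w + e \<cdot>\<^sub>v (B *\<^sub>v w)"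
    using Z A(1) B(1) E(1) v
    by (simp add: lift[OF carr(1) E] lift[OF carr(2) A] lift[OF carr(3) B]
      mult_add_distrib_mat_vec[of Z n m] mult_mat_vec[of Z n m])
  hence "(l \<cdot>\<^sub>v (E *\<^sub>v w)) $ i = (A *\<^sub>v w + e \<cdot>\<^sub>v (B *\<^sub>v w)) $ i" for i by simp
  hence comp: "l * (E *\<^sub>v w) $ i = (A *\<^sub>v w) $ i + e * (B *\<^sub>v w) $ i" if "i < n" for i
    using that carr by (metis index_add_vec(1) index_smult_vec(1) dim_mult_mat_vec carrier_matD(1) index_smult_vec(2))
  have "?M *\<^sub>v w = 0\<^sub>v n"
  proof (rule eq_vecI)
    fix i assume "i < dim_vec (0\<^sub>v n :: complex vec)"
    hence i: "i < n" by simp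
    have "(?M *\<^sub>v w) $ i = (\<Sum>j<n. (l * E $$ (i, j) - A $$ (i, j) - e * B $$ (i, j)) * w $ j)"
      using carr i w by (subst mult_mat_vec_entry[OF M w i]) auto
    also have "\<dots> = l * (E *\<^sub>v w) $ i - (A *\<^sub>v w) $ i - e * (B *\<^sub>v w) $ i"
      unfolding mult_mat_vec_entry[OF carr(1) w i] mult_mat_vec_entry[OF carr(2) w i]
        mult_mat_vec_entry[OF carr(3) w i]
      by (simp add: sum_distrib_left sum_subtractf algebra_simps)
    finally show "(?M *\<^sub>v w) $ i = 0\<^sub>v n $ i" using comp[OF i] i by simp
  qed (use carr in auto)
  hence "det ?M = 0" using det_0_iff_vec_prod_zero[OF M] w w0 by blast
  hence "l \<in> ddae_spectrum E A B \<tau>" by (simp add: ddae_spectrum_def e_def)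
  thus False using spec l by auto
qed

lemma commuting_kernel_invariant:
  fixes M N :: "complex mat"
  assumes "M \<in> carrier_mat m m" "N \<in> carrier_mat m m" "v \<in> carrier_vec m"
    and "M * N = N * M" "M *\<^sub>v v = 0\<^sub>v m"
  shows "M *\<^sub>v ((((*\<^sub>v) N) ^^ j) v) = 0\<^sub>v m"
  using funpow_mult_mat_vec_commute[OF assms(1-3) assms(4), of j]
    funpow_mult_mat_zero_vec[OF assms(2), of j] assms(5) by simp

text \<open>A kernel vector of \<open>N1\<close> is moved along its orbit under \<open>N2\<close>
  into the kernel of \<open>N2\<close>, then likewise for \<open>N3\<close>; commutation keeps it in
  the kernels reached before.\<close>

lemma nilpotent_block_empty:
  fixes N1 N2 N3 :: "complex mat"
  assumes N: "N1 \<in> carrier_mat m m" "N2 \<in> carrier_mat m m" "N3 \<in> carrier_mat m m"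
    and comm: "N1 * N2 = N2 * N1" "N1 * N3 = N3 * N1" "N2 * N3 = N3 * N2"
    and nil: "nilpotent_mat N1" "nilpotent_mat N2" "nilpotent_mat N3"
    and reg: "\<And>v. v \<in> carrier_vec m \<Longrightarrow> N1 *\<^sub>v v = 0\<^sub>v m \<Longrightarrow> N2 *\<^sub>v v = 0\<^sub>v m \<Longrightarrow>
      N3 *\<^sub>v v = 0\<^sub>v m \<Longrightarrow> v = 0\<^sub>v m"
  shows "m = 0"
proof (rule ccontr)
  assume m: "m \<noteq> 0"
  obtain k1 k2 k3 where k:
    "\<And>v. v \<in> carrier_vec m \<Longrightarrow> (((*\<^sub>v) N1) ^^ k1) v = 0\<^sub>v m"
    "\<And>v. v \<in> carrier_vec m \<Longrightarrow> (((*\<^sub>v) N2) ^^ k2) v = 0\<^sub>v m"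
    "\<And>v. v \<in> carrier_vec m \<Longrightarrow> (((*\<^sub>v) N3) ^^ k3) v = 0\<^sub>v m"
    using nilpotent_mat_obtain[OF nil(1) N(1)] nilpotent_mat_obtain[OF nil(2) N(2)]
      nilpotent_mat_obtain[OF nil(3) N(3)] by metis
  define v :: "complex vec" where "v = unit_vec m 0"
  have v: "v \<in> carrier_vec m" "v \<noteq> 0\<^sub>v m"
    using m unit_vec_nonzero[of 0 m] by (auto simp: v_def)
  obtain j1 where j1: "(((*\<^sub>v) N1) ^^ j1) v \<noteq> 0\<^sub>v m" "N1 *\<^sub>v (((*\<^sub>v) N1) ^^ j1) v = 0\<^sub>v m"
    using nilpotent_kernel_in_orbit[OF N(1) v k(1)[OF v(1)]] by blast
  define v1 where "v1 = (((*\<^sub>v) N1) ^^ j1) v"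
  have v1: "v1 \<in> carrier_vec m" "v1 \<noteq> 0\<^sub>v m" "N1 *\<^sub>v v1 = 0\<^sub>v m"
    using j1 funpow_mult_mat_vec_carrier[OF N(1) v(1)] by (auto simp: v1_def)
  obtain j2 where j2: "(((*\<^sub>v) N2) ^^ j2) v1 \<noteq> 0\<^sub>v m" "N2 *\<^sub>v (((*\<^sub>v) N2) ^^ j2) v1 = 0\<^sub>v m"
    using nilpotent_kernel_in_orbit[OF N(2) v1(1,2) k(2)[OF v1(1)]] by blast
  define v2 where "v2 = (((*\<^sub>v) N2) ^^ j2) v1"
  have v2: "v2 \<in> carrier_vec m" "v2 \<noteq> 0\<^sub>v m" "N1 *\<^sub>v v2 = 0\<^sub>v m" "N2 *\<^sub>v v2 = 0\<^sub>v m"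
    using j2 funpow_mult_mat_vec_carrier[OF N(2) v1(1)]
      commuting_kernel_invariant[OF N(1,2) v1(1) comm(1) v1(3)] by (auto simp: v2_def)
  obtain j3 where j3: "(((*\<^sub>v) N3) ^^ j3) v2 \<noteq> 0\<^sub>v m" "N3 *\<^sub>v (((*\<^sub>v) N3) ^^ j3) v2 = 0\<^sub>v m"
    using nilpotent_kernel_in_orbit[OF N(3) v2(1,2) k(3)[OF v2(1)]] by blast
  show False
    using reg[OF funpow_mult_mat_vec_carrier[OF N(3) v2(1)]
        commuting_kernel_invariant[OF N(1,3) v2(1) comm(2) v2(3)]
        commuting_kernel_invariant[OF N(2,3) v2(1) comm(3) v2(4)] j3(2)] j3(1) by simp
qed

section \<open>Uniform decay over families of functions\<close>

lemma off_grid_eq: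
  assumes "\<tau> > 0"
  shows "off_grid \<tau> = (\<Union>n::nat. {real n * \<tau><..<real (Suc n) * \<tau>})"
proof (intro equalityI subsetI)
  fix t assume t: "t \<in> off_grid \<tau>"
  define n where "n = nat \<lfloor>t / \<tau>\<rfloor>"
  have "t / \<tau> \<ge> 0" using t assms by (auto simp: off_grid_def)
  hence "real n \<le> t / \<tau>" "t / \<tau> < real (Suc n)"
    unfolding n_def by linarith+
  hence "real n * \<tau> \<le> t" "t < real (Suc n) * \<tau>"
    using assms by (simp_all only: pos_le_divide_eq pos_divide_less_eq)
  moreover have "t \<noteq> real n * \<tau>" using t by (auto simp: off_grid_def)
  ultimately show "t \<in> (\<Union>n::nat. {real n * \<tau><..<real (Suc n) * \<tau>})" by force
next
  fix t assume "t \<in> (\<Union>n::nat. {real n * \<tau><..<real (Suc n) * \<tau>})"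
  then obtain n :: nat where "real n * \<tau> < t" "t < real (Suc n) * \<tau>" by auto
  hence "0 < t - real n * \<tau>" "t - real n * \<tau> < \<tau>" by (auto simp: algebra_simps)
  from between_multiples_off_grid[OF assms this, of n] show "t \<in> off_grid \<tau>" by simp
qed

lemma open_off_grid: "\<tau> > 0 \<Longrightarrow> open (off_grid \<tau>)"
  by (simp add: off_grid_eq open_UN)

text \<open>An open set, so that derivatives depend only on values inside it, which contains
  \<open>t - \<tau>\<close> for every \<open>t\<close> off the grid. The initial interval enters
  without its end points, where the derivatives of initial functions are one-sided.\<close>

definition delay_domain :: "real \<Rightarrow> real set" where
  "delay_domain \<tau> = {-\<tau><..<0} \<union> off_grid \<tau>"

lemma open_delay_domain: "\<tau> > 0 \<Longrightarrow> open (delay_domain \<tau>)"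
  by (simp add: delay_domain_def open_off_grid open_Un)

lemma delay_domain_gt: "\<tau> > 0 \<Longrightarrow> t \<in> delay_domain \<tau> \<Longrightarrow> -\<tau> < t"
  by (auto simp: delay_domain_def off_grid_def)

lemma off_grid_minus: 
  assumes "\<tau> > 0" "t \<in> off_grid \<tau>"
  shows "t - \<tau> \<in> delay_domain \<tau>"
proof -
  have ne: "t \<noteq> real j * \<tau>" for j :: nat using assms by (auto simp: off_grid_def)
  have "t - \<tau> \<noteq> real j * \<tau>" for j :: nat
    using ne[of "Suc j"] by (auto simp: algebra_simps)
  moreover have "t - \<tau> \<noteq> 0" using ne[of 1] by auto
  moreover have "t > 0" using assms by (auto simp: off_grid_def)
  ultimately show ?thesis by (auto simp: delay_domain_def off_grid_def)
qed

text \<open>The method of steps as an induction rule: subtracting \<open>\<tau>\<close> repeatedly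
  ends in the open initial interval and never meets the grid.\<close>

lemma delay_domain_induct [consumes 2, case_names initial step]:
  assumes "\<tau> > 0" "t \<in> delay_domain \<tau>"
    and init: "\<And>t. -\<tau> < t \<Longrightarrow> t < 0 \<Longrightarrow> Q t"
    and step: "\<And>t. t \<in> off_grid \<tau> \<Longrightarrow> Q (t - \<tau>) \<Longrightarrow> Q t"
  shows "Q t"
proof -
  have "\<forall>t\<in>delay_domain \<tau>. t < real n * \<tau> \<longrightarrow> Q t" for n
  proof (induction n)
    case 0
    thus ?case using init delay_domain_gt[OF assms(1)] by auto
  next
    case (Suc n)
    show ?case
    proof (intro ballI impI)
      fix t assume t: "t \<in> delay_domain \<tau>" "t < real (Suc n) * \<tau>"
      show "Q t"
      proof (cases "t \<in> off_grid \<tau>")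
        case True
        moreover have "t - \<tau> < real n * \<tau>" using t by (simp add: algebra_simps)
        ultimately show ?thesis using Suc off_grid_minus[OF assms(1) True] step by blast
      next
        case False
        thus ?thesis using t init by (auto simp: delay_domain_def)
      qed
    qed
  qed
  moreover have "t < real (Suc (nat \<lceil>t / \<tau>\<rceil>)) * \<tau>"
  proof -
    have "t / \<tau> < real (Suc (nat \<lceil>t / \<tau>\<rceil>))" by linarith
    thus ?thesis using assms(1) by (simp only: pos_divide_less_eq)
  qed
  ultimately show ?thesis using assms(2) by blast
qed

text \<open>The index \<open>a\<close> ranges over all solutions, with \<open>K a\<close> the norm of the initial function:
  the constants in \<open>decays\<close> are uniform in \<open>a\<close>.\<close>

locale delay_family =
  fixes \<tau> :: real and S :: "'a set" and K :: "'a \<Rightarrow> real"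
  assumes tau: "\<tau> > 0" and K_nonneg: "a \<in> S \<Longrightarrow> K a \<ge> 0"
begin

abbreviation "ini \<equiv> {-\<tau><..<0}"
abbreviation "offgrid \<equiv> off_grid \<tau>"
abbreviation "domn \<equiv> delay_domain \<tau>"

definition decays :: "real set \<Rightarrow> ('a \<Rightarrow> real \<Rightarrow> complex) \<Rightarrow> bool" where
  "decays T f \<longleftrightarrow> (\<exists>C \<gamma>. C \<ge> 0 \<and> \<gamma> > 0 \<and>
     (\<forall>a\<in>S. \<forall>t\<in>T. -\<tau> < t \<longrightarrow> cmod (f a t) \<le> C * K a * exp (- \<gamma> * t)))"

lemma decaysI:
  assumes "C \<ge> 0" "\<gamma> > 0"
    "\<And>a t. a \<in> S \<Longrightarrow> t \<in> T \<Longrightarrow> -\<tau> < t \<Longrightarrow> cmod (f a t) \<le> C * K a * exp (- \<gamma> * t)"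
  shows "decays T f"
  using assms unfolding decays_def by blast

text \<open>For \<open>t < 0\<close> a smaller rate gives a smaller bound; as
  \<open>t > - \<tau>\<close>, the factor \<open>exp (\<gamma> * \<tau>)\<close> makes up for it.
  Two decaying families can thus be brought to a common rate.\<close>

lemma decays_slower:
  assumes "decays T f"
  obtains C \<gamma> where "C \<ge> 0" "\<gamma> > 0"
    "\<And>a t \<gamma>'. a \<in> S \<Longrightarrow> t \<in> T \<Longrightarrow> -\<tau> < t \<Longrightarrow> 0 \<le> \<gamma>' \<Longrightarrow> \<gamma>' \<le> \<gamma> \<Longrightarrow>
      cmod (f a t) \<le> C * K a * exp (- \<gamma>' * t)"
proof -
  obtain C \<gamma> where C: "C \<ge> 0" "\<gamma> > 0"
    "\<And>a t. a \<in> S \<Longrightarrow> t \<in> T \<Longrightarrow> -\<tau> < t \<Longrightarrow> cmod (f a t) \<le> C * K a * exp (- \<gamma> * t)"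
    using assms unfolding decays_def by blast
  show thesis
  proof (rule that[of "C * exp (\<gamma> * \<tau>)" \<gamma>])
    fix a t \<gamma>' assume *: "a \<in> S" "t \<in> T" "-\<tau> < t" "0 \<le> \<gamma>'" "\<gamma>' \<le> \<gamma>"
    have "(\<gamma> - \<gamma>') * (- t) \<le> (\<gamma> - \<gamma>') * \<tau>" using * by (intro mult_left_mono) auto
    also have "\<dots> \<le> \<gamma> * \<tau>" using * tau by (intro mult_right_mono) auto
    finally have "- \<gamma> * t \<le> \<gamma> * \<tau> + - \<gamma>' * t" by (simp add: algebra_simps)
    hence "exp (- \<gamma> * t) \<le> exp (\<gamma> * \<tau>) * exp (- \<gamma>' * t)" by (simp flip: exp_add)
    hence "C * K a * exp (- \<gamma> * t) \<le> C * K a * (exp (\<gamma> * \<tau>) * exp (- \<gamma>' * t))"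
      using C K_nonneg * by (intro mult_left_mono) auto
    with C(3)[OF *(1-3)] show "cmod (f a t) \<le> C * exp (\<gamma> * \<tau>) * K a * exp (- \<gamma>' * t)"
      by (simp add: mult_ac)
  qed (use C in auto)
qed

lemma decays_subset: "decays T f \<Longrightarrow> T' \<subseteq> T \<Longrightarrow> decays T' f"
  unfolding decays_def by blast

lemma decays_cong:
  "(\<And>a t. a \<in> S \<Longrightarrow> t \<in> T \<Longrightarrow> f a t = h a t) \<Longrightarrow> decays T f \<Longrightarrow> decays T h"
  unfolding decays_def by (metis (no_types, lifting))

lemma decays_zero: "decays T (\<lambda>a t. 0)"
  by (rule decaysI[of 0 1]) auto

lemma decays_add:
  assumes "decays T f" "decays T g"
  shows "decays T (\<lambda>a t. f a t + g a t)"
proof -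
  obtain C1 \<gamma>1 where 1: "C1 \<ge> 0" "\<gamma>1 > 0"
    "\<And>a t \<gamma>'. a \<in> S \<Longrightarrow> t \<in> T \<Longrightarrow> -\<tau> < t \<Longrightarrow> 0 \<le> \<gamma>' \<Longrightarrow> \<gamma>' \<le> \<gamma>1 \<Longrightarrow>
      cmod (f a t) \<le> C1 * K a * exp (- \<gamma>' * t)" using decays_slower[OF assms(1)] by blast
  obtain C2 \<gamma>2 where 2: "C2 \<ge> 0" "\<gamma>2 > 0"
    "\<And>a t \<gamma>'. a \<in> S \<Longrightarrow> t \<in> T \<Longrightarrow> -\<tau> < t \<Longrightarrow> 0 \<le> \<gamma>' \<Longrightarrow> \<gamma>' \<le> \<gamma>2 \<Longrightarrow>
      cmod (g a t) \<le> C2 * K a * exp (- \<gamma>' * t)" using decays_slower[OF assms(2)] by blast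
  show ?thesis
  proof (rule decaysI[of "C1 + C2" "min \<gamma>1 \<gamma>2"])
    fix a t assume *: "a \<in> S" "t \<in> T" "-\<tau> < t"
    show "cmod (f a t + g a t) \<le> (C1 + C2) * K a * exp (- min \<gamma>1 \<gamma>2 * t)"
      using norm_triangle_le[OF add_mono[OF 1(3)[OF *, of "min \<gamma>1 \<gamma>2"] 2(3)[OF *, of "min \<gamma>1 \<gamma>2"]]]
        1(2) 2(2) by (simp add: distrib_right)
  qed (use 1 2 in auto)
qed

lemma decays_Un:
  assumes "decays T1 f" "decays T2 f"
  shows "decays (T1 \<union> T2) f"
proof -
  obtain C1 \<gamma>1 where 1: "C1 \<ge> 0" "\<gamma>1 > 0"
    "\<And>a t \<gamma>'. a \<in> S \<Longrightarrow> t \<in> T1 \<Longrightarrow> -\<tau> < t \<Longrightarrow> 0 \<le> \<gamma>' \<Longrightarrow> \<gamma>' \<le> \<gamma>1 \<Longrightarrow>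
      cmod (f a t) \<le> C1 * K a * exp (- \<gamma>' * t)" using decays_slower[OF assms(1)] by blast
  obtain C2 \<gamma>2 where 2: "C2 \<ge> 0" "\<gamma>2 > 0"
    "\<And>a t \<gamma>'. a \<in> S \<Longrightarrow> t \<in> T2 \<Longrightarrow> -\<tau> < t \<Longrightarrow> 0 \<le> \<gamma>' \<Longrightarrow> \<gamma>' \<le> \<gamma>2 \<Longrightarrow>
      cmod (f a t) \<le> C2 * K a * exp (- \<gamma>' * t)" using decays_slower[OF assms(2)] by blast
  show ?thesis
  proof (rule decaysI[of "max C1 C2" "min \<gamma>1 \<gamma>2"])
    fix a t assume *: "a \<in> S" "t \<in> T1 \<union> T2" "-\<tau> < t"
    have "cmod (f a t) \<le> C1 * (K a * exp (- min \<gamma>1 \<gamma>2 * t)) \<or>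
        cmod (f a t) \<le> C2 * (K a * exp (- min \<gamma>1 \<gamma>2 * t))"
      using 1(3)[OF *(1) _ *(3), of "min \<gamma>1 \<gamma>2"] 2(3)[OF *(1) _ *(3), of "min \<gamma>1 \<gamma>2"]
        1(2) 2(2) *(2) by (auto simp: mult.assoc)
    moreover have "C * (K a * exp (- min \<gamma>1 \<gamma>2 * t)) \<le> max C1 C2 * (K a * exp (- min \<gamma>1 \<gamma>2 * t))"
      if "C \<in> {C1, C2}" for C
      using that K_nonneg[OF *(1)] by (intro mult_right_mono) auto
    ultimately show "cmod (f a t) \<le> max C1 C2 * K a * exp (- min \<gamma>1 \<gamma>2 * t)"
      by (fastforce simp: mult.assoc)
  qed (use 1 2 in auto)
qed

lemma decays_cmult:
  assumes "decays T f"
  shows "decays T (\<lambda>a t. c * f a t)"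
proof -
  obtain C \<gamma> where C: "C \<ge> 0" "\<gamma> > 0"
    "\<And>a t. a \<in> S \<Longrightarrow> t \<in> T \<Longrightarrow> -\<tau> < t \<Longrightarrow> cmod (f a t) \<le> C * K a * exp (- \<gamma> * t)"
    using assms unfolding decays_def by blast
  show ?thesis
  proof (rule decaysI[of "cmod c * C" \<gamma>])
    fix a t assume *: "a \<in> S" "t \<in> T" "-\<tau> < t"
    show "cmod (c * f a t) \<le> cmod c * C * K a * exp (- \<gamma> * t)"
      using mult_left_mono[OF C(3)[OF *], of "cmod c"] by (simp add: norm_mult mult.assoc)
  qed (use C in auto)
qed

lemma decays_delay:
  assumes "decays domn f"
  shows "decays offgrid (\<lambda>a t. f a (t - \<tau>))"
proof -
  obtain C \<gamma> where C: "C \<ge> 0" "\<gamma> > 0"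
    "\<And>a t. a \<in> S \<Longrightarrow> t \<in> domn \<Longrightarrow> -\<tau> < t \<Longrightarrow> cmod (f a t) \<le> C * K a * exp (- \<gamma> * t)"
    using assms unfolding decays_def by blast
  show ?thesis
  proof (rule decaysI[of "C * exp (\<gamma> * \<tau>)" \<gamma>])
    fix a t assume *: "a \<in> S" "t \<in> offgrid" "-\<tau> < t"
    have "cmod (f a (t - \<tau>)) \<le> C * K a * exp (- \<gamma> * (t - \<tau>))"
      using * off_grid_minus[OF tau *(2)] delay_domain_gt[OF tau] by (intro C) auto
    also have "exp (- \<gamma> * (t - \<tau>)) = exp (\<gamma> * \<tau>) * exp (- \<gamma> * t)"
      by (simp add: algebra_simps flip: exp_add)
    finally show "cmod (f a (t - \<tau>)) \<le> C * exp (\<gamma> * \<tau>) * K a * exp (- \<gamma> * t)"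
      by (simp add: mult_ac)
  qed (use C in auto)
qed

section \<open>Decay of derivatives\<close>

primrec smooth_decay :: "real set \<Rightarrow> nat \<Rightarrow> ('a \<Rightarrow> real \<Rightarrow> complex) \<Rightarrow> bool" where
  "smooth_decay T 0 f \<longleftrightarrow> decays T f"
| "smooth_decay T (Suc p) f \<longleftrightarrow> decays T f \<and>
     (\<exists>f'. (\<forall>a\<in>S. \<forall>t\<in>T. (f a has_vector_derivative f' a t) (at t)) \<and> smooth_decay T p f')"

lemma smooth_decay_decays: "smooth_decay T p f \<Longrightarrow> decays T f"
  by (cases p) auto

lemma smooth_decay_le: "smooth_decay T q f \<Longrightarrow> p \<le> q \<Longrightarrow> smooth_decay T p f"
proof (induction p arbitrary: f q)
  case 0
  thus ?case by (simp add: smooth_decay_decays)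
next
  case (Suc p)
  then obtain q' where q': "q = Suc q'" "p \<le> q'" by (cases q) auto
  then obtain f' where "\<forall>a\<in>S. \<forall>t\<in>T. (f a has_vector_derivative f' a t) (at t)"
    "smooth_decay T q' f'" "decays T f" using Suc.prems by auto
  thus ?case using Suc.IH[of q' f'] q' by (auto intro!: exI[of _ f'])
qed

lemma smooth_decay_subset:
  "smooth_decay T p f \<Longrightarrow> T' \<subseteq> T \<Longrightarrow> smooth_decay T' p f"
proof (induction p arbitrary: f)
  case (Suc p)
  then obtain f' where "\<forall>a\<in>S. \<forall>t\<in>T. (f a has_vector_derivative f' a t) (at t)" "smooth_decay T p f'"
    by auto
  thus ?case using Suc by (auto intro: decays_subset intro!: exI[of _ f'])
qed (simp add: decays_subset)

text \<open>Openness lets \<open>h\<close> inherit the derivative of \<open>f\<close>; higher orders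
  need no further argument, as the same \<open>f'\<close> serves both.\<close>

lemma smooth_decay_cong:
  assumes "open T" "\<And>a t. a \<in> S \<Longrightarrow> t \<in> T \<Longrightarrow> f a t = h a t" "smooth_decay T p f"
  shows "smooth_decay T p h"
proof (cases p)
  case 0
  thus ?thesis using assms decays_cong[of T f h] by simp
next
  case (Suc q)
  then obtain f' where f': "\<forall>a\<in>S. \<forall>t\<in>T. (f a has_vector_derivative f' a t) (at t)"
    "smooth_decay T q f'" "decays T f" using assms(3) by auto
  have "(h a has_vector_derivative f' a t) (at t)" if "a \<in> S" "t \<in> T" for a t
    using f'(1) that assms(1,2) has_vector_derivative_transform_within_open[of "f a" "f' a t" t T "h a"]
    by blast
  thus ?thesis using f' Suc decays_cong[of T f h] assms(2) by auto
qed

lemma smooth_decay_zero: "smooth_decay T p (\<lambda>a t. 0)"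
proof (induction p)
  case (Suc p)
  thus ?case by (auto simp: decays_zero intro!: exI[of _ "\<lambda>a t. 0"])
qed (simp add: decays_zero)

lemma smooth_decay_add:
  "smooth_decay T p f \<Longrightarrow> smooth_decay T p g \<Longrightarrow> smooth_decay T p (\<lambda>a t. f a t + g a t)"
proof (induction p arbitrary: f g)
  case (Suc p)
  then obtain f' g' where
    "\<forall>a\<in>S. \<forall>t\<in>T. (f a has_vector_derivative f' a t) (at t)" "smooth_decay T p f'"
    "\<forall>a\<in>S. \<forall>t\<in>T. (g a has_vector_derivative g' a t) (at t)" "smooth_decay T p g'" by auto
  thus ?case using Suc
    by (auto intro!: decays_add exI[of _ "\<lambda>a t. f' a t + g' a t"] has_vector_derivative_add)
qed (simp add: decays_add)

lemma smooth_decay_cmult: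
  "smooth_decay T p f \<Longrightarrow> smooth_decay T p (\<lambda>a t. c * f a t)"
proof (induction p arbitrary: f)
  case (Suc p)
  then obtain f' where
    "\<forall>a\<in>S. \<forall>t\<in>T. (f a has_vector_derivative f' a t) (at t)" "smooth_decay T p f'" by auto
  thus ?case using Suc
    by (auto intro!: decays_cmult exI[of _ "\<lambda>a t. c * f' a t"] has_vector_derivative_mult_right)
qed (simp add: decays_cmult)

lemma smooth_decay_sum:
  "finite J \<Longrightarrow> (\<And>j. j \<in> J \<Longrightarrow> smooth_decay T p (f j)) \<Longrightarrow> smooth_decay T p (\<lambda>a t. \<Sum>j\<in>J. f j a t)"
  by (induction J rule: finite_induct) (auto intro: smooth_decay_zero smooth_decay_add)

lemma smooth_decay_delay:
  "smooth_decay domn p f \<Longrightarrow> smooth_decay offgrid p (\<lambda>a t. f a (t - \<tau>))"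
proof (induction p arbitrary: f)
  case (Suc p)
  then obtain f' where f':
    "\<forall>a\<in>S. \<forall>t\<in>domn. (f a has_vector_derivative f' a t) (at t)" "smooth_decay domn p f'" by auto
  have "((\<lambda>t. f a (t - \<tau>)) has_vector_derivative f' a (t - \<tau>)) (at t)"
    if "a \<in> S" "t \<in> offgrid" for a t
  proof -
    have "((\<lambda>t. t - \<tau>) has_vector_derivative 1) (at t)" by (auto intro!: derivative_eq_intros)
    moreover have "(f a has_vector_derivative f' a (t - \<tau>)) (at (t - \<tau>))"
      using f' that off_grid_minus[OF tau] by blast
    ultimately show ?thesis using vector_diff_chain_at[of "\<lambda>t. t - \<tau>" 1 t "f a" "f' a (t - \<tau>)"]
      by (simp add: o_def)
  qed
  thus ?case using Suc f' by (auto intro!: decays_delay exI[of _ "\<lambda>a t. f' a (t - \<tau>)"])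
qed (simp add: decays_delay)

text \<open>The rate is lowered until \<open>cmod c * exp (\<gamma> * \<tau>) \<le> q < 1\<close>;
  then a bound with constant \<open>M\<close> reproduces itself over each delay as soon as
  \<open>q * M + C2 \<le> M\<close>.\<close>

lemma decays_difference_equation:
  assumes c: "cmod c < 1"
    and eq: "\<And>a t. a \<in> S \<Longrightarrow> t \<in> offgrid \<Longrightarrow> f a t = c * f a (t - \<tau>) + g a t"
    and f: "decays ini f" and g: "decays offgrid g"
  shows "decays domn f"
proof -
  obtain C1 \<gamma>1 where 1: "C1 \<ge> 0" "\<gamma>1 > 0"
    "\<And>a t \<gamma>'. a \<in> S \<Longrightarrow> t \<in> ini \<Longrightarrow> -\<tau> < t \<Longrightarrow> 0 \<le> \<gamma>' \<Longrightarrow> \<gamma>' \<le> \<gamma>1 \<Longrightarrow>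
      cmod (f a t) \<le> C1 * K a * exp (- \<gamma>' * t)" using decays_slower[OF f] by blast
  obtain C2 \<gamma>2 where 2: "C2 \<ge> 0" "\<gamma>2 > 0"
    "\<And>a t \<gamma>'. a \<in> S \<Longrightarrow> t \<in> offgrid \<Longrightarrow> -\<tau> < t \<Longrightarrow> 0 \<le> \<gamma>' \<Longrightarrow> \<gamma>' \<le> \<gamma>2 \<Longrightarrow>
      cmod (g a t) \<le> C2 * K a * exp (- \<gamma>' * t)" using decays_slower[OF g] by blast
  \<comment> \<open>\<open>2 / (1 + cmod c)\<close> exceeds 1, and \<open>cmod c\<close> times it is
    still below 1; its logarithm makes sense for \<open>c = 0\<close> too.\<close>
  define q where "q = cmod c * (2 / (1 + cmod c))"
  have q: "q < 1" using c by (simp add: q_def divide_less_eq add_pos_nonneg)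
  define \<gamma> where "\<gamma> = min (min \<gamma>1 \<gamma>2) (ln (2 / (1 + cmod c)) / \<tau>)"
  have \<gamma>: "\<gamma> > 0" "\<gamma> \<le> \<gamma>1" "\<gamma> \<le> \<gamma>2" using 1 2 c tau
    by (auto simp: \<gamma>_def add_pos_nonneg ln_gt_zero_iff)
  have "\<gamma> * \<tau> \<le> ln (2 / (1 + cmod c))"
    using tau by (simp add: \<gamma>_def flip: pos_le_divide_eq)
  hence "exp (\<gamma> * \<tau>) \<le> exp (ln (2 / (1 + cmod c)))" by simp
  also have "\<dots> = 2 / (1 + cmod c)" by (simp add: add_pos_nonneg)
  finally have ce: "cmod c * exp (\<gamma> * \<tau>) \<le> q" unfolding q_def by (intro mult_left_mono) auto
  \<comment> \<open>The last summand is the fixed point of \<open>q * M + C2 = M\<close>; adding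
    \<open>C1\<close> covers the initial interval and preserves the inequality.\<close>
  define M where "M = C1 + C2 / (1 - q)"
  have M: "M \<ge> C1" "M \<ge> 0" using 1 2 q by (auto simp: M_def)
  have qM: "q * M + C2 \<le> M"
  proof -
    have "(1 - q) * M = (1 - q) * C1 + C2" using q by (simp add: M_def distrib_left)
    moreover have "(1 - q) * C1 \<ge> 0" using 1 q by simp
    ultimately show ?thesis by (simp add: algebra_simps)
  qed
  show ?thesis
  proof (rule decaysI[OF M(2) \<gamma>(1)])
    fix a t assume a: "a \<in> S" and t: "t \<in> domn"
    note K = K_nonneg[OF a]
    from tau t show "cmod (f a t) \<le> M * K a * exp (- \<gamma> * t)"
    proof (induction rule: delay_domain_induct)
      case (initial t)
      have "cmod (f a t) \<le> C1 * K a * exp (- \<gamma> * t)"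
        using a initial \<gamma> by (intro 1(3)) auto
      also have "\<dots> \<le> M * K a * exp (- \<gamma> * t)" using M K by (intro mult_right_mono) auto
      finally show ?case .
    next
      case (step t)
      have t: "-\<tau> < t" using step(1) tau by (auto simp: off_grid_def)
      have "cmod (f a t) \<le> cmod c * cmod (f a (t - \<tau>)) + cmod (g a t)"
        unfolding eq[OF a step(1)] by (metis norm_mult norm_triangle_ineq)
      also have "\<dots> \<le> cmod c * (M * K a * exp (- \<gamma> * (t - \<tau>))) + C2 * K a * exp (- \<gamma> * t)"
        using step a t \<gamma> by (intro add_mono mult_left_mono 2(3)) auto
      also have "\<dots> = (cmod c * exp (\<gamma> * \<tau>) * M + C2) * (K a * exp (- \<gamma> * t))"
        by (simp add: algebra_simps flip: exp_add)
      also have "\<dots> \<le> (q * M + C2) * (K a * exp (- \<gamma> * t))"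
        using ce M K by (intro mult_right_mono add_right_mono) auto
      also have "\<dots> \<le> M * (K a * exp (- \<gamma> * t))"
        using qM K by (intro mult_right_mono) auto
      finally show ?case by (simp add: mult.assoc)
    qed
  qed
qed

text \<open>The derivative of \<open>f\<close> satisfies the same equation with \<open>g'\<close>
  for \<open>g\<close>, which allows induction on the order. Differentiability is given on the
  initial interval only; the equation transports it from one interval to the next.\<close>

lemma smooth_decay_difference_equation:
  assumes c: "cmod c < 1"
  shows "(\<And>a t. a \<in> S \<Longrightarrow> t \<in> offgrid \<Longrightarrow> f a t = c * f a (t - \<tau>) + g a t) \<Longrightarrow>
    smooth_decay ini p f \<Longrightarrow> smooth_decay offgrid p g \<Longrightarrow> smooth_decay domn p f"
proof (induction p arbitrary: f g)
  case 0
  thus ?case using decays_difference_equation[OF c, of f g] by simp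
next
  case (Suc p)
  obtain fi where fi: "\<forall>a\<in>S. \<forall>t\<in>ini. (f a has_vector_derivative fi a t) (at t)" "smooth_decay ini p fi"
    using Suc.prems(2) by auto
  obtain g' where g': "\<forall>a\<in>S. \<forall>t\<in>offgrid. (g a has_vector_derivative g' a t) (at t)" "smooth_decay offgrid p g'"
    using Suc.prems(3) by auto
  \<comment> \<open>Differentiability is not known yet, hence a total operator; \<open>deriv\<close>
    below shows that its value is a derivative on the whole domain.\<close>
  define f' where "f' = (\<lambda>a t. vector_derivative (f a) (at t))"
  have fi': "f' a t = fi a t" if "a \<in> S" "t \<in> ini" for a t
    using fi that by (auto simp: f'_def intro!: vector_derivative_at)
  have step_deriv: "(f a has_vector_derivative c * d + g' a t) (at t)"
    if a: "a \<in> S" and t: "t \<in> offgrid" and d: "(f a has_vector_derivative d) (at (t - \<tau>))" for a t d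
  proof -
    have "((\<lambda>t. t - \<tau>) has_vector_derivative 1) (at t)" by (auto intro!: derivative_eq_intros)
    from vector_diff_chain_at[OF this d]
    have "((\<lambda>t. f a (t - \<tau>)) has_vector_derivative d) (at t)" by (simp add: o_def)
    hence "((\<lambda>t. c * f a (t - \<tau>) + g a t) has_vector_derivative c * d + g' a t) (at t)"
      using g' a t by (intro has_vector_derivative_add has_vector_derivative_mult_right) auto
    thus ?thesis
      by (rule has_vector_derivative_transform_within_open[OF _ open_off_grid[OF tau] t])
        (use Suc.prems(1)[OF a] in auto)
  qed
  have deriv: "(f a has_vector_derivative f' a t) (at t)" if a: "a \<in> S" and t: "t \<in> domn" for a t
    using tau t
  proof (induction rule: delay_domain_induct)
    case (initial t)
    thus ?case using fi fi' a by auto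
  next
    case (step t)
    from step_deriv[OF a step] show ?case
      unfolding f'_def using vector_derivative_works differentiableI_vector by blast
  qed
  have "smooth_decay domn p f'"
  proof (rule Suc.IH[OF _ _ g'(2)])
    fix a t assume at: "a \<in> S" "t \<in> offgrid"
    have "(f a has_vector_derivative c * f' a (t - \<tau>) + g' a t) (at t)"
      using step_deriv[OF at] deriv[OF at(1) off_grid_minus[OF tau at(2)]] by blast
    thus "f' a t = c * f' a (t - \<tau>) + g' a t"
      by (simp add: f'_def vector_derivative_at)
  next
    show "smooth_decay ini p f'"
      by (rule smooth_decay_cong[OF _ _ fi(2)]) (use fi' in auto)
  qed
  moreover have "decays domn f"
    using decays_difference_equation[OF c, of f g] Suc.prems by auto
  ultimately show ?case using deriv by auto
qed

section \<open>Vector-valued families\<close>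

definition vec_family :: "nat \<Rightarrow> ('a \<Rightarrow> real \<Rightarrow> complex vec) \<Rightarrow> bool" where
  "vec_family m Y \<longleftrightarrow> (\<forall>a\<in>S. \<forall>t>-\<tau>. Y a t \<in> carrier_vec m)"

definition vec_smooth_decay :: "real set \<Rightarrow> nat \<Rightarrow> nat \<Rightarrow> ('a \<Rightarrow> real \<Rightarrow> complex vec) \<Rightarrow> bool" where
  "vec_smooth_decay T p m Y \<longleftrightarrow> (\<forall>i<m. smooth_decay T p (\<lambda>a t. Y a t $ i))"

lemma vec_family_mult: "vec_family m Y \<Longrightarrow> M \<in> carrier_mat k m \<Longrightarrow> vec_family k (\<lambda>a t. M *\<^sub>v Y a t)"
  by (auto simp: vec_family_def)

lemma vec_smooth_decay_mult:
  assumes "open T" "T \<subseteq> {-\<tau><..}" "vec_family m Y" "M \<in> carrier_mat k m" "vec_smooth_decay T p m Y"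
  shows "vec_smooth_decay T p k (\<lambda>a t. M *\<^sub>v Y a t)"
  unfolding vec_smooth_decay_def
proof (intro allI impI)
  fix i assume i: "i < k"
  show "smooth_decay T p (\<lambda>a t. (M *\<^sub>v Y a t) $ i)"
  proof (rule smooth_decay_cong[OF assms(1)])
    show "smooth_decay T p (\<lambda>a t. \<Sum>j<m. M $$ (i, j) * Y a t $ j)"
      using assms(5) by (intro smooth_decay_sum smooth_decay_cmult) (auto simp: vec_smooth_decay_def)
    fix a t assume at: "a \<in> S" "t \<in> T"
    hence "Y a t \<in> carrier_vec m" using assms(2,3) by (auto simp: vec_family_def)
    from mult_mat_vec_entry[OF assms(4) this i]
    show "(\<Sum>j<m. M $$ (i, j) * Y a t $ j) = (M *\<^sub>v Y a t) $ i" by simp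
  qed
qed

lemma vec_smooth_decay_shift_mult:
  assumes "open T" "T \<subseteq> {-\<tau><..}" "vec_family m Y" "M \<in> carrier_mat m m" "vec_smooth_decay T p m Y"
  shows "vec_smooth_decay T p m (\<lambda>a t. shift_mult M c (Y a t))"
  unfolding vec_smooth_decay_def
proof (intro allI impI)
  fix i assume i: "i < m"
  show "smooth_decay T p (\<lambda>a t. shift_mult M c (Y a t) $ i)"
  proof (rule smooth_decay_cong[OF assms(1)])
    show "smooth_decay T p (\<lambda>a t. (M *\<^sub>v Y a t) $ i + (- c) * Y a t $ i)"
      using assms(5) vec_smooth_decay_mult[OF assms] i
      by (intro smooth_decay_add smooth_decay_cmult) (auto simp: vec_smooth_decay_def)
    fix a t assume at: "a \<in> S" "t \<in> T"
    hence "Y a t \<in> carrier_vec m" using assms(2,3) by (auto simp: vec_family_def)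
    thus "(M *\<^sub>v Y a t) $ i + (- c) * Y a t $ i = shift_mult M c (Y a t) $ i"
      using i assms(4) by (simp add: shift_mult_def)
  qed
qed

end

section \<open>The three kinds of blocks\<close>

lemma mult_mat_vec_deriv:
  fixes u :: "real \<Rightarrow> complex vec" and d :: "complex vec"
  assumes W: "W \<in> carrier_mat m n" and u: "\<And>s. u s \<in> carrier_vec n" and d: "d \<in> carrier_vec n"
    and deriv: "\<And>j. j < n \<Longrightarrow> ((\<lambda>s. u s $ j) has_vector_derivative d $ j) (at t)" and i: "i < m"
  shows "((\<lambda>s. (W *\<^sub>v u s) $ i) has_vector_derivative (W *\<^sub>v d) $ i) (at t)"
  unfolding mult_mat_vec_entry[OF W u i] mult_mat_vec_entry[OF W d i]
  by (intro has_vector_derivative_sum has_vector_derivative_mult_right deriv) auto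

lemma shift_mult_eq_mat:
  assumes "C \<in> carrier_mat m m" "v \<in> carrier_vec m"
  shows "shift_mult C c v = (C - c \<cdot>\<^sub>m 1\<^sub>m m) *\<^sub>v v"
proof -
  have "(C - c \<cdot>\<^sub>m 1\<^sub>m m) *\<^sub>v v = C *\<^sub>v v - (c \<cdot>\<^sub>m 1\<^sub>m m) *\<^sub>v v"
    using assms by (intro minus_mult_distrib_mat_vec[of _ m m]) auto
  also have "(c \<cdot>\<^sub>m 1\<^sub>m m) *\<^sub>v v = c \<cdot>\<^sub>v v"
    using assms(2) by (intro eq_vecI) auto
  finally show ?thesis by (simp add: shift_mult_def)
qed

lemma shift_mat_commute:
  fixes C E :: "complex mat"
  assumes "C \<in> carrier_mat m m" "E \<in> carrier_mat m m" "C * E = E * C"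
  shows "(C - c \<cdot>\<^sub>m 1\<^sub>m m) * E = E * (C - c \<cdot>\<^sub>m 1\<^sub>m m)"
proof -
  have "(C - c \<cdot>\<^sub>m 1\<^sub>m m) * E = C * E - (c \<cdot>\<^sub>m 1\<^sub>m m) * E"
    using assms by (intro minus_mult_distrib_mat) auto
  moreover have "E * (C - c \<cdot>\<^sub>m 1\<^sub>m m) = E * C - E * (c \<cdot>\<^sub>m 1\<^sub>m m)"
    using assms by (intro mult_minus_distrib_mat) auto
  moreover have "(c \<cdot>\<^sub>m 1\<^sub>m m) * E = c \<cdot>\<^sub>m E" "E * (c \<cdot>\<^sub>m 1\<^sub>m m) = c \<cdot>\<^sub>m E"
    using assms mult_smult_assoc_mat[of "1\<^sub>m m" m m E m c] mult_smult_distrib[of E m m "1\<^sub>m m" m c]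
    by auto
  ultimately show ?thesis using assms(3) by simp
qed

context delay_family
begin

section \<open>Equations for single blocks and their transformations\<close>

definition block_ode :: "nat \<Rightarrow> complex mat \<Rightarrow> complex mat \<Rightarrow> complex mat \<Rightarrow> ('a \<Rightarrow> real \<Rightarrow> complex vec) \<Rightarrow> bool" where
  "block_ode m E A B Y \<longleftrightarrow> vec_family m Y \<and> (\<forall>a\<in>S. \<forall>t\<in>offgrid. \<forall>i<m.
     ((\<lambda>s. (E *\<^sub>v Y a s) $ i) has_vector_derivative (A *\<^sub>v Y a t + B *\<^sub>v Y a (t - \<tau>)) $ i) (at t))"

lemma block_odeD:
  assumes "block_ode m E A B Y"
  shows "vec_family m Y"
    "a \<in> S \<Longrightarrow> t \<in> offgrid \<Longrightarrow> i < m \<Longrightarrow>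
     ((\<lambda>s. (E *\<^sub>v Y a s) $ i) has_vector_derivative (A *\<^sub>v Y a t + B *\<^sub>v Y a (t - \<tau>)) $ i) (at t)"
  using assms by (auto simp: block_ode_def)

lemma offgrid_gt: "t \<in> offgrid \<Longrightarrow> -\<tau> < t" "t \<in> offgrid \<Longrightarrow> -\<tau> < t - \<tau>" "t \<in> domn \<Longrightarrow> -\<tau> < t"
  using tau delay_domain_gt[OF tau] by (auto simp: off_grid_def)

lemma domn_subset: "domn \<subseteq> {-\<tau><..}" "ini \<subseteq> {-\<tau><..}" "offgrid \<subseteq> {-\<tau><..}"
  using offgrid_gt by auto

lemma offgrid_domn: "t \<in> offgrid \<Longrightarrow> t \<in> domn" "t \<in> offgrid \<Longrightarrow> t - \<tau> \<in> domn"
  using off_grid_minus[OF tau] by (auto simp: delay_domain_def)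

text \<open>Apply \<open>W\<close> to the equation. With \<open>W\<close> the rows of one block this
  isolates the block; with \<open>W\<close> a square matrix commuting with all coefficients it turns
  solutions into solutions, which feeds the inductions below.\<close>

lemma block_ode_intertwine:
  assumes ode: "block_ode n E A B X" and W: "W \<in> carrier_mat m n"
    and carr: "E \<in> carrier_mat n n" "A \<in> carrier_mat n n" "B \<in> carrier_mat n n"
    and carr': "E' \<in> carrier_mat m m" "A' \<in> carrier_mat m m" "B' \<in> carrier_mat m m"
    and eq: "W * E = E' * W" "W * A = A' * W" "W * B = B' * W"
  shows "block_ode m E' A' B' (\<lambda>a t. W *\<^sub>v X a t)"
  unfolding block_ode_def
proof (intro conjI ballI allI impI)
  show "vec_family m (\<lambda>a t. W *\<^sub>v X a t)" using block_odeD(1)[OF ode] W by (rule vec_family_mult)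
  have X: "X a s \<in> carrier_vec n" if "a \<in> S" "-\<tau> < s" for a s
    using block_odeD(1)[OF ode] that by (auto simp: vec_family_def)
  have swap: "M' *\<^sub>v (W *\<^sub>v v) = W *\<^sub>v (M *\<^sub>v v)"
    if "M \<in> carrier_mat n n" "M' \<in> carrier_mat m m" "W * M = M' * W" "v \<in> carrier_vec n" for M M' v
    using assoc_mult_mat_vec[of M' m m W n v] assoc_mult_mat_vec[of W m n M n v] that W by simp
  fix a t i assume a: "a \<in> S" and t: "t \<in> offgrid" and i: "i < m"
  have X': "X a t \<in> carrier_vec n" "X a (t - \<tau>) \<in> carrier_vec n"
    using X[OF a] offgrid_gt t by auto
  let ?d = "A *\<^sub>v X a t + B *\<^sub>v X a (t - \<tau>)"
  have d: "?d \<in> carrier_vec n" using carr X' by auto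
  have "((\<lambda>s. (W *\<^sub>v (E *\<^sub>v X a s)) $ i) has_vector_derivative (W *\<^sub>v ?d) $ i) (at t)"
    by (rule mult_mat_vec_deriv[OF W _ d _ i])
      (use carr block_odeD(2)[OF ode a t] in \<open>auto simp: carrier_vecI\<close>)
  moreover have "W *\<^sub>v ?d = A' *\<^sub>v (W *\<^sub>v X a t) + B' *\<^sub>v (W *\<^sub>v X a (t - \<tau>))"
    using W carr X' swap[OF carr(2) carr'(2) eq(2)] swap[OF carr(3) carr'(3) eq(3)]
    by (simp add: mult_add_distrib_mat_vec[of W m n])
  ultimately have "((\<lambda>s. (W *\<^sub>v (E *\<^sub>v X a s)) $ i) has_vector_derivative
      (A' *\<^sub>v (W *\<^sub>v X a t) + B' *\<^sub>v (W *\<^sub>v X a (t - \<tau>))) $ i) (at t)" by simp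
  thus "((\<lambda>s. (E' *\<^sub>v (W *\<^sub>v X a s)) $ i) has_vector_derivative
      (A' *\<^sub>v (W *\<^sub>v X a t) + B' *\<^sub>v (W *\<^sub>v X a (t - \<tau>))) $ i) (at t)"
    by (rule has_vector_derivative_transform_within_open[where S = "{-\<tau><..}"])
      (use offgrid_gt(1)[OF t] swap[OF carr(1) carr'(1) eq(1) X[OF a]] in auto)
qed

text \<open>With \<open>M\<close> the inverse of one of the coefficients, this normalises that
  coefficient to the identity.\<close>

lemma block_ode_mult:
  assumes ode: "block_ode m E A B Y" and M: "M \<in> carrier_mat m m"
    and carr: "E \<in> carrier_mat m m" "A \<in> carrier_mat m m" "B \<in> carrier_mat m m"
  shows "block_ode m (M * E) (M * A) (M * B) Y"
  unfolding block_ode_def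
proof (intro conjI ballI allI impI)
  show fam: "vec_family m Y" by (rule block_odeD(1)[OF ode])
  fix a t i assume a: "a \<in> S" and t: "t \<in> offgrid" and i: "i < m"
  have Y: "Y a s \<in> carrier_vec m" if "-\<tau> < s" for s
    using fam a that by (auto simp: vec_family_def)
  have Y': "Y a t \<in> carrier_vec m" "Y a (t - \<tau>) \<in> carrier_vec m" using Y offgrid_gt t by auto
  let ?d = "A *\<^sub>v Y a t + B *\<^sub>v Y a (t - \<tau>)"
  have d: "?d \<in> carrier_vec m" using carr Y' by auto
  have "((\<lambda>s. (M *\<^sub>v (E *\<^sub>v Y a s)) $ i) has_vector_derivative (M *\<^sub>v ?d) $ i) (at t)"
    by (rule mult_mat_vec_deriv[OF M _ d _ i])
      (use carr block_odeD(2)[OF ode a t] in \<open>auto simp: carrier_vecI\<close>)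
  moreover have "M *\<^sub>v ?d = (M * A) *\<^sub>v Y a t + (M * B) *\<^sub>v Y a (t - \<tau>)"
    using M carr Y' by (simp add: mult_add_distrib_mat_vec[of M m m] assoc_mult_mat_vec[of M m m _ m])
  ultimately have "((\<lambda>s. (M *\<^sub>v (E *\<^sub>v Y a s)) $ i) has_vector_derivative
      ((M * A) *\<^sub>v Y a t + (M * B) *\<^sub>v Y a (t - \<tau>)) $ i) (at t)" by simp
  thus "((\<lambda>s. (M * E *\<^sub>v Y a s) $ i) has_vector_derivative
      ((M * A) *\<^sub>v Y a t + (M * B) *\<^sub>v Y a (t - \<tau>)) $ i) (at t)"
    by (rule has_vector_derivative_transform_within_open[where S = "{-\<tau><..}"])
      (use offgrid_gt(1)[OF t] M carr Y assoc_mult_mat_vec[of M m m E m] in auto)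
qed

lemma block_ode_cong:
  assumes ode: "block_ode m E A B Y" and eq: "\<And>a t. a \<in> S \<Longrightarrow> -\<tau> < t \<Longrightarrow> Y a t = Z a t"
  shows "block_ode m E A B Z"
  unfolding block_ode_def
proof (intro conjI ballI allI impI)
  show "vec_family m Z" using block_odeD(1)[OF ode] eq by (auto simp: vec_family_def)
  fix a t i assume a: "a \<in> S" and t: "t \<in> offgrid" and i: "i < m"
  have "((\<lambda>s. (E *\<^sub>v Y a s) $ i) has_vector_derivative (A *\<^sub>v Z a t + B *\<^sub>v Z a (t - \<tau>)) $ i) (at t)"
    using block_odeD(2)[OF ode a t i] eq[OF a] offgrid_gt t by simp
  thus "((\<lambda>s. (E *\<^sub>v Z a s) $ i) has_vector_derivative (A *\<^sub>v Z a t + B *\<^sub>v Z a (t - \<tau>)) $ i) (at t)"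
    by (rule has_vector_derivative_transform_within_open[where S = "{-\<tau><..}"])
      (use offgrid_gt(1)[OF t] eq[OF a] in auto)
qed

lemma block_ode_shift_mult:
  assumes ode: "block_ode m E A B Y" and M: "M \<in> carrier_mat m m"
    and carr: "E \<in> carrier_mat m m" "A \<in> carrier_mat m m" "B \<in> carrier_mat m m"
    and comm: "M * E = E * M" "M * A = A * M" "M * B = B * M"
  shows "block_ode m E A B (\<lambda>a t. shift_mult M c (Y a t))"
proof (rule block_ode_cong)
  show "block_ode m E A B (\<lambda>a t. (M - c \<cdot>\<^sub>m 1\<^sub>m m) *\<^sub>v Y a t)"
    by (rule block_ode_intertwine[OF ode _ carr carr])
      (use M shift_mat_commute[OF M carr(1) comm(1)] shift_mat_commute[OF M carr(2) comm(2)]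
        shift_mat_commute[OF M carr(3) comm(3)] in auto)
  fix a t assume "a \<in> S" "-\<tau> < t"
  thus "(M - c \<cdot>\<^sub>m 1\<^sub>m m) *\<^sub>v Y a t = shift_mult M c (Y a t)"
    using block_odeD(1)[OF ode] by (auto simp: vec_family_def intro!: shift_mult_eq_mat[OF M, symmetric])
qed

section \<open>The block with invertible delay coefficient\<close>

lemma vec_smooth_decay_vanishing:
  assumes "open T" "\<And>a t. a \<in> S \<Longrightarrow> t \<in> T \<Longrightarrow> Y a t = 0\<^sub>v m"
  shows "vec_smooth_decay T p m Y"
  unfolding vec_smooth_decay_def
  by (intro allI impI smooth_decay_cong[OF assms(1) _ smooth_decay_zero]) (use assms(2) in simp)

text \<open>Induction on the sum of two exponents attached to \<open>Y\<close>. \<open>P\<close>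
  times \<open>Y\<close> and \<open>Q\<close> times \<open>Y\<close> solve the same equation with
  one exponent lowered, so they vanish, and the equation leaves \<open>Y\<close> as the derivative
  of zero.\<close>

lemma advanced_block_vanishes:
  assumes P: "P \<in> carrier_mat m m" and Q: "Q \<in> carrier_mat m m" and PQ: "P * Q = Q * P"
    and "block_ode m P Q (1\<^sub>m m) Y"
    and "\<And>a t. a \<in> S \<Longrightarrow> t \<in> domn \<Longrightarrow> (((*\<^sub>v) P) ^^ k) (Y a t) = 0\<^sub>v m"
    and "\<And>a t. a \<in> S \<Longrightarrow> t \<in> domn \<Longrightarrow> (((*\<^sub>v) Q) ^^ l) (Y a t) = 0\<^sub>v m"
    and "a \<in> S" "t \<in> domn"
  shows "Y a t = 0\<^sub>v m"
  using assms(4-)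
proof (induction "k + l" arbitrary: k l Y a t rule: less_induct)
  case less
  show ?case
  proof (cases "k = 0 \<or> l = 0")
    case True
    thus ?thesis using less.prems by auto
  next
    case False
    then obtain k' l' where kl: "k = Suc k'" "l = Suc l'" by (metis not0_implies_Suc)
    have Y: "Y a t \<in> carrier_vec m" if "a \<in> S" "-\<tau> < t" for a t
      using block_odeD(1)[OF less.prems(1)] that by (auto simp: vec_family_def)
    have one: "1\<^sub>m m \<in> carrier_mat m m" by simp
    have PY: "P *\<^sub>v Y a t = 0\<^sub>v m" if at: "a \<in> S" "t \<in> domn" for a t
    proof (rule less.hyps[of k' l "\<lambda>a t. P *\<^sub>v Y a t"])
      show "k' + l < k + l" using kl by simp
      show "block_ode m P Q (1\<^sub>m m) (\<lambda>a t. P *\<^sub>v Y a t)"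
        by (rule block_ode_intertwine[OF less.prems(1) P P Q one P Q one]) (use P PQ in auto)
      fix a t assume at: "a \<in> S" "t \<in> domn"
      show "(((*\<^sub>v) P) ^^ k') (P *\<^sub>v Y a t) = 0\<^sub>v m"
        using less.prems(2)[OF at] kl by (simp add: funpow_swap1)
      show "(((*\<^sub>v) Q) ^^ l) (P *\<^sub>v Y a t) = 0\<^sub>v m"
        using less.prems(3)[OF at] funpow_mult_mat_vec_commute[OF P Q Y PQ] P at offgrid_gt by simp
    qed (use at in auto)
    have QY: "Q *\<^sub>v Y a t = 0\<^sub>v m" if at: "a \<in> S" "t \<in> domn" for a t
    proof (rule less.hyps[of k l' "\<lambda>a t. Q *\<^sub>v Y a t"])
      show "k + l' < k + l" using kl by simp
      show "block_ode m P Q (1\<^sub>m m) (\<lambda>a t. Q *\<^sub>v Y a t)"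
        by (rule block_ode_intertwine[OF less.prems(1) Q P Q one P Q one]) (use Q PQ in auto)
      fix a t assume at: "a \<in> S" "t \<in> domn"
      show "(((*\<^sub>v) Q) ^^ l') (Q *\<^sub>v Y a t) = 0\<^sub>v m"
        using less.prems(3)[OF at] kl by (simp add: funpow_swap1)
      show "(((*\<^sub>v) P) ^^ k) (Q *\<^sub>v Y a t) = 0\<^sub>v m"
        using less.prems(2)[OF at] funpow_mult_mat_vec_commute[OF Q P Y PQ[symmetric]] Q at offgrid_gt
        by simp
    qed (use at in auto)
    note a = less.prems(4)
    \<comment> \<open>The equation is read one delay later, where its delayed argument is
      \<open>t\<close>; so it determines \<open>Y\<close> on the initial interval as well.\<close>
    have t: "t + \<tau> \<in> offgrid"
    proof (cases "t < 0")
      case True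
      thus ?thesis using between_multiples_off_grid[of \<tau> "t + \<tau>" 0] tau delay_domain_gt[OF tau less.prems(5)]
        by simp
    next
      case False
      hence "t > 0" "\<And>j::nat. t \<noteq> real j * \<tau>" using less.prems(5)
        by (auto simp: delay_domain_def off_grid_def)
      moreover have "t + \<tau> \<noteq> real j * \<tau>" for j :: nat
        using \<open>t > 0\<close> \<open>\<And>j::nat. t \<noteq> real j * \<tau>\<close>[of "j - 1"] tau
        by (cases j) (auto simp: algebra_simps)
      ultimately show ?thesis using tau by (auto simp: off_grid_def)
    qed
    show ?thesis
    proof (rule eq_vecI)
      fix i assume "i < dim_vec (0\<^sub>v m :: complex vec)"
      hence i: "i < m" by simp
      have "((\<lambda>s. (P *\<^sub>v Y a s) $ i) has_vector_derivative 0) (at (t + \<tau>))"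
      proof (rule has_vector_derivative_transform_within_open[OF _ open_delay_domain[OF tau] offgrid_domn(1)[OF t]])
        show "((\<lambda>s. 0) has_vector_derivative 0) (at (t + \<tau>))" by simp
        show "0 = (P *\<^sub>v Y a s) $ i" if "s \<in> domn" for s using PY[OF a that] i by simp
      qed
      moreover have "((\<lambda>s. (P *\<^sub>v Y a s) $ i) has_vector_derivative (Y a t) $ i) (at (t + \<tau>))"
        using block_odeD(2)[OF less.prems(1) a t i] QY[OF a offgrid_domn(1)[OF t]] i
          Y[OF a] less.prems(5) offgrid_gt by simp
      ultimately show "Y a t $ i = 0\<^sub>v m $ i"
        using i vector_derivative_unique_at by fastforce
    qed (use Y[OF a] less.prems(5) offgrid_gt in auto)
  qed
qed

section \<open>The block with nilpotent leading coefficient and invertible \<open>A\<close>\<close>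

text \<open>Splitting off a root \<open>c\<close> leaves the difference equation
  \<open>Y t = - c Y (t - \<tau>) + (R Y)' t - Z (t - \<tau>)\<close>, where
  \<open>Z = (D - c) Y\<close> has the shorter list. The derivative is left to the hypothesis
  \<open>deriv\<close>; \<open>ds\<close> stays whole while \<open>cs\<close> shrinks, so that
  \<open>deriv\<close> remains applicable to \<open>Z\<close>.\<close>

lemma nilpotent_block_decay_aux:
  assumes R: "R \<in> carrier_mat m m" and D: "D \<in> carrier_mat m m" and RD: "R * D = D * R"
    and cs: "\<And>c. c \<in> set cs \<Longrightarrow> cmod c < 1"
    and deriv: "\<And>Y i. block_ode m R (1\<^sub>m m) D Y \<Longrightarrow>
      (\<And>a t. a \<in> S \<Longrightarrow> t \<in> domn \<Longrightarrow> (((*\<^sub>v) R) ^^ Suc k) (Y a t) = 0\<^sub>v m) \<Longrightarrow>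
      (\<And>a t. a \<in> S \<Longrightarrow> t \<in> domn \<Longrightarrow> fold (shift_mult D) ds (Y a t) = 0\<^sub>v m) \<Longrightarrow>
      vec_smooth_decay ini (p + k) m Y \<Longrightarrow> i < m \<Longrightarrow>
      \<exists>h. smooth_decay offgrid p h \<and>
        (\<forall>a\<in>S. \<forall>t\<in>offgrid. ((\<lambda>s. (R *\<^sub>v Y a s) $ i) has_vector_derivative h a t) (at t))"
  shows "block_ode m R (1\<^sub>m m) D Y \<Longrightarrow>
      (\<And>a t. a \<in> S \<Longrightarrow> t \<in> domn \<Longrightarrow> (((*\<^sub>v) R) ^^ Suc k) (Y a t) = 0\<^sub>v m) \<Longrightarrow>
      (\<And>a t. a \<in> S \<Longrightarrow> t \<in> domn \<Longrightarrow> fold (shift_mult D) ds (Y a t) = 0\<^sub>v m) \<Longrightarrow>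
      (\<And>a t. a \<in> S \<Longrightarrow> t \<in> domn \<Longrightarrow> fold (shift_mult D) cs (Y a t) = 0\<^sub>v m) \<Longrightarrow>
      vec_smooth_decay ini (p + k) m Y \<Longrightarrow> vec_smooth_decay domn p m Y"
  using cs
proof (induction cs arbitrary: Y)
  case Nil
  thus ?case using open_delay_domain[OF tau] by (intro vec_smooth_decay_vanishing) auto
next
  case (Cons c cs)
  have one: "1\<^sub>m m \<in> carrier_mat m m" by simp
  have fam: "vec_family m Y" by (rule block_odeD(1)[OF Cons.prems(1)])
  have Y: "Y a t \<in> carrier_vec m" if "a \<in> S" "-\<tau> < t" for a t
    using fam that by (auto simp: vec_family_def)
  define Z where "Z = (\<lambda>a t. shift_mult D c (Y a t))"
  have Z: "vec_smooth_decay domn p m Z"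
    unfolding Z_def
  proof (rule Cons.IH)
    show "block_ode m R (1\<^sub>m m) D (\<lambda>a t. shift_mult D c (Y a t))"
      by (rule block_ode_shift_mult[OF Cons.prems(1) D R one D]) (use RD D in auto)
    show "vec_smooth_decay ini (p + k) m (\<lambda>a t. shift_mult D c (Y a t))"
      by (rule vec_smooth_decay_shift_mult[OF _ domn_subset(2) fam D Cons.prems(5)]) auto
    fix a t assume at: "a \<in> S" "t \<in> domn"
    note Yat = Y[OF at(1) offgrid_gt(3)[OF at(2)]]
    show "fold (shift_mult D) cs (shift_mult D c (Y a t)) = 0\<^sub>v m"
      using Cons.prems(4)[OF at] by simp
    have "shift_mult D c (fold (shift_mult D) ds (Y a t)) = fold (shift_mult D) ds (shift_mult D c (Y a t))"
      by (rule shift_mult_fold_shift_mult[OF D D Yat]) simp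
    thus "fold (shift_mult D) ds (shift_mult D c (Y a t)) = 0\<^sub>v m"
      using Cons.prems(3)[OF at] fold_shift_mult_zero[OF D, of "[c]"] by simp
    have "shift_mult D c ((((*\<^sub>v) R) ^^ j) (Y a t)) = (((*\<^sub>v) R) ^^ j) (shift_mult D c (Y a t))" for j
    proof (induction j)
      case (Suc j)
      have "shift_mult D c (R *\<^sub>v (((*\<^sub>v) R) ^^ j) (Y a t)) = R *\<^sub>v shift_mult D c ((((*\<^sub>v) R) ^^ j) (Y a t))"
        using mult_mat_vec_shift_mult[OF R D funpow_mult_mat_vec_carrier[OF R Yat] RD] by simp
      thus ?case using Suc by simp
    qed simp
    from this[of "Suc k"] show "(((*\<^sub>v) R) ^^ Suc k) (shift_mult D c (Y a t)) = 0\<^sub>v m"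
      using Cons.prems(2)[OF at] fold_shift_mult_zero[OF D, of "[c]"] by simp
  qed (use Cons.prems in auto)
  show ?case
    unfolding vec_smooth_decay_def
  proof (intro allI impI)
    fix i assume i: "i < m"
    obtain h where h: "smooth_decay offgrid p h"
      "\<And>a t. a \<in> S \<Longrightarrow> t \<in> offgrid \<Longrightarrow> ((\<lambda>s. (R *\<^sub>v Y a s) $ i) has_vector_derivative h a t) (at t)"
      using deriv[OF Cons.prems(1-3,5) i] by blast
    show "smooth_decay domn p (\<lambda>a t. Y a t $ i)"
    proof (rule smooth_decay_difference_equation[of "- c"])
      show "cmod (- c) < 1" using Cons.prems(6)[of c] by simp
      show "smooth_decay ini p (\<lambda>a t. Y a t $ i)"
        using Cons.prems(5) i le_add1[of p k] smooth_decay_le unfolding vec_smooth_decay_def by blast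
      show "smooth_decay offgrid p (\<lambda>a t. h a t + (- 1) * Z a (t - \<tau>) $ i)"
        by (intro smooth_decay_add smooth_decay_cmult h(1) smooth_decay_delay[of p "\<lambda>a t. Z a t $ i"])
          (use Z i in \<open>auto simp: vec_smooth_decay_def\<close>)
      fix a t assume at: "a \<in> S" "t \<in> offgrid"
      have Yc: "Y a t \<in> carrier_vec m" "Y a (t - \<tau>) \<in> carrier_vec m"
        using Y at offgrid_gt by auto
      have "h a t = (1\<^sub>m m *\<^sub>v Y a t + D *\<^sub>v Y a (t - \<tau>)) $ i"
        by (rule vector_derivative_unique_at[OF h(2)[OF at] block_odeD(2)[OF Cons.prems(1) at i]])
      hence "h a t = Y a t $ i + (D *\<^sub>v Y a (t - \<tau>)) $ i"
        using Yc D i by simp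
      moreover have "Z a (t - \<tau>) $ i = (D *\<^sub>v Y a (t - \<tau>)) $ i - c * Y a (t - \<tau>) $ i"
        using Yc D i by (simp add: Z_def shift_mult_def)
      ultimately show "Y a t $ i = - c * Y a (t - \<tau>) $ i + (h a t + (- 1) * Z a (t - \<tau>) $ i)"
        by simp
    qed
  qed
qed

text \<open>\<open>R\<close> times \<open>Y\<close> is killed by one power of \<open>R\<close> less,
  so by induction it has \<open>p + 1\<close> decaying derivatives on the domain; its derivative has
  \<open>p\<close>, as the difference equation requires. The sum \<open>p + k\<close> is constant
  along the induction and is the regularity asked of the initial function.\<close>

lemma nilpotent_block_decay:
  assumes R: "R \<in> carrier_mat m m" and D: "D \<in> carrier_mat m m" and RD: "R * D = D * R"
    and cs: "\<And>c. c \<in> set cs \<Longrightarrow> cmod c < 1"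
  shows "block_ode m R (1\<^sub>m m) D Y \<Longrightarrow>
      (\<And>a t. a \<in> S \<Longrightarrow> t \<in> domn \<Longrightarrow> (((*\<^sub>v) R) ^^ Suc k) (Y a t) = 0\<^sub>v m) \<Longrightarrow>
      (\<And>a t. a \<in> S \<Longrightarrow> t \<in> domn \<Longrightarrow> fold (shift_mult D) cs (Y a t) = 0\<^sub>v m) \<Longrightarrow>
      vec_smooth_decay ini (p + k) m Y \<Longrightarrow> vec_smooth_decay domn p m Y"
proof (induction k arbitrary: p Y)
  case 0
  show ?case
  proof (rule nilpotent_block_decay_aux[OF R D RD cs _ 0(1-3) 0(3,4)], assumption)
    fix Y i
    assume nil: "\<And>a t. a \<in> S \<Longrightarrow> t \<in> domn \<Longrightarrow> (((*\<^sub>v) R) ^^ Suc 0) (Y a t) = 0\<^sub>v m" and i: "i < m"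
    have "((\<lambda>s. (R *\<^sub>v Y a s) $ i) has_vector_derivative 0) (at t)" if "a \<in> S" "t \<in> offgrid" for a t
    proof (rule has_vector_derivative_transform_within_open[OF _ open_delay_domain[OF tau] offgrid_domn(1)[OF that(2)]])
      show "((\<lambda>s. 0) has_vector_derivative 0) (at t)" by simp
      show "0 = (R *\<^sub>v Y a s) $ i" if "s \<in> domn" for s using nil[OF \<open>a \<in> S\<close> that] i by simp
    qed
    thus "\<exists>h. smooth_decay offgrid p h \<and>
        (\<forall>a\<in>S. \<forall>t\<in>offgrid. ((\<lambda>s. (R *\<^sub>v Y a s) $ i) has_vector_derivative h a t) (at t))"
      using smooth_decay_zero by (intro exI[of _ "\<lambda>a t. 0"]) auto
  qed
next
  case (Suc k)
  have one: "1\<^sub>m m \<in> carrier_mat m m" by simp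
  show ?case
  proof (rule nilpotent_block_decay_aux[OF R D RD cs _ Suc.prems(1-3) Suc.prems(3,4)], assumption)
    fix Y i
    assume ode: "block_ode m R (1\<^sub>m m) D Y"
      and nil: "\<And>a t. a \<in> S \<Longrightarrow> t \<in> domn \<Longrightarrow> (((*\<^sub>v) R) ^^ Suc (Suc k)) (Y a t) = 0\<^sub>v m"
      and ann: "\<And>a t. a \<in> S \<Longrightarrow> t \<in> domn \<Longrightarrow> fold (shift_mult D) cs (Y a t) = 0\<^sub>v m"
      and smooth: "vec_smooth_decay ini (p + Suc k) m Y" and i: "i < m"
    have "vec_smooth_decay domn (Suc p) m (\<lambda>a t. R *\<^sub>v Y a t)"
    proof (rule Suc.IH)
      show "block_ode m R (1\<^sub>m m) D (\<lambda>a t. R *\<^sub>v Y a t)"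
        by (rule block_ode_intertwine[OF ode R R one D R one D]) (use R RD in auto)
      show "vec_smooth_decay ini (Suc p + k) m (\<lambda>a t. R *\<^sub>v Y a t)"
        using vec_smooth_decay_mult[OF _ domn_subset(2) block_odeD(1)[OF ode] R smooth] by simp
      fix a t assume at: "a \<in> S" "t \<in> domn"
      hence Y: "Y a t \<in> carrier_vec m" using block_odeD(1)[OF ode] offgrid_gt by (auto simp: vec_family_def)
      show "(((*\<^sub>v) R) ^^ Suc k) (R *\<^sub>v Y a t) = 0\<^sub>v m"
        using nil[OF at] by (simp only: funpow_Suc_right o_def)
      show "fold (shift_mult D) cs (R *\<^sub>v Y a t) = 0\<^sub>v m"
        using mult_mat_vec_fold_shift_mult[OF R D Y RD, of cs] ann[OF at] R by simp
    qed
    hence "smooth_decay domn (Suc p) (\<lambda>a t. (R *\<^sub>v Y a t) $ i)"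
      using i by (auto simp: vec_smooth_decay_def)
    then obtain h where "\<forall>a\<in>S. \<forall>t\<in>domn. ((\<lambda>s. (R *\<^sub>v Y a s) $ i) has_vector_derivative h a t) (at t)"
      "smooth_decay domn p h" by auto
    thus "\<exists>h. smooth_decay offgrid p h \<and>
        (\<forall>a\<in>S. \<forall>t\<in>offgrid. ((\<lambda>s. (R *\<^sub>v Y a s) $ i) has_vector_derivative h a t) (at t))"
      using offgrid_domn(1) smooth_decay_subset[of domn p h offgrid] by (intro exI[of _ h]) auto
  qed
qed

section \<open>The block with invertible leading coefficient\<close>

lemma retarded_scalar_decay:
  assumes roots: "\<And>l::complex. l = a + b * exp (- l * \<tau>) \<Longrightarrow> Re l < 0"
    and cont: "\<And>s. s \<in> S \<Longrightarrow> continuous_on {-\<tau>..} (y s)"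
    and ini: "decays ini y" and g: "decays offgrid g"
    and deriv: "\<And>s t. s \<in> S \<Longrightarrow> t \<in> offgrid \<Longrightarrow>
      (y s has_vector_derivative a * y s t + b * y s (t - \<tau>) + g s t) (at t)"
  shows "decays domn y"
proof -
  obtain C1 where 1: "C1 \<ge> 0"
    "\<And>s t. s \<in> S \<Longrightarrow> t \<in> ini \<Longrightarrow> -\<tau> < t \<Longrightarrow> cmod (y s t) \<le> C1 * K s"
  proof -
    obtain C \<gamma> where "C \<ge> 0" "\<gamma> > 0"
      "\<And>a t \<gamma>'. a \<in> S \<Longrightarrow> t \<in> ini \<Longrightarrow> -\<tau> < t \<Longrightarrow> 0 \<le> \<gamma>' \<Longrightarrow> \<gamma>' \<le> \<gamma> \<Longrightarrow>
        cmod (y a t) \<le> C * K a * exp (- \<gamma>' * t)" using decays_slower[OF ini] by blast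
    from this(1) this(3)[where \<gamma>' = 0] this(2) show thesis by (intro that) auto
  qed
  obtain C2 \<gamma> where 2: "C2 \<ge> 0" "\<gamma> > 0"
    "\<And>s t. s \<in> S \<Longrightarrow> t \<in> offgrid \<Longrightarrow> -\<tau> < t \<Longrightarrow> cmod (g s t) \<le> C2 * K s * exp (- \<gamma> * t)"
    using g unfolding decays_def by blast
  obtain C \<gamma>' where C: "C \<ge> 0" "\<gamma>' > 0"
    "\<And>y g K t. K \<ge> 0 \<Longrightarrow> continuous_on {-\<tau>..} y \<Longrightarrow> (\<And>t. -\<tau> < t \<Longrightarrow> t < 0 \<Longrightarrow> cmod (y t) \<le> K) \<Longrightarrow>
      (\<And>t. t \<in> off_grid \<tau> \<Longrightarrow> (y has_vector_derivative a * y t + b * y (t - \<tau>) + g t) (at t)) \<Longrightarrow>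
      (\<And>t. t \<in> off_grid \<tau> \<Longrightarrow> cmod (g t) \<le> K * exp (- \<gamma> * t)) \<Longrightarrow> t \<ge> 0 \<Longrightarrow>
      cmod (y t) \<le> C * K * exp (- \<gamma>' * t)"
    by (rule scalar_delay_decay[OF tau 2(2) roots]) (assumption, blast)
  have offgrid: "decays offgrid y"
  proof (rule decaysI[of "C * (C1 + C2)" \<gamma>'])
    fix s t assume st: "s \<in> S" "t \<in> offgrid"
    note K = K_nonneg[OF st(1)]
    have "cmod (y s t) \<le> C * ((C1 + C2) * K s) * exp (- \<gamma>' * t)"
    proof (rule C(3)[of _ "y s" "g s"])
      show "t \<ge> 0" using st(2) by (simp add: off_grid_def)
      show "0 \<le> (C1 + C2) * K s" using 1 2 K by simp
      show "continuous_on {-\<tau>..} (y s)" using cont st(1) by simp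
      fix t
      show "(y s has_vector_derivative a * y s t + b * y s (t - \<tau>) + g s t) (at t)"
        if "t \<in> offgrid" using deriv[OF st(1) that] .
      show "cmod (y s t) \<le> (C1 + C2) * K s" if "-\<tau> < t" "t < 0"
      proof -
        have "cmod (y s t) \<le> C1 * K s" using 1(2)[OF st(1)] that by simp
        also have "\<dots> \<le> (C1 + C2) * K s" using 2 K by (intro mult_right_mono) auto
        finally show ?thesis .
      qed
      show "cmod (g s t) \<le> (C1 + C2) * K s * exp (- \<gamma> * t)" if "t \<in> offgrid"
      proof -
        have "cmod (g s t) \<le> C2 * K s * exp (- \<gamma> * t)" using 2(3)[OF st(1) that] offgrid_gt that by simp
        also have "\<dots> \<le> (C1 + C2) * K s * exp (- \<gamma> * t)"
          using 1 K by (intro mult_right_mono) auto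
        finally show ?thesis .
      qed
    qed
    thus "cmod (y s t) \<le> C * (C1 + C2) * K s * exp (- \<gamma>' * t)" by (simp add: mult.assoc)
  qed (use C 1 2 in auto)
  show ?thesis unfolding delay_domain_def by (rule decays_Un[OF ini offgrid])
qed

text \<open>Nested induction on the two lists. \<open>(A - a) Y\<close> and \<open>(B - b) Y\<close>
  are solutions with one list shortened, hence decay; they make up the forcing in a scalar equation
  for each component of \<open>Y\<close>. The condition at \<open>- \<tau>\<close>, a point outside
  the scope of \<open>vec_family\<close>, makes the transformed functions continuous on the closed
  half-line.\<close>

lemma retarded_block_decay:
  assumes A: "A \<in> carrier_mat m m" and B: "B \<in> carrier_mat m m" and AB: "A * B = B * A"
    and reg: "\<And>l v. Re l \<ge> 0 \<Longrightarrow> v \<in> carrier_vec m \<Longrightarrow>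
      l \<cdot>\<^sub>v v = A *\<^sub>v v + exp (- l * \<tau>) \<cdot>\<^sub>v (B *\<^sub>v v) \<Longrightarrow> v = 0\<^sub>v m"
  shows "block_ode m (1\<^sub>m m) A B Y \<Longrightarrow>
      (\<And>s i. s \<in> S \<Longrightarrow> i < m \<Longrightarrow> continuous_on {-\<tau>..} (\<lambda>t. Y s t $ i)) \<Longrightarrow>
      (\<And>s. s \<in> S \<Longrightarrow> Y s (-\<tau>) \<in> carrier_vec m) \<Longrightarrow>
      vec_smooth_decay ini 0 m Y \<Longrightarrow>
      (\<And>s t. s \<in> S \<Longrightarrow> t \<in> domn \<Longrightarrow> fold (shift_mult A) as (Y s t) = 0\<^sub>v m) \<Longrightarrow>
      (\<And>s t. s \<in> S \<Longrightarrow> t \<in> domn \<Longrightarrow> fold (shift_mult B) bs (Y s t) = 0\<^sub>v m) \<Longrightarrow>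
      vec_smooth_decay domn 0 m Y"
proof (induction as arbitrary: bs Y)
  case Nil
  thus ?case using open_delay_domain[OF tau] by (intro vec_smooth_decay_vanishing) auto
next
  case (Cons a as)
  note outer = Cons.IH
  from Cons.prems show ?case
  proof (induction bs arbitrary: Y)
    case Nil
    thus ?case using open_delay_domain[OF tau] by (intro vec_smooth_decay_vanishing) auto
  next
    case (Cons b bs)
    note ode = Cons.prems(1)
    have one: "1\<^sub>m m \<in> carrier_mat m m" by simp
    have fam: "vec_family m Y" by (rule block_odeD(1)[OF ode])
    have Y: "Y s t \<in> carrier_vec m" if "s \<in> S" "-\<tau> < t" for s t
      using fam that by (auto simp: vec_family_def)
    have Y': "Y s t \<in> carrier_vec m" if "s \<in> S" "-\<tau> \<le> t" for s t
      using Y[OF that(1)] Cons.prems(3)[OF that(1)] that(2) by (cases "t = -\<tau>") auto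
    have cont_shift: "continuous_on {-\<tau>..} (\<lambda>t. shift_mult M c (Y s t) $ i)"
      if M: "M \<in> carrier_mat m m" and s: "s \<in> S" and i: "i < m" for M c s i
    proof (rule continuous_on_eq)
      show "continuous_on {-\<tau>..} (\<lambda>t. (\<Sum>j<m. M $$ (i, j) * Y s t $ j) - c * Y s t $ i)"
        using Cons.prems(2)[OF s] i by (intro continuous_intros) auto
      fix t assume "t \<in> {-\<tau>..}"
      hence c: "Y s t \<in> carrier_vec m" using Y'[OF s] by simp
      show "(\<Sum>j<m. M $$ (i, j) * Y s t $ j) - c * Y s t $ i = shift_mult M c (Y s t) $ i"
        unfolding mult_mat_vec_entry[OF M c i, symmetric]
        using c i M by (simp add: shift_mult_def)
    qed
    \<comment> \<open>Here the list for \<open>A\<close> gets shorter while the list for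
      \<open>B\<close> stays whole; the outer hypothesis admits this because it is general in
      \<open>bs\<close>.\<close>
    have Z1: "vec_smooth_decay domn 0 m (\<lambda>s t. shift_mult A a (Y s t))"
    proof (rule outer[where bs = "b # bs"])
      show "block_ode m (1\<^sub>m m) A B (\<lambda>s t. shift_mult A a (Y s t))"
        by (rule block_ode_shift_mult[OF ode A one A B]) (use A AB in auto)
      show "vec_smooth_decay ini 0 m (\<lambda>s t. shift_mult A a (Y s t))"
        by (rule vec_smooth_decay_shift_mult[OF _ domn_subset(2) fam A Cons.prems(4)]) auto
      fix s t assume st: "s \<in> S" "t \<in> domn"
      show "fold (shift_mult A) as (shift_mult A a (Y s t)) = 0\<^sub>v m"
        using Cons.prems(5)[OF st] by simp
      show "fold (shift_mult B) (b # bs) (shift_mult A a (Y s t)) = 0\<^sub>v m"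
        using shift_mult_fold_shift_mult[OF A B Y[OF st(1) offgrid_gt(3)[OF st(2)]] AB, of a "b # bs"]
          Cons.prems(6)[OF st] fold_shift_mult_zero[OF A, of "[a]"] by simp
    qed (use cont_shift[OF A] Cons.prems(3) A in auto)
    have Z2: "vec_smooth_decay domn 0 m (\<lambda>s t. shift_mult B b (Y s t))"
    proof (rule Cons.IH)
      show "block_ode m (1\<^sub>m m) A B (\<lambda>s t. shift_mult B b (Y s t))"
        by (rule block_ode_shift_mult[OF ode B one A B]) (use B AB in auto)
      show "vec_smooth_decay ini 0 m (\<lambda>s t. shift_mult B b (Y s t))"
        by (rule vec_smooth_decay_shift_mult[OF _ domn_subset(2) fam B Cons.prems(4)]) auto
      fix s t assume st: "s \<in> S" "t \<in> domn"
      show "fold (shift_mult B) bs (shift_mult B b (Y s t)) = 0\<^sub>v m"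
        using Cons.prems(6)[OF st] by simp
      show "fold (shift_mult A) (a # as) (shift_mult B b (Y s t)) = 0\<^sub>v m"
        using shift_mult_fold_shift_mult[OF B A Y[OF st(1) offgrid_gt(3)[OF st(2)]] AB[symmetric], of b "a # as"]
          Cons.prems(5)[OF st] fold_shift_mult_zero[OF B, of "[b]"] by simp
    qed (use cont_shift[OF B] Cons.prems(3) B in auto)
    show ?case
    proof (cases "\<forall>l::complex. l = a + b * exp (- l * \<tau>) \<longrightarrow> Re l < 0")
      case True
      show ?thesis
        unfolding vec_smooth_decay_def smooth_decay.simps
      proof (intro allI impI)
        fix i assume i: "i < m"
        show "decays domn (\<lambda>s t. Y s t $ i)"
        proof (rule retarded_scalar_decay)
          show "decays offgrid (\<lambda>s t. shift_mult A a (Y s t) $ i + shift_mult B b (Y s (t - \<tau>)) $ i)"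
            by (intro decays_add decays_delay[of "\<lambda>s t. shift_mult B b (Y s t) $ i"] decays_subset[of domn _ offgrid])
              (use Z1 Z2 i offgrid_domn(1) in \<open>auto simp: vec_smooth_decay_def\<close>)
          fix s t assume st: "s \<in> S" "t \<in> offgrid"
          have Yc: "Y s t \<in> carrier_vec m" "Y s (t - \<tau>) \<in> carrier_vec m"
            using Y st offgrid_gt by auto
          have "((\<lambda>t. Y s t $ i) has_vector_derivative (A *\<^sub>v Y s t + B *\<^sub>v Y s (t - \<tau>)) $ i) (at t)"
            by (rule has_vector_derivative_transform_within_open[OF block_odeD(2)[OF ode st i], of "{-\<tau><..}"])
              (use offgrid_gt(1)[OF st(2)] Y[OF st(1)] in auto)
          moreover have "(A *\<^sub>v Y s t + B *\<^sub>v Y s (t - \<tau>)) $ i = a * Y s t $ i + b * Y s (t - \<tau>) $ i +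
              (shift_mult A a (Y s t) $ i + shift_mult B b (Y s (t - \<tau>)) $ i)"
            using Yc i A B by (simp add: shift_mult_def)
          ultimately show "((\<lambda>t. Y s t $ i) has_vector_derivative a * Y s t $ i + b * Y s (t - \<tau>) $ i +
              (shift_mult A a (Y s t) $ i + shift_mult B b (Y s (t - \<tau>)) $ i)) (at t)" by simp
        qed (use True Cons.prems(2,4) i in \<open>auto simp: vec_smooth_decay_def\<close>)
      qed
    next
      case False
      then obtain l :: complex where l: "l = a + b * exp (- l * \<tau>)" "Re l \<ge> 0" by force
      define e where "e = exp (- l * \<tau>)"
      \<comment> \<open>Since \<open>l = a + b * e\<close>, this matrix is
        \<open>- (A - a) - e * (B - b)\<close>: it sends \<open>Y\<close> to a combination of the
        functions treated in \<open>Z1\<close> and \<open>Z2\<close>. By \<open>reg\<close> its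
        kernel is trivial, so \<open>Y\<close> is recovered from that combination.\<close>
      define M where "M = l \<cdot>\<^sub>m 1\<^sub>m m - A - e \<cdot>\<^sub>m B"
      have M: "M \<in> carrier_mat m m" using A B by (auto simp: M_def)
      have Mv: "(M *\<^sub>v v) $ i = l * v $ i - (A *\<^sub>v v) $ i - e * (B *\<^sub>v v) $ i"
        if v: "v \<in> carrier_vec m" and i: "i < m" for v i
      proof -
        have "(M *\<^sub>v v) $ i = (\<Sum>j<m. (if j = i then l * v $ i else 0) - A $$ (i, j) * v $ j - e * (B $$ (i, j) * v $ j))"
          unfolding mult_mat_vec_entry[OF M v i]
          by (intro sum.cong) (use A B i in \<open>auto simp: M_def algebra_simps\<close>)
        also have "\<dots> = l * v $ i - (A *\<^sub>v v) $ i - e * (B *\<^sub>v v) $ i"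
          unfolding mult_mat_vec_entry[OF A v i] mult_mat_vec_entry[OF B v i]
          using i by (simp add: sum_subtractf sum_distrib_left)
        finally show ?thesis .
      qed
      obtain Mi where Mi: "Mi \<in> carrier_mat m m" "Mi * M = 1\<^sub>m m"
      proof (rule ex_left_inverse_if_trivial_kernel[OF M])
        fix v :: "complex vec" assume v: "v \<in> carrier_vec m" "M *\<^sub>v v = 0\<^sub>v m"
        show "v = 0\<^sub>v m"
        proof (rule reg[OF l(2) v(1)])
          show "l \<cdot>\<^sub>v v = A *\<^sub>v v + exp (- l * \<tau>) \<cdot>\<^sub>v (B *\<^sub>v v)"
          proof (rule eq_vecI)
            fix i assume "i < dim_vec (A *\<^sub>v v + exp (- l * \<tau>) \<cdot>\<^sub>v (B *\<^sub>v v))"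
            hence i: "i < m" using A B by simp
            have "l * v $ i - (A *\<^sub>v v) $ i - e * (B *\<^sub>v v) $ i = 0"
              using Mv[OF v(1) i] v(2) i by simp
            thus "(l \<cdot>\<^sub>v v) $ i = (A *\<^sub>v v + exp (- l * \<tau>) \<cdot>\<^sub>v (B *\<^sub>v v)) $ i"
              using i v(1) A B by (simp add: e_def algebra_simps)
          qed (use A B v in auto)
        qed
      qed
      have MY: "vec_smooth_decay domn 0 m (\<lambda>s t. M *\<^sub>v Y s t)"
        unfolding vec_smooth_decay_def
      proof (intro allI impI)
        fix i assume i: "i < m"
        show "smooth_decay domn 0 (\<lambda>s t. (M *\<^sub>v Y s t) $ i)"
        proof (rule smooth_decay_cong[OF open_delay_domain[OF tau]])
          show "smooth_decay domn 0 (\<lambda>s t. (- 1) * shift_mult A a (Y s t) $ i + (- e) * shift_mult B b (Y s t) $ i)"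
            using Z1 Z2 i unfolding vec_smooth_decay_def
            by (intro smooth_decay_add smooth_decay_cmult) auto
          fix s t assume st: "s \<in> S" "t \<in> domn"
          have c: "Y s t \<in> carrier_vec m" using Y st offgrid_gt by auto
          have le: "l = a + b * e" using l(1) by (simp add: e_def)
          show "(- 1) * shift_mult A a (Y s t) $ i + (- e) * shift_mult B b (Y s t) $ i = (M *\<^sub>v Y s t) $ i"
            unfolding Mv[OF c i] le using A B i c by (simp add: shift_mult_def algebra_simps)
        qed
      qed
      have "vec_smooth_decay domn 0 m (\<lambda>s t. Mi *\<^sub>v (M *\<^sub>v Y s t))"
        by (rule vec_smooth_decay_mult[OF open_delay_domain[OF tau] domn_subset(1) vec_family_mult[OF fam M] Mi(1) MY])
      moreover have "Mi *\<^sub>v (M *\<^sub>v Y s t) = Y s t" if "s \<in> S" "t \<in> domn" for s t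
        using assoc_mult_mat_vec[of Mi m m M m "Y s t"] Mi M Y that offgrid_gt by simp
      ultimately show ?thesis
        unfolding vec_smooth_decay_def
        by (intro allI impI smooth_decay_cong[OF open_delay_domain[OF tau],
              of "\<lambda>s t. (Mi *\<^sub>v (M *\<^sub>v Y s t)) $ i" "\<lambda>s t. Y s t $ i" for i]) auto
    qed
  qed
qed

end

section \<open>The blocks before normalisation\<close>

lemma inverse_mult_commute:
  fixes J :: "complex mat"
  assumes J: "J \<in> carrier_mat m m" "Ji \<in> carrier_mat m m" "Ji * J = 1\<^sub>m m" "J * Ji = 1\<^sub>m m"
    and M: "M \<in> carrier_mat m m" "J * M = M * J" and N: "N \<in> carrier_mat m m" "J * N = N * J"
    and MN: "M * N = N * M"
  shows "(Ji * M) * (Ji * N) = (Ji * N) * (Ji * M)"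
proof -
  have *: "(Ji * M) * (Ji * N) = Ji * Ji * (M * N)"
    if "M \<in> carrier_mat m m" "J * M = M * J" "N \<in> carrier_mat m m" for M N
  proof -
    have "(Ji * M) * (Ji * N) = Ji * (M * Ji) * N"
      using J(2) that by (simp add: assoc_mult_mat[of _ m m _ m _ m])
    also have "M * Ji = Ji * M" using inverse_mat_commute[OF J(1,2) that(1) J(3,4) that(2)] by simp
    finally show ?thesis using J(2) that(1,3) by (simp add: assoc_mult_mat[of _ m m _ m _ m])
  qed
  show ?thesis using *[OF M N(1)] *[OF N M(1)] MN by simp
qed

lemma mult_vec_cancel_inverse:
  fixes J :: "complex mat"
  assumes "J \<in> carrier_mat m m" "Ji \<in> carrier_mat m m" "J * Ji = 1\<^sub>m m"
    "M \<in> carrier_mat m m" "v \<in> carrier_vec m"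
  shows "J *\<^sub>v ((Ji * M) *\<^sub>v v) = M *\<^sub>v v"
proof -
  have "J *\<^sub>v ((Ji * M) *\<^sub>v v) = J *\<^sub>v (Ji *\<^sub>v (M *\<^sub>v v))"
    using assms by (simp add: assoc_mult_mat_vec[of Ji m m M m])
  also have "\<dots> = (J * Ji) *\<^sub>v (M *\<^sub>v v)"
    using assms by (intro assoc_mult_mat_vec[symmetric]) auto
  finally show ?thesis using assms(3) mult_mat_vec_carrier[OF assms(4,5)] by simp
qed

context delay_family
begin

text \<open>Multiplying by the inverse of \<open>E\<close> normalises the block; multiplying back by
  \<open>E\<close> takes the regularity condition for the normalised coefficients to
  \<open>reg\<close>.\<close>

lemma retarded_part_decay:
  fixes Y :: "'a \<Rightarrow> real \<Rightarrow> complex vec"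
  assumes ode: "block_ode m E A B Y"
    and carr: "E \<in> carrier_mat m m" "A \<in> carrier_mat m m" "B \<in> carrier_mat m m"
    and comm: "E * A = A * E" "E * B = B * E" "A * B = B * A"
    and inv: "invertible_mat E"
    and reg: "\<And>l v. Re l \<ge> 0 \<Longrightarrow> v \<in> carrier_vec m \<Longrightarrow>
      l \<cdot>\<^sub>v (E *\<^sub>v v) = A *\<^sub>v v + exp (- l * \<tau>) \<cdot>\<^sub>v (B *\<^sub>v v) \<Longrightarrow> v = 0\<^sub>v m"
    and cont: "\<And>s i. s \<in> S \<Longrightarrow> i < m \<Longrightarrow> continuous_on {-\<tau>..} (\<lambda>t. Y s t $ i)"
    and start: "\<And>s. s \<in> S \<Longrightarrow> Y s (-\<tau>) \<in> carrier_vec m"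
    and ini: "vec_smooth_decay ini 0 m Y"
  shows "vec_smooth_decay domn 0 m Y"
proof -
  obtain J where J: "J \<in> carrier_mat m m" "J * E = 1\<^sub>m m" "E * J = 1\<^sub>m m"
    using invertible_mat_obtain[OF inv carr(1)] by metis
  have JA: "J * A \<in> carrier_mat m m" and JB: "J * B \<in> carrier_mat m m" using J carr by auto
  obtain as where as: "\<And>v. v \<in> carrier_vec m \<Longrightarrow> fold (shift_mult (J * A)) as v = 0\<^sub>v m"
    using ex_annihilating_eigenvalues[OF JA] by metis
  obtain bs where bs: "\<And>v. v \<in> carrier_vec m \<Longrightarrow> fold (shift_mult (J * B)) bs v = 0\<^sub>v m"
    using ex_annihilating_eigenvalues[OF JB] by metis
  have fam: "Y s t \<in> carrier_vec m" if "s \<in> S" "t \<in> domn" for s t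
    using block_odeD(1)[OF ode] that offgrid_gt by (auto simp: vec_family_def)
  show ?thesis
  proof (rule retarded_block_decay[OF JA JB _ _ _ cont start ini])
    show "J * A * (J * B) = J * B * (J * A)"
      by (rule inverse_mult_commute[OF carr(1) J carr(2) comm(1) carr(3) comm(2,3)])
    show "block_ode m (1\<^sub>m m) (J * A) (J * B) Y"
      using block_ode_mult[OF ode J(1) carr] J(2) by simp
    fix l and v :: "complex vec"
    assume l: "Re l \<ge> 0" and v: "v \<in> carrier_vec m"
      and eq: "l \<cdot>\<^sub>v v = (J * A) *\<^sub>v v + exp (- l * \<tau>) \<cdot>\<^sub>v ((J * B) *\<^sub>v v)"
    have "E *\<^sub>v (l \<cdot>\<^sub>v v) = E *\<^sub>v ((J * A) *\<^sub>v v + exp (- l * \<tau>) \<cdot>\<^sub>v ((J * B) *\<^sub>v v))"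
      using eq by simp
    also have "\<dots> = E *\<^sub>v ((J * A) *\<^sub>v v) + exp (- l * \<tau>) \<cdot>\<^sub>v (E *\<^sub>v ((J * B) *\<^sub>v v))"
      using mult_mat_vec_carrier[OF JA v] mult_mat_vec_carrier[OF JB v] carr(1)
      by (simp add: mult_add_distrib_mat_vec[of E m m] mult_mat_vec[of E m m])
    also have "\<dots> = A *\<^sub>v v + exp (- l * \<tau>) \<cdot>\<^sub>v (B *\<^sub>v v)"
      by (simp only: mult_vec_cancel_inverse[OF carr(1) J(1,3) carr(2) v]
        mult_vec_cancel_inverse[OF carr(1) J(1,3) carr(3) v])
    finally show "v = 0\<^sub>v m"
      using reg[OF l v] carr(1) v by (simp add: mult_mat_vec[of E m m])
  qed (use as bs fam in auto)
qed

text \<open>The difference equation requires every eigenvalue \<open>c\<close> of \<open>D\<close>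
  to have modulus below 1. On an eigenvector in the kernel of \<open>E\<close> the characteristic
  equation becomes \<open>1 + c exp (- \<lambda> \<tau>) = 0\<close>, which is solvable for every
  \<open>c \<noteq> 0\<close>, and the spectral condition locates the solution.\<close>

lemma algebraic_part_decay:
  assumes ode: "block_ode m E A B Y"
    and carr: "E \<in> carrier_mat m m" "A \<in> carrier_mat m m" "B \<in> carrier_mat m m"
    and comm: "E * A = A * E" "E * B = B * E" "A * B = B * A"
    and inv: "invertible_mat A"
    and nil: "\<And>v. v \<in> carrier_vec m \<Longrightarrow> (((*\<^sub>v) E) ^^ Suc p) v = 0\<^sub>v m"
    and reg: "\<And>l v. Re l \<ge> 0 \<Longrightarrow> v \<in> carrier_vec m \<Longrightarrow>
      l \<cdot>\<^sub>v (E *\<^sub>v v) = A *\<^sub>v v + exp (- l * \<tau>) \<cdot>\<^sub>v (B *\<^sub>v v) \<Longrightarrow> v = 0\<^sub>v m"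
    and ini: "vec_smooth_decay ini p m Y"
  shows "vec_smooth_decay domn 0 m Y"
proof -
  obtain J where J: "J \<in> carrier_mat m m" "J * A = 1\<^sub>m m" "A * J = 1\<^sub>m m"
    using invertible_mat_obtain[OF inv carr(2)] by metis
  define D where "D = J * B"
  have JE: "J * E \<in> carrier_mat m m" and D: "D \<in> carrier_mat m m" using J carr by (auto simp: D_def)
  have JEc: "J * E = E * J" using inverse_mat_commute[OF carr(2) J(1) carr(1) J(2,3) comm(1)[symmetric]] .
  have DE: "D * E = E * D"
  proof -
    have "D * E = J * (B * E)" using J carr by (simp add: D_def assoc_mult_mat[of _ m m _ m _ m])
    also have "\<dots> = (J * E) * B" unfolding comm(2)[symmetric] using J carr
      by (simp add: assoc_mult_mat[of _ m m _ m _ m])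
    finally show ?thesis unfolding JEc using J carr by (simp add: D_def assoc_mult_mat[of _ m m _ m _ m])
  qed
  obtain cs where cs: "\<And>c. c \<in> set cs \<Longrightarrow> eigenvalue D c"
    "\<And>v. v \<in> carrier_vec m \<Longrightarrow> fold (shift_mult D) cs v = 0\<^sub>v m"
    using ex_annihilating_eigenvalues[OF D] by metis
  have lt: "cmod c < 1" if c: "c \<in> set cs" for c
  proof (cases "c = 0")
    case False
    obtain v where v: "v \<in> carrier_vec m" "v \<noteq> 0\<^sub>v m" "D *\<^sub>v v = c \<cdot>\<^sub>v v"
      using cs(1)[OF c] D by (auto simp: eigenvalue_def eigenvector_def)
    \<comment> \<open>Moves the eigenvector into the kernel of \<open>E\<close>; as \<open>D\<close>
      commutes with \<open>E\<close>, it remains an eigenvector for \<open>c\<close>.\<close>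
    obtain j where j: "(((*\<^sub>v) E) ^^ j) v \<noteq> 0\<^sub>v m" "E *\<^sub>v (((*\<^sub>v) E) ^^ j) v = 0\<^sub>v m"
      using nilpotent_kernel_in_orbit[OF carr(1) v(1,2) nil[OF v(1)]] by metis
    define w where "w = (((*\<^sub>v) E) ^^ j) v"
    have w: "w \<in> carrier_vec m" unfolding w_def by (rule funpow_mult_mat_vec_carrier[OF carr(1) v(1)])
    have "D *\<^sub>v w = (((*\<^sub>v) E) ^^ j) (c \<cdot>\<^sub>v v)"
      unfolding w_def funpow_mult_mat_vec_commute[OF D carr(1) v(1) DE, symmetric] v(3) ..
    also have "\<dots> = c \<cdot>\<^sub>v w" unfolding w_def
    proof (induction j)
      case (Suc j)
      thus ?case using carr(1) funpow_mult_mat_vec_carrier[OF carr(1) v(1), of j]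
        by (simp add: mult_mat_vec[of E m m])
    qed simp
    finally have Dw: "D *\<^sub>v w = c \<cdot>\<^sub>v w" .
    \<comment> \<open>A solution of \<open>exp (- l * \<tau>) = - 1 / c\<close>. Once
      \<open>Re l < 0\<close> is known, the left side has modulus above 1.\<close>
    define l where "l = - Ln (- 1 / c) / \<tau>"
    have e: "exp (- l * \<tau>) = - 1 / c"
      using False tau by (simp add: l_def)
    have "B *\<^sub>v w = A *\<^sub>v (D *\<^sub>v w)"
      unfolding D_def using mult_vec_cancel_inverse[OF carr(2) J(1,3) carr(3) w] by simp
    hence "B *\<^sub>v w = c \<cdot>\<^sub>v (A *\<^sub>v w)" unfolding Dw using carr(2) w by (simp add: mult_mat_vec[of A m m])
    hence "A *\<^sub>v w + exp (- l * \<tau>) \<cdot>\<^sub>v (B *\<^sub>v w) = 0\<^sub>v m"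
      unfolding e using False w carr(2) by (intro eq_vecI) auto
    moreover have "l \<cdot>\<^sub>v (E *\<^sub>v w) = 0\<^sub>v m" unfolding w_def j(2) by (intro eq_vecI) auto
    ultimately have "\<not> Re l \<ge> 0" using reg[of l w] w j(1) by (auto simp: w_def)
    hence "- Re l * \<tau> > 0" using tau by (simp add: mult_neg_pos)
    hence "cmod (exp (- l * \<tau>)) > 1" by simp
    thus ?thesis unfolding e using False by (simp add: norm_divide field_simps)
  qed simp
  have fam: "Y s t \<in> carrier_vec m" if "s \<in> S" "t \<in> domn" for s t
    using block_odeD(1)[OF ode] that offgrid_gt by (auto simp: vec_family_def)
  show ?thesis
  proof (rule nilpotent_block_decay[OF JE D _ lt, where k = p])
    show "J * E * D = D * (J * E)" unfolding D_def
      by (rule inverse_mult_commute[OF carr(2) J carr(1) comm(1)[symmetric] carr(3) comm(3) comm(2)])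
    show "block_ode m (J * E) (1\<^sub>m m) D Y"
      using block_ode_mult[OF ode J(1) carr] J(2) by (simp add: D_def)
    fix a t assume "a \<in> S" "t \<in> domn"
    thus "(((*\<^sub>v) (J * E)) ^^ Suc p) (Y a t) = 0\<^sub>v m"
      by (intro nilpotent_mult_mat_vec[OF J(1) carr(1) JEc nil] fam)
  qed (use cs(2) fam ini in auto)
qed

lemma advanced_part_decay:
  assumes ode: "block_ode m E A B Y"
    and carr: "E \<in> carrier_mat m m" "A \<in> carrier_mat m m" "B \<in> carrier_mat m m"
    and comm: "E * A = A * E" "E * B = B * E" "A * B = B * A"
    and inv: "invertible_mat B" and nil: "nilpotent_mat E" "nilpotent_mat A"
  shows "vec_smooth_decay domn 0 m Y"
proof -
  obtain J where J: "J \<in> carrier_mat m m" "J * B = 1\<^sub>m m" "B * J = 1\<^sub>m m"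
    using invertible_mat_obtain[OF inv carr(3)] by metis
  have JE: "J * E \<in> carrier_mat m m" and JA: "J * A \<in> carrier_mat m m" using J carr by auto
  obtain k l where k: "\<And>v. v \<in> carrier_vec m \<Longrightarrow> (((*\<^sub>v) E) ^^ k) v = 0\<^sub>v m"
    and l: "\<And>v. v \<in> carrier_vec m \<Longrightarrow> (((*\<^sub>v) A) ^^ l) v = 0\<^sub>v m"
    using nilpotent_mat_obtain[OF nil(1) carr(1)] nilpotent_mat_obtain[OF nil(2) carr(2)] by metis
  have fam: "Y s t \<in> carrier_vec m" if "s \<in> S" "t \<in> domn" for s t
    using block_odeD(1)[OF ode] that offgrid_gt by (auto simp: vec_family_def)
  have "Y s t = 0\<^sub>v m" if "s \<in> S" "t \<in> domn" for s t
  proof (rule advanced_block_vanishes[OF JE JA _ _ _ _ that, where k = k and l = l])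
    show "J * E * (J * A) = J * A * (J * E)"
      by (rule inverse_mult_commute[OF carr(3) J carr(1) comm(2)[symmetric] carr(2) comm(3)[symmetric] comm(1)])
    show "block_ode m (J * E) (J * A) (1\<^sub>m m) Y"
      using block_ode_mult[OF ode J(1) carr] J(2) by simp
    fix a t assume "a \<in> S" "t \<in> domn"
    note Y = fam[OF this]
    show "(((*\<^sub>v) (J * E)) ^^ k) (Y a t) = 0\<^sub>v m"
      by (rule nilpotent_mult_mat_vec[OF J(1) carr(1)
            inverse_mat_commute[OF carr(3) J(1) carr(1) J(2,3) comm(2)[symmetric]] k Y])
    show "(((*\<^sub>v) (J * A)) ^^ l) (Y a t) = 0\<^sub>v m"
      by (rule nilpotent_mult_mat_vec[OF J(1) carr(2)
            inverse_mat_commute[OF carr(3) J(1) carr(2) J(2,3) comm(3)[symmetric]] l Y])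
  qed
  thus ?thesis by (intro vec_smooth_decay_vanishing open_delay_domain tau)
qed

text \<open>Every \<open>t \<ge> 0\<close> is a limit from the right of times off the grid, so
  continuity extends the estimate to the grid points.\<close>

lemma vec_decay_bound:
  fixes Y :: "'a \<Rightarrow> real \<Rightarrow> complex vec"
  assumes dec: "vec_smooth_decay domn 0 n Y"
    and cont: "\<And>a i. a \<in> S \<Longrightarrow> i < n \<Longrightarrow> continuous_on {-\<tau>..} (\<lambda>t. Y a t $ i)"
  obtains C \<gamma> where "C \<ge> 0" "\<gamma> > 0"
    "\<And>a t. a \<in> S \<Longrightarrow> t \<ge> 0 \<Longrightarrow> (\<Sum>i<n. cmod (Y a t $ i)) \<le> C * K a * exp (- \<gamma> * t)"
proof -
  \<comment> \<open>The moduli are cast back to complex numbers so that closure of decay under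
    finite sums applies to them.\<close>
  have "decays domn (\<lambda>a t. complex_of_real (cmod (Y a t $ i)))" if "i < n" for i
    using dec that by (auto simp: vec_smooth_decay_def decays_def)
  hence "smooth_decay domn 0 (\<lambda>a t. \<Sum>i<n. complex_of_real (cmod (Y a t $ i)))"
    by (intro smooth_decay_sum) auto
  then obtain C \<gamma> where C: "C \<ge> 0" "\<gamma> > 0"
    "\<And>a t. a \<in> S \<Longrightarrow> t \<in> domn \<Longrightarrow> -\<tau> < t \<Longrightarrow>
      cmod (\<Sum>i<n. complex_of_real (cmod (Y a t $ i))) \<le> C * K a * exp (- \<gamma> * t)"
    unfolding smooth_decay.simps decays_def by blast
  show thesis
  proof (rule that[OF C(1,2)])
    fix a and t0 :: real assume a: "a \<in> S" and t0: "t0 \<ge> 0"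
    define h where "h = (\<lambda>t. \<Sum>i<n. cmod (Y a t $ i))"
    have "continuous_on {-\<tau>..} h"
      unfolding h_def by (intro continuous_intros cont[OF a]) auto
    hence "isCont h t0" using tau t0 by (intro continuous_on_interior[of "{-\<tau>..}"]) auto
    hence "(h \<longlongrightarrow> h t0) (at_right t0)"
      by (simp add: continuous_within filterlim_at_split)
    moreover have "((\<lambda>t. C * K a * exp (- \<gamma> * t)) \<longlongrightarrow> C * K a * exp (- \<gamma> * t0)) (at_right t0)"
      by (intro tendsto_intros)
    moreover have "eventually (\<lambda>t. h t \<le> C * K a * exp (- \<gamma> * t)) (at_right t0)"
    proof -
      define k where "k = nat \<lfloor>t0 / \<tau>\<rfloor>"
      have "t0 / \<tau> \<ge> 0" using t0 tau by simp
      hence "real k \<le> t0 / \<tau>" "t0 / \<tau> < real (Suc k)"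
        unfolding k_def by linarith+
      hence k: "real k * \<tau> \<le> t0" "t0 < real (Suc k) * \<tau>"
        using tau by (simp_all only: pos_le_divide_eq pos_divide_less_eq)
      have "h t \<le> C * K a * exp (- \<gamma> * t)" if t: "t0 < t" "t < real (Suc k) * \<tau>" for t
      proof -
        have "t \<in> offgrid"
          unfolding off_grid_eq[OF tau] using k(1) t by (intro UN_I[of k]) auto
        hence "cmod (complex_of_real (h t)) \<le> C * K a * exp (- \<gamma> * t)"
          using C(3)[OF a offgrid_domn(1) offgrid_gt(1)] by (simp add: h_def)
        thus ?thesis by simp
      qed
      thus ?thesis using eventually_at_right[OF k(2)] k(2) by blast
    qed
    ultimately show "(\<Sum>i<n. cmod (Y a t0 $ i)) \<le> C * K a * exp (- \<gamma> * t0)"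
      unfolding h_def by (intro tendsto_le[OF trivial_limit_at_right_real])
  qed
qed

end

section \<open>Norms of vectors and of initial functions\<close>

lemma cmod_le_vnorm: "i < dim_vec (v :: complex vec) \<Longrightarrow> cmod (v $ i) \<le> vnorm v"
  unfolding vnorm_def
  by (rule real_le_rsqrt) (use member_le_sum[of i "{..<dim_vec v}" "\<lambda>i. (cmod (v $ i))\<^sup>2"] in auto)

lemma vnorm_le_sum: "(v :: complex vec) \<in> carrier_vec n \<Longrightarrow> vnorm v \<le> (\<Sum>i<n. cmod (v $ i))"
  using L2_set_le_sum[of "{..<n}" "\<lambda>i. cmod (v $ i)"] by (simp add: vnorm_def L2_set_def)

lemma Cp_family_carrier:
  assumes "Cp_family n \<tau> p D" "\<And>t. t \<in> {-\<tau>..0} \<Longrightarrow> D 0 t \<in> carrier_vec n" "i \<le> p" "t \<in> {-\<tau>..0}"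
  shows "D i t \<in> carrier_vec n"
  using assms by (cases i) (auto simp: Cp_family_def has_vec_deriv_def)

text \<open>A real supremum dominates its members only over a bounded set; continuity on the compact
  interval provides the bound.\<close>

lemma Cp_norm_bounds:
  assumes tau: "\<tau> > 0" and D: "Cp_family n \<tau> p D" "\<And>t. t \<in> {-\<tau>..0} \<Longrightarrow> D 0 t \<in> carrier_vec n"
  shows "0 \<le> Cp_norm \<tau> p D"
    and "i \<le> p \<Longrightarrow> t \<in> {-\<tau>..0} \<Longrightarrow> vnorm (D i t) \<le> Cp_norm \<tau> p D"
proof -
  have le: "vnorm (D i t) \<le> (SUP t\<in>{-\<tau>..0}. vnorm (D i t))" if i: "i \<le> p" "t \<in> {-\<tau>..0}" for i t
  proof (rule cSUP_upper[OF i(2)])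
    have "continuous_on {-\<tau>..0} (\<lambda>t. vnorm (D i t))"
    proof (rule continuous_on_eq)
      show "continuous_on {-\<tau>..0} (\<lambda>t. sqrt (\<Sum>j<n. (cmod (D i t $ j))\<^sup>2))"
        using D(1) i(1) by (intro continuous_intros) (auto simp: Cp_family_def vcont_on_def)
      fix t assume "t \<in> {-\<tau>..0}"
      from Cp_family_carrier[OF D i(1) this]
      show "sqrt (\<Sum>j<n. (cmod (D i t $ j))\<^sup>2) = vnorm (D i t)" by (simp add: vnorm_def)
    qed
    thus "bdd_above ((\<lambda>t. vnorm (D i t)) ` {-\<tau>..0})"
      by (intro bounded_imp_bdd_above compact_imp_bounded compact_continuous_image) auto
  qed
  have vn: "0 \<le> vnorm v" for v by (simp add: vnorm_def sum_nonneg)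
  have pos: "0 \<le> (SUP t\<in>{-\<tau>..0}. vnorm (D i t))" if "i \<le> p" for i
    using order_trans[OF vn le[OF that, of 0]] tau by simp
  show "0 \<le> Cp_norm \<tau> p D" unfolding Cp_norm_def by (intro sum_nonneg pos) auto
  assume i: "i \<le> p" "t \<in> {-\<tau>..0}"
  have "(SUP t\<in>{-\<tau>..0}. vnorm (D i t)) \<le> Cp_norm \<tau> p D"
    unfolding Cp_norm_def using i pos by (intro member_le_sum) auto
  thus "vnorm (D i t) \<le> Cp_norm \<tau> p D" using le[OF i] by linarith
qed

section \<open>Stability of the delay differential-algebraic equation\<close>

text \<open>The exponent is \<open>p + 1\<close> since a matrix whose power \<open>p + 1\<close>
  vanishes costs \<open>p\<close> derivatives. A zero block is the case \<open>p = 0\<close>, where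
  the norm is the supremum norm; the nilpotency index is an admissible \<open>p\<close> as
  well.\<close>

lemma weak_exp_stable_if_nilpotent:
  fixes n n1 n2 n3 n4 :: nat and \<tau> :: real
    and E A B U V JE N2E N3E N4E A1 JA N3A N4A B1 B2 JB N4B :: "complex mat"
  assumes tau: "\<tau> > 0"
    and carr: "E \<in> carrier_mat n n" "A \<in> carrier_mat n n" "B \<in> carrier_mat n n"
    and comm: "E * A = A * E" "E * B = B * E" "A * B = B * A"
    and U: "U \<in> carrier_mat n n" "V \<in> carrier_mat n n" "inverts_mat U V" "inverts_mat V U"
    and blocks1: "JE \<in> carrier_mat n1 n1" "A1 \<in> carrier_mat n1 n1" "B1 \<in> carrier_mat n1 n1"
    and blocks2: "N2E \<in> carrier_mat n2 n2" "JA \<in> carrier_mat n2 n2" "B2 \<in> carrier_mat n2 n2"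
    and blocks3: "N3E \<in> carrier_mat n3 n3" "N3A \<in> carrier_mat n3 n3" "JB \<in> carrier_mat n3 n3"
    and blocks4: "N4E \<in> carrier_mat n4 n4" "N4A \<in> carrier_mat n4 n4" "N4B \<in> carrier_mat n4 n4"
    and dim: "n1 + n2 + n3 + n4 = n"
    and UE: "U * E * V = diag_block_mat [JE, N2E, N3E, N4E]"
    and UA: "U * A * V = diag_block_mat [A1, JA, N3A, N4A]"
    and UB: "U * B * V = diag_block_mat [B1, B2, JB, N4B]"
    and nonsing: "invertible_mat JE" "invertible_mat JA" "invertible_mat JB"
    and nilp: "nilpotent_mat N3E" "nilpotent_mat N4E"
              "nilpotent_mat N3A" "nilpotent_mat N4A" "nilpotent_mat N4B"
    and spec: "ddae_spectrum E A B \<tau> \<subseteq> {z. Re z < 0}"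
    and N2E: "N2E ^\<^sub>m Suc p = 0\<^sub>m n2 n2"
  shows "weak_exp_stable n E A B \<tau> p"
proof -
  \<comment> \<open>The family is indexed by all pairs of an initial function with its derivatives
    and a solution, weighted by the \<open>C^p\<close> norm; decay of this one family is uniform
    stability.\<close>
  define S where "S = {(D, x). Cp_family n \<tau> p D \<and> ddae_solution n E A B \<tau> (\<lambda>_. 0\<^sub>v n) (D 0) x}"
  define K where "K = (\<lambda>(D, x :: real \<Rightarrow> complex vec). Cp_norm \<tau> p D)"
  define X :: "(nat \<Rightarrow> real \<Rightarrow> complex vec) \<times> (real \<Rightarrow> complex vec) \<Rightarrow> real \<Rightarrow> complex vec"
    where "X = snd"
  have Cp: "Cp_family n \<tau> p (fst a)" and sol: "ddae_solution n E A B \<tau> (\<lambda>_. 0\<^sub>v n) (fst a 0) (X a)"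
    if "a \<in> S" for a using that by (auto simp: S_def X_def)
  have Xcarr: "X a t \<in> carrier_vec n" if "a \<in> S" "-\<tau> \<le> t" for a t
    using sol[OF that(1)] that(2) by (auto simp: ddae_solution_def)
  have Xini: "X a t = fst a 0 t" if "a \<in> S" "t \<in> {-\<tau>..0}" for a t
    using sol[OF that(1)] that(2) by (auto simp: ddae_solution_def)
  have D0: "fst a 0 t \<in> carrier_vec n" if "a \<in> S" "t \<in> {-\<tau>..0}" for a t
    using Xcarr[OF that(1), of t] Xini[OF that] that(2) by simp
  have Xcont: "continuous_on {-\<tau>..} (\<lambda>t. X a t $ i)" if "a \<in> S" "i < n" for a i
    using sol[OF that(1)] that(2) by (auto simp: ddae_solution_def vcont_on_def)
  have K: "K a = Cp_norm \<tau> p (fst a)" for a by (simp add: K_def case_prod_beta)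
  interpret delay_family \<tau> S K
  proof
    show "K a \<ge> 0" if "a \<in> S" for a
      unfolding K by (rule Cp_norm_bounds(1)[OF tau Cp[OF that] D0[OF that]])
  qed (rule tau)
  have ode: "block_ode n E A B X"
    unfolding block_ode_def vec_family_def
  proof (intro conjI ballI allI impI)
    fix a t i assume a: "a \<in> S" and t: "t \<in> offgrid" and i: "i < n"
    have "has_vec_deriv n (\<lambda>s. E *\<^sub>v X a s) (A *\<^sub>v X a t + B *\<^sub>v X a (t - \<tau>) + 0\<^sub>v n) t UNIV"
      using sol[OF a] t by (auto simp: ddae_solution_def off_grid_def)
    moreover have "A *\<^sub>v X a t + B *\<^sub>v X a (t - \<tau>) \<in> carrier_vec n"
      using carr Xcarr[OF a, of t] Xcarr[OF a, of "t - \<tau>"] offgrid_gt(1,2)[OF t] by auto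
    ultimately show "((\<lambda>s. (E *\<^sub>v X a s) $ i) has_vector_derivative
        (A *\<^sub>v X a t + B *\<^sub>v X a (t - \<tau>)) $ i) (at t)"
      using i by (simp add: has_vec_deriv_def)
  qed (use Xcarr in auto)
  have smooth: "vec_smooth_decay ini p n X"
    unfolding vec_smooth_decay_def
  proof (intro allI impI)
    fix i assume i: "i < n"
    \<comment> \<open>For \<open>t < 0\<close> the factor \<open>exp (- t)\<close> is at least 1, so
      on the initial interval boundedness is decay at any rate.\<close>
    have dec_ini: "decays ini (\<lambda>a t. fst a j t $ i)" if j: "j \<le> p" for j
    proof (rule decaysI[of 1 1])
      fix a t assume a: "a \<in> S" and t: "t \<in> ini"
      have "fst a j t \<in> carrier_vec n"
        by (rule Cp_family_carrier[OF Cp[OF a] D0[OF a] j]) (use t in auto)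
      hence "cmod (fst a j t $ i) \<le> vnorm (fst a j t)" using i by (intro cmod_le_vnorm) auto
      also have "\<dots> \<le> K a" unfolding K
        by (rule Cp_norm_bounds(2)[OF tau Cp[OF a] D0[OF a] j]) (use t in auto)
      also have "\<dots> \<le> 1 * K a * exp (- 1 * t)"
        using t K_nonneg[OF a] by (simp add: mult_le_cancel_left1)
      finally show "cmod (fst a j t $ i) \<le> 1 * K a * exp (- 1 * t)" .
    qed auto
    \<comment> \<open>Downward from the highest derivative: the function with \<open>q\<close>
      derivatives left is the one of order \<open>p - q\<close>.\<close>
    have "smooth_decay ini q (\<lambda>a t. fst a (p - q) t $ i)" if "q \<le> p" for q
      using that
    proof (induction q)
      case 0
      have "decays ini (\<lambda>a t. fst a p t $ i)"
        by (rule dec_ini) simp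
      thus ?case by simp
    next
      case (Suc q)
      have "((\<lambda>t. fst a (p - Suc q) t $ i) has_vector_derivative fst a (p - q) t $ i) (at t)"
        if a: "a \<in> S" and t: "t \<in> ini"
        for a :: "(nat \<Rightarrow> real \<Rightarrow> complex vec) \<times> (real \<Rightarrow> complex vec)" and t
      proof -
        have "has_vec_deriv n (fst a (p - Suc q)) (fst a (Suc (p - Suc q)) t) t {-\<tau>..0}"
          using Cp[OF a] Suc.prems t by (simp add: Cp_family_def)
        moreover have "Suc (p - Suc q) = p - q" using Suc.prems by simp
        moreover have "at t within {-\<tau>..0} = at t"
          by (rule at_within_interior) (use t in auto)
        ultimately show ?thesis using i by (simp add: has_vec_deriv_def)
      qed
      moreover have "smooth_decay ini q (\<lambda>a t. fst a (p - q) t $ i)" using Suc by simp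
      ultimately show ?case
        unfolding smooth_decay.simps using dec_ini[of "p - Suc q"] by (meson diff_le_self)
    qed
    from this[OF order_refl] show "smooth_decay ini p (\<lambda>a t. X a t $ i)"
      by (rule smooth_decay_cong[rotated 2]) (use Xini in auto)
  qed
  let ?W = "block_rows U" and ?Z = "block_cols V"
  have UV: "U * V = 1\<^sub>m n" "V * U = 1\<^sub>m n"
    using U by (auto simp: inverts_mat_def)
  have part: "block_ode m Ep Ap Bp (\<lambda>a t. ?W k m *\<^sub>v X a t)"
      "Ep * Ap = Ap * Ep" "Ep * Bp = Bp * Ep" "Ap * Bp = Bp * Ap"
      "\<And>l v. Re l \<ge> 0 \<Longrightarrow> v \<in> carrier_vec m \<Longrightarrow>
        l \<cdot>\<^sub>v (Ep *\<^sub>v v) = Ap *\<^sub>v v + exp (- l * \<tau>) \<cdot>\<^sub>v (Bp *\<^sub>v v) \<Longrightarrow> v = 0\<^sub>v m"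
    if E': "block_at n k m (U * E * V) Ep" and A': "block_at n k m (U * A * V) Ap"
      and B': "block_at n k m (U * B * V) Bp" for k m Ep Ap Bp
  proof -
    have km: "k + m \<le> n" "Ep \<in> carrier_mat m m" "Ap \<in> carrier_mat m m" "Bp \<in> carrier_mat m m"
      using E' A' B' by (auto simp: block_at_def)
    have W: "?W k m \<in> carrier_mat m n" and Z: "?Z k m \<in> carrier_mat n m" using U by auto
    have WZ: "?W k m * ?Z k m = 1\<^sub>m m" by (rule block_rows_block_cols[OF U(1,2) UV(1) km(1)])
    note iE = block_intertwine[OF U(1,2) UV carr(1) E']
    note iA = block_intertwine[OF U(1,2) UV carr(2) A']
    note iB = block_intertwine[OF U(1,2) UV carr(3) B']
    show "block_ode m Ep Ap Bp (\<lambda>a t. ?W k m *\<^sub>v X a t)"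
      by (rule block_ode_intertwine[OF ode W carr km(2-4) iE(1) iA(1) iB(1)])
    show "Ep * Ap = Ap * Ep"
      by (rule intertwined_commute[OF W Z WZ carr(1) km(2) iE(1) carr(2) km(3) iA(1) comm(1)])
    show "Ep * Bp = Bp * Ep"
      by (rule intertwined_commute[OF W Z WZ carr(1) km(2) iE(1) carr(3) km(4) iB(1) comm(2)])
    show "Ap * Bp = Bp * Ap"
      by (rule intertwined_commute[OF W Z WZ carr(2) km(3) iA(1) carr(3) km(4) iB(1) comm(3)])
    show "v = 0\<^sub>v m" if "Re l \<ge> 0" "v \<in> carrier_vec m"
      "l \<cdot>\<^sub>v (Ep *\<^sub>v v) = Ap *\<^sub>v v + exp (- l * \<tau>) \<cdot>\<^sub>v (Bp *\<^sub>v v)" for l v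
      by (rule block_spectrum_regular[OF spec carr W Z WZ km(2) iE(2) km(3) iA(2) km(4) iB(2) that])
  qed
  have Wsmooth: "vec_smooth_decay ini q m (\<lambda>a t. ?W k m *\<^sub>v X a t)" if "q \<le> p" for k m q
  proof -
    have "vec_smooth_decay ini q n X"
      using smooth that smooth_decay_le unfolding vec_smooth_decay_def by blast
    thus ?thesis
      by (intro vec_smooth_decay_mult[OF _ domn_subset(2) block_odeD(1)[OF ode]]) (use U in auto)
  qed
  note blkE = block_at_diag_block_mat[OF blocks1(1) blocks2(1) blocks3(1) blocks4(1) dim, folded UE]
  note blkA = block_at_diag_block_mat[OF blocks1(2) blocks2(2) blocks3(2) blocks4(2) dim, folded UA]
  note blkB = block_at_diag_block_mat[OF blocks1(3) blocks2(3) blocks3(3) blocks4(3) dim, folded UB]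
  have 1: "vec_smooth_decay domn 0 n1 (\<lambda>a t. ?W 0 n1 *\<^sub>v X a t)"
  proof (rule retarded_part_decay[OF part(1)[OF blkE(1) blkA(1) blkB(1)] blocks1
        part(2-4)[OF blkE(1) blkA(1) blkB(1)] nonsing(1) part(5)[OF blkE(1) blkA(1) blkB(1)]])
    show "vec_smooth_decay ini 0 n1 (\<lambda>a t. ?W 0 n1 *\<^sub>v X a t)" by (rule Wsmooth) simp
    show "?W 0 n1 *\<^sub>v X a (-\<tau>) \<in> carrier_vec n1" if "a \<in> S" for a
      using Xcarr[OF that, of "-\<tau>"] U by (intro mult_mat_vec_carrier[of _ n1 n]) auto
    show "continuous_on {-\<tau>..} (\<lambda>t. (?W 0 n1 *\<^sub>v X a t) $ i)" if a: "a \<in> S" and i: "i < n1" for a i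
    proof (rule continuous_on_eq)
      show "continuous_on {-\<tau>..} (\<lambda>t. \<Sum>j<n. ?W 0 n1 $$ (i, j) * X a t $ j)"
        using Xcont[OF a] by (intro continuous_intros) auto
      fix t assume "t \<in> {-\<tau>..}"
      thus "(\<Sum>j<n. ?W 0 n1 $$ (i, j) * X a t $ j) = (?W 0 n1 *\<^sub>v X a t) $ i"
        using mult_mat_vec_entry[OF block_rows_carrier[OF U(1)] Xcarr[OF a] i] by simp
    qed
  qed
  have 2: "vec_smooth_decay domn 0 n2 (\<lambda>a t. ?W n1 n2 *\<^sub>v X a t)"
  proof (rule algebraic_part_decay[OF part(1)[OF blkE(2) blkA(2) blkB(2)] blocks2
        part(2-4)[OF blkE(2) blkA(2) blkB(2)] nonsing(2) _ part(5)[OF blkE(2) blkA(2) blkB(2)]])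
    show "vec_smooth_decay ini p n2 (\<lambda>a t. ?W n1 n2 *\<^sub>v X a t)" by (rule Wsmooth) simp
    show "(((*\<^sub>v) N2E) ^^ Suc p) v = 0\<^sub>v n2" if v: "v \<in> carrier_vec n2" for v
      unfolding pow_mat_mult_vec[OF blocks2(1) v, symmetric] N2E using v by (intro eq_vecI) auto
  qed
  have 3: "vec_smooth_decay domn 0 n3 (\<lambda>a t. ?W (n1 + n2) n3 *\<^sub>v X a t)"
    by (rule advanced_part_decay[OF part(1)[OF blkE(3) blkA(3) blkB(3)] blocks3
          part(2-4)[OF blkE(3) blkA(3) blkB(3)] nonsing(3) nilp(1,3)])
  have 4: "n4 = 0"
  proof (rule nilpotent_block_empty[OF blocks4 part(2-4)[OF blkE(4) blkA(4) blkB(4)] nilp(2,4,5)])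
    fix v :: "complex vec"
    assume "v \<in> carrier_vec n4" "N4E *\<^sub>v v = 0\<^sub>v n4" "N4A *\<^sub>v v = 0\<^sub>v n4" "N4B *\<^sub>v v = 0\<^sub>v n4"
    \<comment> \<open>With all three products zero, the equation in the regularity condition holds
      at every \<open>l\<close>; 0 is picked.\<close>
    thus "v = 0\<^sub>v n4"
      by (intro part(5)[OF blkE(4) blkA(4) blkB(4), of 0]) (auto intro!: eq_vecI)
  qed
  have UX: "vec_smooth_decay domn 0 n (\<lambda>a t. U *\<^sub>v X a t)"
    unfolding vec_smooth_decay_def
  proof (intro allI impI)
    fix i assume i: "i < n"
    have pick: "smooth_decay domn 0 (\<lambda>a t. (U *\<^sub>v X a t) $ (k + j))"
      if W: "vec_smooth_decay domn 0 m (\<lambda>a t. ?W k m *\<^sub>v X a t)" and j: "j < m" "k + m \<le> n" for k m j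
    proof (rule smooth_decay_cong[OF open_delay_domain[OF tau]])
      show "smooth_decay domn 0 (\<lambda>a t. (?W k m *\<^sub>v X a t) $ j)"
        using W j by (auto simp: vec_smooth_decay_def)
      show "(?W k m *\<^sub>v X a t) $ j = (U *\<^sub>v X a t) $ (k + j)" if "a \<in> S" "t \<in> domn" for a t
        using Xcarr[OF that(1), of t] offgrid_gt(3)[OF that(2)]
        by (intro block_rows_mult_vec[OF U(1) _ j]) auto
    qed
    consider "i < n1" | "n1 \<le> i" "i < n1 + n2" | "n1 + n2 \<le> i" "i < n1 + n2 + n3"
      using i 4 dim by linarith
    thus "smooth_decay domn 0 (\<lambda>a t. (U *\<^sub>v X a t) $ i)"
    proof cases
      case 1
      thus ?thesis using pick[OF \<open>vec_smooth_decay domn 0 n1 _\<close>, of i] dim by simp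
    next
      case 2
      thus ?thesis using pick[OF \<open>vec_smooth_decay domn 0 n2 _\<close>, of "i - n1"] dim by simp
    next
      case 3
      thus ?thesis using pick[OF \<open>vec_smooth_decay domn 0 n3 _\<close>, of "i - (n1 + n2)"] dim by simp
    qed
  qed
  have "vec_smooth_decay domn 0 n (\<lambda>a t. V *\<^sub>v (U *\<^sub>v X a t))"
    by (rule vec_smooth_decay_mult[OF open_delay_domain[OF tau] domn_subset(1)
          vec_family_mult[OF block_odeD(1)[OF ode] U(1)] U(2) UX])
  moreover have VU: "V *\<^sub>v (U *\<^sub>v X a t) = X a t" if "a \<in> S" "t \<in> domn" for a t
    using assoc_mult_mat_vec[of V n n U n "X a t"] U UV Xcarr[OF that(1), of t] offgrid_gt(3)[OF that(2)]
    by simp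
  ultimately have "vec_smooth_decay domn 0 n X"
    unfolding vec_smooth_decay_def
    by (intro allI impI smooth_decay_cong[OF open_delay_domain[OF tau],
          of "\<lambda>a t. (V *\<^sub>v (U *\<^sub>v X a t)) $ i" "\<lambda>a t. X a t $ i" for i]) auto
  from vec_decay_bound[OF this Xcont] obtain C \<gamma> where C: "C \<ge> 0" "\<gamma> > 0"
    "\<And>a t. a \<in> S \<Longrightarrow> t \<ge> 0 \<Longrightarrow> (\<Sum>i<n. cmod (X a t $ i)) \<le> C * K a * exp (- \<gamma> * t)"
    by metis
  show ?thesis
    unfolding weak_exp_stable_def
  \<comment> \<open>\<open>C\<close> may be 0, while stability asks for a positive constant.\<close>
  proof (rule exI[of _ "C + 1"], intro exI[of _ \<gamma>] conjI allI impI)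
    fix D x t
    assume D: "Cp_family n \<tau> p D" "ddae_solution n E A B \<tau> (\<lambda>_. 0\<^sub>v n) (D 0) x" and t: "0 \<le> (t :: real)"
    have S: "(D, x) \<in> S" using D by (simp add: S_def)
    have "vnorm (x t) \<le> (\<Sum>i<n. cmod (X (D, x) t $ i))"
      using vnorm_le_sum[OF Xcarr[OF S, of t]] t tau by (simp add: X_def)
    also have "\<dots> \<le> C * K (D, x) * exp (- \<gamma> * t)" by (rule C(3)[OF S t])
    also have "\<dots> \<le> (C + 1) * K (D, x) * exp (- \<gamma> * t)"
      using K_nonneg[OF S] by (intro mult_right_mono) auto
    finally show "vnorm (x t) \<le> (C + 1) * exp (- \<gamma> * t) * Cp_norm \<tau> p D"
      by (simp add: K mult_ac)
  qed (use C in auto)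
qed

theorem theorem7:
  fixes n n1 n2 n3 n4 :: nat and \<tau> :: real
    and E A B U V JE N2E N3E N4E A1 JA N3A N4A B1 B2 JB N4B :: "complex mat"
  assumes tau: "\<tau> > 0"
    and carr: "E \<in> carrier_mat n n" "A \<in> carrier_mat n n" "B \<in> carrier_mat n n"
    and comm: "E * A = A * E" "E * B = B * E" "A * B = B * A"
    and uniq: "\<And>f \<phi> x y. ddae_solution n E A B \<tau> f \<phi> x \<Longrightarrow> ddae_solution n E A B \<tau> f \<phi> y
                 \<Longrightarrow> \<forall>t\<ge>-\<tau>. x t = y t"
    and U: "U \<in> carrier_mat n n" "V \<in> carrier_mat n n" "inverts_mat U V" "inverts_mat V U"
    and blocks1: "JE \<in> carrier_mat n1 n1" "A1 \<in> carrier_mat n1 n1" "B1 \<in> carrier_mat n1 n1"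
    and blocks2: "N2E \<in> carrier_mat n2 n2" "JA \<in> carrier_mat n2 n2" "B2 \<in> carrier_mat n2 n2"
    and blocks3: "N3E \<in> carrier_mat n3 n3" "N3A \<in> carrier_mat n3 n3" "JB \<in> carrier_mat n3 n3"
    and blocks4: "N4E \<in> carrier_mat n4 n4" "N4A \<in> carrier_mat n4 n4" "N4B \<in> carrier_mat n4 n4"
    and dim: "n1 + n2 + n3 + n4 = n"
    and UE: "U * E * V = diag_block_mat [JE, N2E, N3E, N4E]"
    and UA: "U * A * V = diag_block_mat [A1, JA, N3A, N4A]"
    and UB: "U * B * V = diag_block_mat [B1, B2, JB, N4B]"
    and nonsing: "invertible_mat JE" "invertible_mat JA" "invertible_mat JB"
    and nilp: "nilpotent_mat N2E" "nilpotent_mat N3E" "nilpotent_mat N4E"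
              "nilpotent_mat N3A" "nilpotent_mat N4A" "nilpotent_mat N4B"
  shows "(ddae_spectrum E A B \<tau> \<subseteq> {z. Re z < 0} \<and> N2E = 0\<^sub>m n2 n2
            \<longrightarrow> exp_stable n E A B \<tau>)
       \<and> (ddae_spectrum E A B \<tau> \<subseteq> {z. Re z < 0}
            \<longrightarrow> weak_exp_stable n E A B \<tau> (nilpotency_index N2E))"
proof -
  note setting = tau carr comm U blocks1 blocks2 blocks3 blocks4 dim UE UA UB nonsing nilp(2-6)
  have "exp_stable n E A B \<tau>" if spec: "ddae_spectrum E A B \<tau> \<subseteq> {z. Re z < 0}" and N: "N2E = 0\<^sub>m n2 n2"
  proof -
    have "N2E ^\<^sub>m Suc 0 = 0\<^sub>m n2 n2" using N by simp
    from weak_exp_stable_if_nilpotent[OF setting spec this]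
    obtain \<delta> \<gamma> where "\<delta> > 0" "\<gamma> > 0" and *: "\<And>D x t. Cp_family n \<tau> 0 D \<Longrightarrow>
        ddae_solution n E A B \<tau> (\<lambda>_. 0\<^sub>v n) (D 0) x \<Longrightarrow> t \<ge> 0 \<Longrightarrow>
        vnorm (x t) \<le> \<delta> * exp (-\<gamma> * t) * Cp_norm \<tau> 0 D"
      unfolding weak_exp_stable_def by blast
    moreover have "vnorm (x t) \<le> \<delta> * exp (-\<gamma> * t) * (SUP s\<in>{-\<tau>..0}. vnorm (\<phi> s))"
      if "vcont_on n {-\<tau>..0} \<phi>" "ddae_solution n E A B \<tau> (\<lambda>_. 0\<^sub>v n) \<phi> x" "t \<ge> 0" for \<phi> x t
      \<comment> \<open>For \<open>p = 0\<close> only member 0 of the family enters, and the norm is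
        the supremum norm of \<open>\<phi>\<close>.\<close>
      using *[of "\<lambda>_. \<phi>" x t] that by (simp add: Cp_family_def Cp_norm_def)
    ultimately show ?thesis unfolding exp_stable_def by blast
  qed
  moreover have "weak_exp_stable n E A B \<tau> (nilpotency_index N2E)"
    if spec: "ddae_spectrum E A B \<tau> \<subseteq> {z. Re z < 0}"
  proof (rule weak_exp_stable_if_nilpotent[OF setting spec])
    obtain k where "N2E ^\<^sub>m k = 0\<^sub>m (dim_row N2E) (dim_col N2E)"
      using nilp(1) by (auto simp: nilpotent_mat_def)
    hence "N2E ^\<^sub>m nilpotency_index N2E = 0\<^sub>m (dim_row N2E) (dim_col N2E)"
      unfolding nilpotency_index_def by (rule LeastI)
    thus "N2E ^\<^sub>m Suc (nilpotency_index N2E) = 0\<^sub>m n2 n2"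
      using blocks2(1) by simp
  qed
  ultimately show ?thesis by blast
qed

end
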